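(* For each sample size $n$, let $\mathcal H$ be a Euclidean space or a real separable Hilbert space, $s>0$ real with $n\ge m=\lceil s\rceil-1\ge2$, $\theta\in\mathcal H$, $f:\mathcal H\to\mathbb R$ a function that is $m$ times Fréchet differentiable at $\theta$, with derivatives $f^{(k)}(\theta)$, $1\le k\le m$, that are symmetric $k$-linear forms of finite spectral norm, and $x_j=\theta+\varepsilon_j\in\mathcal H$, $1\le j\le n$, independent observations with $\mathbb E[\varepsilon_j]=0$; all quantities ($\mathcal H$, $f$, $s$, $\theta$, the noise law, $\sigma$, $r(\Sigma)$, $C_0$) may depend on $n$. Let $\widehat f$, $\sigma$, $r(\Sigma)$, $V_1$ be as defined in the context. Suppose (i) $\max_{2\le k<s}\|f^{(k)}(\theta)\|_{\rm S}\le C_0$ and $\|f\|_{(s),\theta}\le C_0$; (ii) $C_0\max\{\sigma^2r(\Sigma)^{1/2}/n,\ (\sigma^2r(\Sigma)/n)^{s/2}\}\ll(V_1/n)^{1/2}$ and $s=O(1)$ as $n\to\infty$; (iii) the Lindeberg condition holds for $\{\langle f^{(1)}(\theta),\varepsilon_j\rangle,\ j\le n\}$. Then $$n^{1/2}\big(\widehat f-f(\theta)\big)/V_1^{1/2}\Rightarrow\mathcal N(0,1)\quad\text{as }n\to\infty.$$ The same asymptotic normality still holds when $s=O(1)$ in (ii) is weakened to $s^2\le n$ and (i) is replaced by: $\max_{2\le k<s}\|f^{(k)}(\theta)\|_{\rm S}/d^{k/2}\le C_0$ and $\|f\|_{(s),\mathrm{HS},\theta}\le C_0d^{m/2}$,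 with any fixed positive real number $d$.
   Context: $f^{(k)}(x)$ is the $k$-th Fréchet derivative, a symmetric $k$-linear form; the derivatives of $f$ at points other than $\theta$ that enter the quantities below are understood to exist. $\langle T,v_1\otimes\cdots\otimes v_k\rangle_k=T(v_1,\dots,v_k)$, extended linearly. $\|T\|_{\rm S}=\sup_{\|h_1\|=\cdots=\|h_k\|=1}|T(h_1,\dots,h_k)|$; $\|T\|_{\rm HS}=(\sum_{i_1,\dots,i_k}T(e_{i_1},\dots,e_{i_k})^2)^{1/2}$ for an orthonormal basis $(e_i)$ of $\mathcal H$. With $m=\lceil s\rceil-1$: $\|f\|_{(s),\theta}=\sup_{\|h\|>0}\|f^{(m)}(\theta+h)-f^{(m)}(\theta)\|_{\rm S}/\|h\|^{s-m}$ and $\|f\|_{(s),\mathrm{HS},\theta}=\sup_{\|h\|>0}\|f^{(m)}(\theta+h)-f^{(m)}(\theta)\|_{\rm HS}/\|h\|^{s-m}$. Estimator: with $\bar x=n^{-1}\sum_jx_j$, $$\widehat f=f(\bar x)+\sum_{k=1}^m\frac{\langle f^{(k)}(\bar x),\bar u^{(k)}\rangle_k}{k!},\qquad\bar u^{(k)}=\sum_{1\le j_1\neq\cdots\neq j_k\le n}\frac{(x_{j_1}-\bar x)\otimes\cdots\otimes(x_{j_k}-\bar x)}{n(n-1)\cdots(n-k+1)}$$ (indices pairwise distinct). $\Sigma=\mathbb E[n^{-1}\sum_{j=1}^n\varepsilon_j\otimes\varepsilon_j]$ (second moments finite, so that $\Sigma$ is defined), $\sigma=\|\Sigma\|_{\rm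 S}^{1/2}>0$, $r(\Sigma)=\mathrm{trace}(\Sigma)/\sigma^2$, and $V_1=\langle f^{(1)}(\theta)\otimes f^{(1)}(\theta),\Sigma\rangle_2=n^{-1}\sum_{j=1}^n\mathbb E[\langle f^{(1)}(\theta),\varepsilon_j\rangle^2]>0$. $a_n\ll b_n$ means $a_n/b_n\to0$. Lindeberg condition: for every $\eta>0$, $\frac1{nV_1}\sum_{j=1}^n\mathbb E\big[\langle f^{(1)}(\theta),\varepsilon_j\rangle^2\,\mathbf 1\{|\langle f^{(1)}(\theta),\varepsilon_j\rangle|>\eta\sqrt{nV_1}\}\big]\to0$. "$\Rightarrow$" denotes convergence in distribution. *)

theory Defs
  imports "HOL-Probability.Probability" "HOL-Library.Landau_Symbols"
begin

text \<open>
  The Hilbert space of the model may change with the sample size, which a type cannot do. It is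
  therefore a closed subspace \<open>H\<close> of an ambient separable Hilbert space \<open>'a\<close>. A \<open>k\<close>-linear form on
  \<open>H\<close> is a function on lists; only its values on the lists of length \<open>k\<close> with entries in \<open>H\<close> are
  meaningful.
\<close>

type_synonym 'a form = "'a list \<Rightarrow> real"

definition multilinear_form :: "'a::real_vector set \<Rightarrow> nat \<Rightarrow> 'a form \<Rightarrow> bool" where
  "multilinear_form H k T \<longleftrightarrow>
     (\<forall>hs i u v a b. length hs = k \<and> set hs \<subseteq> H \<and> i < k \<and> u \<in> H \<and> v \<in> H \<longrightarrow>
        T (hs[i := a *\<^sub>R u + b *\<^sub>R v]) = a * T (hs[i := u]) + b * T (hs[i := v]))"

definition symmetric_form :: "'a set \<Rightarrow> nat \<Rightarrow> 'a form \<Rightarrow> bool" where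
  "symmetric_form H k T \<longleftrightarrow>
     (\<forall>hs hs'. length hs = k \<and> set hs \<subseteq> H \<and> mset hs' = mset hs \<longrightarrow> T hs' = T hs)"

definition spec_norm :: "'a::real_normed_vector set \<Rightarrow> nat \<Rightarrow> 'a form \<Rightarrow> ereal" where
  "spec_norm H k T =
     (SUP hs \<in> {hs. length hs = k \<and> (\<forall>h\<in>set hs. h \<in> H \<and> norm h = 1)}. ereal \<bar>T hs\<bar>)"

definition orthonormal_basis :: "'a::real_inner set \<Rightarrow> 'a set \<Rightarrow> bool" where
  "orthonormal_basis H B \<longleftrightarrow>
     B \<subseteq> H \<and> pairwise orthogonal B \<and> (\<forall>e\<in>B. norm e = 1) \<and> H \<subseteq> closure (span B)"

text \<open>The square root of the (possibly infinite) sum of squares, as a supremum of finite partial sums.\<close>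

definition hs_norm :: "'a set \<Rightarrow> nat \<Rightarrow> 'a form \<Rightarrow> ereal" where
  "hs_norm B k T =
     (SUP F \<in> {F. finite F \<and> F \<subseteq> {es. length es = k \<and> set es \<subseteq> B}}. ereal (L2_set T F))"

text \<open>
  \<open>T\<close>, read as the map sending \<open>h\<close> to the \<open>k\<close>-linear form \<open>T(h, \<dots>)\<close>, is the Frechet derivative at
  \<open>x\<close> of \<open>A\<close>, a map from \<open>H\<close> to the space of bounded \<open>k\<close>-linear forms normed by \<open>spec_norm\<close>.
\<close>

definition has_form_derivative ::
    "'a::real_normed_vector set \<Rightarrow> nat \<Rightarrow> ('a \<Rightarrow> 'a form) \<Rightarrow> 'a form \<Rightarrow> 'a \<Rightarrow> bool" where
  "has_form_derivative H k A T x \<longleftrightarrow>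
     multilinear_form H (Suc k) T \<and> spec_norm H (Suc k) T < \<infinity> \<and>
     ((\<lambda>y. spec_norm H k (\<lambda>hs. A y hs - A x hs - T ((y - x) # hs)) / ereal (norm (y - x)))
        \<longlongrightarrow> 0) (at x within H)"

text \<open>Where the derivative exists, the choice is unique on lists with entries in \<open>H\<close>.\<close>

primrec fderiv ::
    "'a::real_normed_vector set \<Rightarrow> ('a \<Rightarrow> real) \<Rightarrow> nat \<Rightarrow> 'a \<Rightarrow> 'a form" where
  "fderiv H f 0 = (\<lambda>x hs. f x)"
| "fderiv H f (Suc k) = (\<lambda>x. SOME T. has_form_derivative H k (fderiv H f k) T x)"

definition times_differentiable_on ::
    "nat \<Rightarrow> 'a::real_normed_vector set \<Rightarrow> ('a \<Rightarrow> real) \<Rightarrow> bool" where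
  "times_differentiable_on m H f \<longleftrightarrow>
     (\<forall>x\<in>H. \<forall>k<m. \<exists>T. has_form_derivative H k (fderiv H f k) T x)"

definition smooth_order :: "real \<Rightarrow> nat" where
  "smooth_order s = nat (\<lceil>s\<rceil> - 1)"

definition holder_seminorm ::
    "'a::real_normed_vector set \<Rightarrow> ('a \<Rightarrow> real) \<Rightarrow> real \<Rightarrow> 'a \<Rightarrow> ereal" where
  "holder_seminorm H f s \<theta> =
     (let m = smooth_order s in
      SUP h \<in> {h \<in> H. norm h > 0}.
        spec_norm H m (\<lambda>hs. fderiv H f m (\<theta> + h) hs - fderiv H f m \<theta> hs)
          / ereal (norm h powr (s - real m)))"

definition holder_seminorm_HS ::
    "'a::real_normed_vector set \<Rightarrow> 'a set \<Rightarrow> ('a \<Rightarrow> real) \<Rightarrow> real \<Rightarrow> 'a \<Rightarrow> ereal" where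
  "holder_seminorm_HS H B f s \<theta> =
     (let m = smooth_order s in
      SUP h \<in> {h \<in> H. norm h > 0}.
        hs_norm B m (\<lambda>hs. fderiv H f m (\<theta> + h) hs - fderiv H f m \<theta> hs)
          / ereal (norm h powr (s - real m)))"

definition sample_mean :: "nat \<Rightarrow> (nat \<Rightarrow> 'a::real_vector) \<Rightarrow> 'a" where
  "sample_mean n x = (1 / real n) *\<^sub>R (\<Sum>j=1..n. x j)"

text \<open>
  The pairing of a \<open>k\<close>-linear form \<open>T\<close> with the average of the tensors
  \<open>(x j\<^sub>1 - xbar) \<otimes> \<dots> \<otimes> (x j\<^sub>k - xbar)\<close> over pairwise distinct indices, by linearity.
\<close>

definition ubar_pairing :: "nat \<Rightarrow> (nat \<Rightarrow> 'a::real_vector) \<Rightarrow> nat \<Rightarrow> 'a form \<Rightarrow> real" where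
  "ubar_pairing n x k T =
     (\<Sum>js | length js = k \<and> distinct js \<and> set js \<subseteq> {1..n}.
        T (map (\<lambda>j. x j - sample_mean n x) js)) / (\<Prod>i<k. real n - real i)"

definition estimator ::
    "'a::real_normed_vector set \<Rightarrow> ('a \<Rightarrow> real) \<Rightarrow> real \<Rightarrow> nat \<Rightarrow> (nat \<Rightarrow> 'a) \<Rightarrow> real" where
  "estimator H f s n x =
     f (sample_mean n x) +
     (\<Sum>k=1..smooth_order s. ubar_pairing n x k (fderiv H f k (sample_mean n x)) / fact k)"

text \<open>The tensor \<open>v\<^sub>1 \<otimes> \<dots> \<otimes> v\<^sub>k\<close> as the \<open>k\<close>-linear form it represents under the inner product.\<close>

definition tensor_form :: "'a::real_inner list \<Rightarrow> 'a form" where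
  "tensor_form vs hs = prod_list (map2 (\<bullet>) vs hs)"

definition cov_form :: "'w measure \<Rightarrow> nat \<Rightarrow> (nat \<Rightarrow> 'w \<Rightarrow> 'a::real_inner) \<Rightarrow> 'a form" where
  "cov_form M n \<epsilon> hs =
     (\<integral>\<omega>. (1 / real n) * (\<Sum>j=1..n. tensor_form [\<epsilon> j \<omega>, \<epsilon> j \<omega>] hs) \<partial>M)"

definition noise_level ::
    "'a::real_inner set \<Rightarrow> 'w measure \<Rightarrow> nat \<Rightarrow> (nat \<Rightarrow> 'w \<Rightarrow> 'a) \<Rightarrow> real" where
  "noise_level H M n \<epsilon> = sqrt (real_of_ereal (spec_norm H 2 (cov_form M n \<epsilon>)))"

definition form_trace :: "'a set \<Rightarrow> 'a form \<Rightarrow> real" where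
  "form_trace B T = (\<Sum>\<^sub>\<infinity>e\<in>B. T [e, e])"

definition effective_rank ::
    "'a::real_inner set \<Rightarrow> 'a set \<Rightarrow> 'w measure \<Rightarrow> nat \<Rightarrow> (nat \<Rightarrow> 'w \<Rightarrow> 'a) \<Rightarrow> real" where
  "effective_rank H B M n \<epsilon> = form_trace B (cov_form M n \<epsilon>) / (noise_level H M n \<epsilon>)\<^sup>2"

definition lin_noise ::
    "'a::real_normed_vector set \<Rightarrow> ('a \<Rightarrow> real) \<Rightarrow> 'a \<Rightarrow> (nat \<Rightarrow> 'w \<Rightarrow> 'a) \<Rightarrow> nat \<Rightarrow> 'w \<Rightarrow> real" where
  "lin_noise H f \<theta> \<epsilon> j \<omega> = fderiv H f 1 \<theta> [\<epsilon> j \<omega>]"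

definition V1 ::
    "'a::real_normed_vector set \<Rightarrow> ('a \<Rightarrow> real) \<Rightarrow> 'a \<Rightarrow> 'w measure \<Rightarrow> nat \<Rightarrow> (nat \<Rightarrow> 'w \<Rightarrow> 'a) \<Rightarrow> real"
  where
  "V1 H f \<theta> M n \<epsilon> = (1 / real n) * (\<Sum>j=1..n. \<integral>\<omega>. (lin_noise H f \<theta> \<epsilon> j \<omega>)\<^sup>2 \<partial>M)"

definition lindeberg_condition ::
    "(nat \<Rightarrow> 'w measure) \<Rightarrow> (nat \<Rightarrow> real) \<Rightarrow> (nat \<Rightarrow> nat \<Rightarrow> 'w \<Rightarrow> real) \<Rightarrow> bool" where
  "lindeberg_condition M V g \<longleftrightarrow>
     (\<forall>\<eta>>0. (\<lambda>n. (1 / (real n * V n)) *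
        (\<Sum>j=1..n. \<integral>\<omega>. (g n j \<omega>)\<^sup>2 *
            indicator {\<omega>. \<bar>g n j \<omega>\<bar> > \<eta> * sqrt (real n * V n)} \<omega> \<partial>M n)) \<longlonglongrightarrow> 0)"

end

theory Submission
  imports Defs "HOL-Combinatorics.Permutations"
begin

text \<open>
  Write \<open>\<delta>\<close> for the mean of the noise and \<open>y j = \<epsilon> j - \<delta>\<close>. Expanding \<open>f\<^sup>(\<^sup>k\<^sup>)(\<theta> + \<delta>)\<close> around \<open>\<theta>\<close> and
  collecting terms of equal degree, the polynomial part of the estimator becomes
  \<open>f \<theta> + \<Sum>k. U k / k!\<close>, where \<open>U k\<close> is the U-statistic that averages
  \<open>f\<^sup>(\<^sup>k\<^sup>)(\<theta>)(\<epsilon> j\<^sub>1, \<dots>, \<epsilon> j\<^sub>k)\<close> over distinct indices: the centring at the sample mean is undone by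
  the binomial theorem. All averages over distinct indices are written as averages over permutations
  of \<open>{1..n}\<close>. \<open>U 1\<close> is the linear term, to which the Lindeberg theorem applies. For \<open>k \<ge> 2\<close>, \<open>U k\<close>
  is completely degenerate, so its kernels are orthogonal and its second moment is at most
  \<open>k! \<parallel>f\<^sup>(\<^sup>k\<^sup>)(\<theta>)\<parallel>\<^sup>2 \<sigma>\<^sup>2 trace(\<Sigma>)\<^sup>k\<^sup>-\<^sup>1 / n\<^sup>k\<close> up to a constant, one slot being measured by the spectral norm
  of the covariance and the others by its trace.

  The Taylor remainder involves the increment \<open>D\<close> of the derivative of order \<open>m\<close>, evaluated at
  copies of \<open>\<delta>\<close> and at some \<open>y j\<close> with distinct indices. Since \<open>\<Sum>j. y j = 0\<close>, every index that occurs
  only once can be traded for a repeated one, which leaves \<open>(\<Sum>j. \<parallel>y j\<parallel>\<^sup>2)\<close> to the power of half the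
  number of slots; this is the bound by the spectral norm, with a constant that is bounded when \<open>s\<close> is.
  Under the Hilbert-Schmidt hypothesis \<open>y j = \<epsilon> j - \<delta>\<close> is expanded and the sums over the \<open>\<epsilon> j\<close> are
  handled by the Cauchy-Schwarz inequality, which turns them into averages of products of
  inner products whose means vanish unless the indices match. Both give
  \<open>(\<sigma>\<^sup>2 r(\<Sigma>) / n)\<^sup>s\<^sup>/\<^sup>2\<close> in probability, and Slutsky's argument concludes.
\<close>

section \<open>Averages over permutations\<close>

text \<open>The increment \<open>D\<close> is a random form: it is taken at an intermediate point
  \<open>t *\<^sub>R \<delta> \<omega>\<close> that depends on the whole sample, so independence is
  of no use while \<open>D\<close> and the \<open>y j\<close> stand together. The spectral bound is
  deterministic and rests on the centring identity alone; the Hilbert-Schmidt bound separates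
  \<open>D\<close> from the noise tensor by Cauchy-Schwarz and takes moments only afterwards. Both
  treat \<open>D\<close> as one fixed multilinear form, so \<open>t\<close> must be common to all
  index tuples: Taylor's formula is applied to the whole average and not to its terms. Only second
  moments are assumed. Products over distinct indices stay integrable by independence, but a power
  of order \<open>s\<close> of the norm of \<open>\<delta>\<close> need not be; hence a Markov
  cut-off at \<open>K\<close> times a mean, with \<open>K\<close> fixed while \<open>n\<close>
  grows. All orders can be added because the second moment of \<open>U k\<close> carries
  \<open>k!\<close> against the square of \<open>1 / k!\<close>, and the series of
  \<open>d ^ k / sqrt (k!)\<close> converges for every \<open>d\<close>. The condition
  \<open>s^2 \<le> n\<close> serves to keep \<open>n ^ l\<close> within twice the falling
  factorial.\<close>

definition ffact :: "nat \<Rightarrow> nat \<Rightarrow> real" where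
  "ffact n k = (\<Prod>i<k. real n - real i)"

text \<open>Expectation under a uniformly random permutation: slot \<open>i\<close> of a U-statistic
  receives observation \<open>p i\<close>, so the first \<open>k\<close> slots carry a uniformly
  random tuple of distinct indices. Slots are then relabelled by composing \<open>p\<close> on the
  right, and a single slot is redrawn by a transposition.\<close>

definition perm_avg :: "nat \<Rightarrow> ((nat \<Rightarrow> nat) \<Rightarrow> real) \<Rightarrow> real" where
  "perm_avg n h = (\<Sum>p | p permutes {1..n}. h p) / fact n"

lemma ffact_0 [simp]: "ffact n 0 = 1"
  by (simp add: ffact_def)

lemma ffact_Suc: "ffact n (Suc k) = ffact n k * (real n - real k)"
  by (simp add: ffact_def)

lemma ffact_pos: "k \<le> n \<Longrightarrow> 0 < ffact n k"
  unfolding ffact_def by (intro prod_pos) auto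

lemma ffact_self: "ffact n n = fact n"
proof -
  have "ffact n n = (\<Prod>i<n. real (n - i))"
    unfolding ffact_def by (intro prod.cong) (auto simp: of_nat_diff)
  also have "\<dots> = fact n"
    by (simp add: fact_prod_rev atLeast0LessThan)
  finally show ?thesis .
qed

lemma perm_avg_add: "perm_avg n (\<lambda>p. h p + g p) = perm_avg n h + perm_avg n g"
  by (simp add: perm_avg_def sum.distrib add_divide_distrib)

lemma perm_avg_cmult: "perm_avg n (\<lambda>p. c * h p) = c * perm_avg n h"
  by (simp add: perm_avg_def sum_distrib_left)

lemma perm_avg_divide: "perm_avg n (\<lambda>p. h p / c) = perm_avg n h / c"
  by (simp add: perm_avg_def sum_divide_distrib[symmetric])

lemma perm_avg_sum: "perm_avg n (\<lambda>p. \<Sum>a\<in>A. h a p) = (\<Sum>a\<in>A. perm_avg n (h a))"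
  unfolding perm_avg_def by (subst sum.swap) (simp add: sum_divide_distrib)

lemma perm_avg_const [simp]: "perm_avg n (\<lambda>p. c) = c"
  using card_permutations[of "{1..n}" n] by (simp add: perm_avg_def)

lemma perm_avg_cong:
  "(\<And>p. p permutes {1..n} \<Longrightarrow> h p = g p) \<Longrightarrow> perm_avg n h = perm_avg n g"
  by (simp add: perm_avg_def)

lemma perm_avg_mono:
  "(\<And>p. p permutes {1..n} \<Longrightarrow> h p \<le> g p) \<Longrightarrow> perm_avg n h \<le> perm_avg n g"
  unfolding perm_avg_def by (intro divide_right_mono sum_mono) auto

lemma perm_avg_abs_le: "\<bar>perm_avg n h\<bar> \<le> perm_avg n (\<lambda>p. \<bar>h p\<bar>)"
  unfolding perm_avg_def by (simp add: divide_right_mono sum_abs)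

lemma perm_avg_compose:
  assumes "\<pi> permutes {1..n}"
  shows "perm_avg n (\<lambda>p. h (p \<circ> \<pi>)) = perm_avg n h"
  unfolding perm_avg_def using sum_permutations_compose_right[OF assms, of h] by simp

lemma perm_avg_resample:
  assumes I: "I \<subseteq> {1..n}" and t: "t \<in> {1..n} - I"
  shows "perm_avg n h =
    perm_avg n (\<lambda>p. (\<Sum>i\<in>{1..n} - I. h (p \<circ> Transposition.transpose t i)) / (real n - real (card I)))"
proof -
  have fin: "finite I" using I finite_subset by auto
  have c: "real (card ({1..n} - I)) = real n - real (card I)"
    using I fin by (simp add: card_Diff_subset of_nat_diff card_mono[of "{1..n}" I, simplified])
  have "{1..n} - I \<noteq> {}" using t by blast
  then have "card ({1..n} - I) > 0" by (simp only: card_gt_0_iff) simp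
  then have pos: "real n - real (card I) > 0" using c by linarith
  have "perm_avg n (\<lambda>p. \<Sum>i\<in>{1..n} - I. h (p \<circ> Transposition.transpose t i)) =
        (\<Sum>i\<in>{1..n} - I. perm_avg n (\<lambda>p. h (p \<circ> Transposition.transpose t i)))"
    by (rule perm_avg_sum)
  also have "\<dots> = (\<Sum>i\<in>{1..n} - I. perm_avg n h)"
    using t by (intro sum.cong refl perm_avg_compose permutes_swap_id) auto
  also have "\<dots> = (real n - real (card I)) * perm_avg n h" using c by simp
  finally show ?thesis using pos by (simp add: perm_avg_divide)
qed

lemma sum_outside_permuted:
  assumes "p permutes {1..n}" "I \<subseteq> {1..n}"
  shows "(\<Sum>i\<in>{1..n} - I. g (p i)) = (\<Sum>j\<in>{1..n} - p ` I. g j)"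
proof -
  have inj: "inj p" using assms(1) by (rule permutes_inj)
  have "p ` ({1..n} - I) = {1..n} - p ` I"
    using permutes_image[OF assms(1)] image_set_diff[OF inj] by simp
  then show ?thesis
    using sum.reindex[of p "{1..n} - I" g] inj by (simp add: inj_on_def comp_def)
qed

text \<open>Drawing without replacement costs only the falling factorial in place of a power of
  \<open>n\<close>: the slots are redrawn one at a time, and since \<open>g\<close> is nonnegative
  the sum over the still free indices is at most the full sum.\<close>

lemma perm_avg_prod_le:
  assumes "I \<subseteq> {1..n}" and nn: "\<And>t j. t \<in> I \<Longrightarrow> j \<in> {1..n} \<Longrightarrow> 0 \<le> g t j"
  shows "perm_avg n (\<lambda>p. \<Prod>t\<in>I. g t (p t)) \<le> (\<Prod>t\<in>I. \<Sum>j=1..n. g t j) / ffact n (card I)"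
proof -
  have "finite I" using assms(1) finite_subset by auto
  then show ?thesis using assms
  proof (induction I rule: finite_induct)
    case empty
    then show ?case by simp
  next
    case (insert t I)
    have cI: "card (insert t I) \<le> n"
      using card_mono[OF _ insert.prems(1)] by simp
    have pos: "real n - real (card I) > 0" using cI insert.hyps by simp
    have fp: "ffact n (card I) > 0" using cI insert.hyps by (intro ffact_pos) simp
    have t: "t \<in> {1..n}" and I: "I \<subseteq> {1..n}" using insert.prems by auto
    have IH: "perm_avg n (\<lambda>p. \<Prod>t\<in>I. g t (p t)) \<le> (\<Prod>t\<in>I. \<Sum>j=1..n. g t j) / ffact n (card I)"
      using insert.prems by (intro insert.IH) auto
    have "perm_avg n (\<lambda>p. \<Prod>t\<in>insert t I. g t (p t)) =
      perm_avg n (\<lambda>p. (\<Sum>i\<in>{1..n} - I. \<Prod>s\<in>insert t I. g s ((p \<circ> Transposition.transpose t i) s))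
         / (real n - real (card I)))"
      using t insert.hyps I by (intro perm_avg_resample) auto
    also have "\<dots> \<le> perm_avg n (\<lambda>p. ((\<Sum>j=1..n. g t j) / (real n - real (card I)))
         * (\<Prod>s\<in>I. g s (p s)))"
    proof (rule perm_avg_mono)
      fix p assume p: "p permutes {1..n}"
      have pin: "p i \<in> {1..n}" if "i \<in> {1..n}" for i using permutes_in_image[OF p] that by simp
      have "(\<Sum>i\<in>{1..n} - I. \<Prod>s\<in>insert t I. g s ((p \<circ> Transposition.transpose t i) s)) =
            (\<Sum>i\<in>{1..n} - I. g t (p i) * (\<Prod>s\<in>I. g s (p s)))"
      proof (intro sum.cong refl)
        fix i assume i: "i \<in> {1..n} - I"
        have "(\<Prod>s\<in>I. g s (p (Transposition.transpose t i s))) = (\<Prod>s\<in>I. g s (p s))"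
          using i insert.hyps by (intro prod.cong refl) (auto simp: Transposition.transpose_def)
        then show "(\<Prod>s\<in>insert t I. g s ((p \<circ> Transposition.transpose t i) s)) = g t (p i) * (\<Prod>s\<in>I. g s (p s))"
          using insert.hyps by simp
      qed
      also have "\<dots> = (\<Sum>i\<in>{1..n} - I. g t (p i)) * (\<Prod>s\<in>I. g s (p s))"
        by (simp add: sum_distrib_right)
      also have "\<dots> \<le> (\<Sum>j=1..n. g t j) * (\<Prod>s\<in>I. g s (p s))"
      proof (rule mult_right_mono)
        show "(\<Sum>i\<in>{1..n} - I. g t (p i)) \<le> (\<Sum>j=1..n. g t j)"
          unfolding sum_outside_permuted[OF p I]
          using insert.prems by (intro sum_mono2) auto
        show "0 \<le> (\<Prod>s\<in>I. g s (p s))"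
          using insert.prems I by (intro prod_nonneg) (auto intro!: insert.prems(2) pin simp del: atLeastAtMost_iff)
      qed
      finally show "(\<Sum>i\<in>{1..n} - I. \<Prod>s\<in>insert t I. g s ((p \<circ> Transposition.transpose t i) s))
           / (real n - real (card I))
        \<le> (\<Sum>j=1..n. g t j) / (real n - real (card I)) * (\<Prod>s\<in>I. g s (p s))"
        using pos by (simp add: divide_right_mono)
    qed
    also have "\<dots> = ((\<Sum>j=1..n. g t j) / (real n - real (card I)))
         * perm_avg n (\<lambda>p. \<Prod>s\<in>I. g s (p s))"
      by (rule perm_avg_cmult)
    also have "\<dots> \<le> ((\<Sum>j=1..n. g t j) / (real n - real (card I)))
         * ((\<Prod>t\<in>I. \<Sum>j=1..n. g t j) / ffact n (card I))"
      using IH pos t insert.prems by (intro mult_left_mono divide_nonneg_pos sum_nonneg) auto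
    also have "\<dots> = (\<Prod>t\<in>insert t I. \<Sum>j=1..n. g t j) / ffact n (card (insert t I))"
      using insert.hyps by (simp add: ffact_Suc)
    finally show ?case .
  qed
qed

text \<open>A random set is drawn slot by slot: once the slots in \<open>I\<close> lie in
  \<open>A\<close>, \<open>card A - card I\<close> of the remaining \<open>n - card I\<close>
  indices are admissible for the next one. If \<open>A\<close> is too small, the numerator contains
  the factor zero.\<close>

lemma perm_avg_image_subset:
  assumes "I \<subseteq> {1..n}" "A \<subseteq> {1..n}"
  shows "perm_avg n (\<lambda>p. of_bool (p ` I \<subseteq> A)) = ffact (card A) (card I) / ffact n (card I)"
proof -
  have "finite I" using assms(1) finite_subset by auto
  then show ?thesis using assms(1)
  proof (induction I rule: finite_induct)
    case empty
    then show ?case by simp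
  next
    case (insert t I)
    have finA: "finite A" using assms(2) finite_subset by auto
    have t: "t \<in> {1..n}" and I: "I \<subseteq> {1..n}" using insert.prems by auto
    have "perm_avg n (\<lambda>p. of_bool (p ` insert t I \<subseteq> A)) =
      perm_avg n (\<lambda>p. (\<Sum>i\<in>{1..n} - I. of_bool ((p \<circ> Transposition.transpose t i) ` insert t I \<subseteq> A))
         / (real n - real (card I)))"
      using t insert.hyps I by (intro perm_avg_resample) auto
    also have "\<dots> = perm_avg n (\<lambda>p. ((real (card A) - real (card I)) / (real n - real (card I)))
         * of_bool (p ` I \<subseteq> A))"
    proof (rule perm_avg_cong)
      fix p assume p: "p permutes {1..n}"
      have "(\<Sum>i\<in>{1..n} - I. of_bool ((p \<circ> Transposition.transpose t i) ` insert t I \<subseteq> A)) =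
            (\<Sum>i\<in>{1..n} - I. of_bool (p ` I \<subseteq> A) * (of_bool (p i \<in> A) :: real))"
      proof (intro sum.cong refl)
        fix i assume i: "i \<in> {1..n} - I"
        have "(\<lambda>s. p (Transposition.transpose t i s)) ` I = p ` I"
          using i insert.hyps by (intro image_cong refl) (auto simp: Transposition.transpose_def)
        then show "of_bool ((p \<circ> Transposition.transpose t i) ` insert t I \<subseteq> A) =
           of_bool (p ` I \<subseteq> A) * (of_bool (p i \<in> A) :: real)"
          by auto
      qed
      also have "\<dots> = of_bool (p ` I \<subseteq> A) * (\<Sum>j\<in>{1..n} - p ` I. of_bool (j \<in> A))"
        unfolding sum_distrib_left[symmetric] by (subst sum_outside_permuted[OF p I]) simp
      also have "\<dots> = of_bool (p ` I \<subseteq> A) * (real (card A) - real (card I))"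
      proof (cases "p ` I \<subseteq> A")
        case True
        have "({1..n} - p ` I) \<inter> {j. j \<in> A} = A - p ` I" using assms(2) by auto
        then have "(\<Sum>j\<in>{1..n} - p ` I. of_bool (j \<in> A)) = real (card (A - p ` I))"
          by (simp add: of_bool_def sum.If_cases)
        also have "card (A - p ` I) = card A - card I"
          using True insert.hyps(1) permutes_inj_on[OF p, of I] 
          by (simp add: card_Diff_subset card_image)
        also have "real \<dots> = real (card A) - real (card I)"
          using card_mono[OF finA True] permutes_inj_on[OF p, of I]
          by (simp add: card_image of_nat_diff)
        finally show ?thesis by simp
      qed simp
      finally show "(\<Sum>i\<in>{1..n} - I. of_bool ((p \<circ> Transposition.transpose t i) ` insert t I \<subseteq> A))
           / (real n - real (card I)) = (real (card A) - real (card I)) / (real n - real (card I))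
         * of_bool (p ` I \<subseteq> A)"
        by simp
    qed
    also have "\<dots> = ffact (card A) (card (insert t I)) / ffact n (card (insert t I))"
      unfolding perm_avg_cmult using insert.hyps insert.IH[OF I] by (simp add: ffact_Suc mult.commute)
    finally show ?case .
  qed
qed

section \<open>Tuples of distinct indices as permutations\<close>

lemma sum_distinct_lists_Suc:
  fixes h :: "nat list \<Rightarrow> real"
  assumes "finite A"
  shows "(\<Sum>js | length js = Suc k \<and> distinct js \<and> set js \<subseteq> A. h js) =
    (\<Sum>js | length js = k \<and> distinct js \<and> set js \<subseteq> A. \<Sum>j\<in>A - set js. h (js @ [j]))"
proof -
  let ?D = "\<lambda>k. {js. length js = k \<and> distinct js \<and> set js \<subseteq> A}"
  have fin: "finite (?D k)" for k
    by (rule finite_subset[OF _ finite_lists_length_eq[OF assms, of k]]) auto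
  have eq: "?D (Suc k) = (\<lambda>(js, j). js @ [j]) ` (SIGMA js:?D k. A - set js)"
  proof (rule set_eqI, rule iffI)
    fix js assume js: "js \<in> ?D (Suc k)"
    then have "js \<noteq> []" by auto
    then have "js = butlast js @ [last js]" by simp
    then obtain us u where "js = us @ [u]" by blast
    with js show "js \<in> (\<lambda>(js, j). js @ [j]) ` (SIGMA js:?D k. A - set js)" by force
  qed auto
  have "(\<Sum>js\<in>?D (Suc k). h js) = (\<Sum>(js, j)\<in>(SIGMA js:?D k. A - set js). h (js @ [j]))"
    unfolding eq by (subst sum.reindex) (auto simp: inj_on_def case_prod_beta intro!: sum.cong)
  also have "\<dots> = (\<Sum>js\<in>?D k. \<Sum>j\<in>A - set js. h (js @ [j]))"
    using fin assms by (subst sum.Sigma) auto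
  finally show ?thesis .
qed

text \<open>Each list of distinct indices is hit by the same number of permutations. The induction
  draws the last entry by resampling slot \<open>Suc k\<close>, so that number never has to be
  counted.\<close>

lemma sum_distinct_lists_eq_perm_avg:
  "k \<le> n \<Longrightarrow> (\<Sum>js | length js = k \<and> distinct js \<and> set js \<subseteq> {1..n}. h js) / ffact n k =
    perm_avg n (\<lambda>p. h (map p [1..<Suc k]))"
proof (induction k arbitrary: h)
  case 0
  have "{js. length js = 0 \<and> distinct js \<and> set js \<subseteq> {1..n}} = {[]}" by auto
  then show ?case by simp
next
  case (Suc k)
  let ?g = "\<lambda>js. (\<Sum>j\<in>{1..n} - set js. h (js @ [j])) / (real n - real k)"
  have "perm_avg n (\<lambda>p. h (map p [1..<Suc (Suc k)])) =
    perm_avg n (\<lambda>p. (\<Sum>i\<in>{1..n} - {1..k}. h (map (p \<circ> Transposition.transpose (Suc k) i) [1..<Suc (Suc k)]))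
         / (real n - real (card {1..k})))"
    using Suc.prems by (intro perm_avg_resample) auto
  also have "\<dots> = perm_avg n (\<lambda>p. ?g (map p [1..<Suc k]))"
  proof (rule perm_avg_cong)
    fix p assume p: "p permutes {1..n}"
    have "(\<Sum>i\<in>{1..n} - {1..k}. h (map (p \<circ> Transposition.transpose (Suc k) i) [1..<Suc (Suc k)])) =
       (\<Sum>i\<in>{1..n} - {1..k}. h (map p [1..<Suc k] @ [p i]))"
    proof (intro sum.cong refl arg_cong[of _ _ h])
      fix i assume "i \<in> {1..n} - {1..k}"
      then have "map (p \<circ> Transposition.transpose (Suc k) i) [1..<Suc k] = map p [1..<Suc k]"
        by (auto simp: Transposition.transpose_def)
      then show "map (p \<circ> Transposition.transpose (Suc k) i) [1..<Suc (Suc k)] = map p [1..<Suc k] @ [p i]"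
        by simp
    qed
    also have "\<dots> = (\<Sum>j\<in>{1..n} - p ` {1..k}. h (map p [1..<Suc k] @ [j]))"
      using Suc.prems by (subst sum_outside_permuted[OF p, of _ "\<lambda>j. h (map p [1..<Suc k] @ [j])"]) auto
    also have "p ` {1..k} = set (map p [1..<Suc k])"
      by (auto simp del: upt_Suc)
    finally show "(\<Sum>i\<in>{1..n} - {1..k}. h (map (p \<circ> Transposition.transpose (Suc k) i) [1..<Suc (Suc k)]))
         / (real n - real (card {1..k})) = ?g (map p [1..<Suc k])"
      by (simp add: comp_def del: upt_Suc)
  qed
  also have "\<dots> = (\<Sum>js | length js = k \<and> distinct js \<and> set js \<subseteq> {1..n}. ?g js) / ffact n k"
    using Suc.prems by (intro Suc.IH[symmetric]) simp
  also have "\<dots> = (\<Sum>js | length js = Suc k \<and> distinct js \<and> set js \<subseteq> {1..n}. h js) / ffact n (Suc k)"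
    by (simp add: sum_distinct_lists_Suc ffact_Suc sum_divide_distrib[symmetric] mult.commute)
  finally show ?case by simp
qed

text \<open>Transports a statement about an arbitrary set of slots to an initial segment; a
  bijection onto \<open>S\<close> and one between the complements are glued together.\<close>

lemma ex_permutes_image_eq:
  assumes "S \<subseteq> {1..n}"
  shows "\<exists>\<pi>. \<pi> permutes {1..n} \<and> \<pi> ` {1..card S} = S"
proof -
  have fS: "finite S" using assms finite_subset by auto
  have cS: "card S \<le> n" using card_mono[OF _ assms] by simp
  obtain f where f: "bij_betw f {1..card S} S"
    using finite_same_card_bij[of "{1..card S}" S] fS by auto
  have "card ({1..n} - {1..card S}) = card ({1..n} - S)"
    using assms fS cS by (simp add: card_Diff_subset)
  then obtain g where g: "bij_betw g ({1..n} - {1..card S}) ({1..n} - S)"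
    using finite_same_card_bij[of "{1..n} - {1..card S}" "{1..n} - S"] by auto
  define q where "q i = (if i \<in> {1..card S} then f i else if i \<in> {1..n} then g i else i)" for i
  have "bij_betw q {1..card S} S" using f by (subst bij_betw_cong[of _ _ f]) (auto simp: q_def)
  moreover have "bij_betw q ({1..n} - {1..card S}) ({1..n} - S)"
    using g by (subst bij_betw_cong[of _ _ g]) (auto simp: q_def)
  ultimately have "bij_betw q ({1..card S} \<union> ({1..n} - {1..card S})) (S \<union> ({1..n} - S))"
    by (intro bij_betw_combine) auto
  moreover have "{1..card S} \<union> ({1..n} - {1..card S}) = {1..n}" "S \<union> ({1..n} - S) = {1..n}"
    using assms cS by auto
  ultimately have "q permutes {1..n}"
    using cS by (intro bij_imp_permutes) (auto simp: q_def)
  moreover have "q ` {1..card S} = S"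
    using \<open>bij_betw q {1..card S} S\<close> by (simp add: bij_betw_def)
  ultimately show ?thesis by blast
qed

section \<open>Multilinear forms on a subspace\<close>

text \<open>A real bound for all arguments in \<open>H\<close>, whereas \<open>spec_norm\<close> is
  an extended real tested on unit vectors. On a trivial \<open>H\<close> that supremum may be over
  the empty set and equal \<open>-\<infinity>\<close>, so real constants are carried
  instead.\<close>

definition form_le :: "'a::real_normed_vector set \<Rightarrow> nat \<Rightarrow> 'a form \<Rightarrow> real \<Rightarrow> bool" where
  "form_le H k T c \<longleftrightarrow>
     (\<forall>hs. length hs = k \<and> set hs \<subseteq> H \<longrightarrow> \<bar>T hs\<bar> \<le> c * prod_list (map norm hs))"

lemma multilinear_slot:
  assumes "multilinear_form H k T" "length pre + length post + 1 = k"
    "set pre \<subseteq> H" "set post \<subseteq> H" "u \<in> H" "v \<in> H"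
  shows "T (pre @ (a *\<^sub>R u + b *\<^sub>R v) # post) = a * T (pre @ u # post) + b * T (pre @ v # post)"
proof -
  let ?hs = "pre @ u # post" and ?i = "length pre"
  have "T (?hs[?i := a *\<^sub>R u + b *\<^sub>R v]) = a * T (?hs[?i := u]) + b * T (?hs[?i := v])"
    using assms(1)[unfolded multilinear_form_def, rule_format, of ?hs ?i u v a b] assms(2-) by auto
  then show ?thesis by simp
qed

lemma multilinear_slot_0:
  assumes "subspace H" "multilinear_form H k T" "length pre + length post + 1 = k"
    "set pre \<subseteq> H" "set post \<subseteq> H"
  shows "T (pre @ 0 # post) = 0"
  using multilinear_slot[OF assms(2-5), of 0 0 0 0] subspace_0[OF assms(1)] by simp

lemma multilinear_slot_scale:
  assumes "multilinear_form H k T" "length pre + length post + 1 = k"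
    "set pre \<subseteq> H" "set post \<subseteq> H" "u \<in> H"
  shows "T (pre @ (a *\<^sub>R u) # post) = a * T (pre @ u # post)"
  using multilinear_slot[OF assms(1-4), of u u a 0] assms(5) by simp

lemma multilinear_slot_add:
  assumes "multilinear_form H k T" "length pre + length post + 1 = k"
    "set pre \<subseteq> H" "set post \<subseteq> H" "u \<in> H" "v \<in> H"
  shows "T (pre @ (u + v) # post) = T (pre @ u # post) + T (pre @ v # post)"
  using multilinear_slot[OF assms, of 1 1] by simp

lemma multilinear_slot_sum:
  assumes H: "subspace H" and T: "multilinear_form H k T" "length pre + length post + 1 = k"
    "set pre \<subseteq> H" "set post \<subseteq> H" and F: "finite F" "\<And>b. b \<in> F \<Longrightarrow> v b \<in> H"
  shows "T (pre @ (\<Sum>b\<in>F. v b) # post) = (\<Sum>b\<in>F. T (pre @ v b # post))"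
  using F
proof (induction F rule: finite_induct)
  case empty
  then show ?case using multilinear_slot_0[OF H T] by simp
next
  case (insert b F)
  then show ?case
    using multilinear_slot_add[OF T, of "v b" "sum v F"] subspace_sum[OF H, of F v] by simp
qed

lemma multilinear_form_diff:
  "multilinear_form H k S \<Longrightarrow> multilinear_form H k T \<Longrightarrow> multilinear_form H k (\<lambda>hs. S hs - T hs)"
  unfolding multilinear_form_def by (simp add: algebra_simps)

lemma multilinear_form_append:
  assumes "multilinear_form H k T" "set pre \<subseteq> H" "length pre + l = k"
  shows "multilinear_form H l (\<lambda>hs. T (pre @ hs))"
  unfolding multilinear_form_def
proof safe
  fix hs i u v and a b :: real
  assume hs: "set hs \<subseteq> H" "i < length hs" "u \<in> H" "v \<in> H" and l: "l = length hs"
  have "T ((pre @ hs)[length pre + i := a *\<^sub>R u + b *\<^sub>R v]) =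
    a * T ((pre @ hs)[length pre + i := u]) + b * T ((pre @ hs)[length pre + i := v])"
    using assms hs l unfolding multilinear_form_def by auto
  then show "T (pre @ hs[i := a *\<^sub>R u + b *\<^sub>R v]) = a * T (pre @ hs[i := u]) + b * T (pre @ hs[i := v])"
    by (simp add: list_update_append)
qed

text \<open>The function \<open>J\<close> records which summand is chosen in each slot; it is
  indexed by the labels in \<open>xs\<close>, which is why these are distinct. The prefix
  \<open>pre\<close> holds the slots already expanded in the induction.\<close>

lemma multilinear_expand:
  assumes H: "subspace H" and T: "multilinear_form H k T" and F: "finite F"
  shows "distinct xs \<Longrightarrow> length pre + length xs = k \<Longrightarrow> set pre \<subseteq> H \<Longrightarrow>
    (\<And>i b. i \<in> set xs \<Longrightarrow> b \<in> F \<Longrightarrow> v i b \<in> H) \<Longrightarrow>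
    T (pre @ map (\<lambda>i. \<Sum>b\<in>F. v i b) xs) =
      (\<Sum>J\<in>PiE (set xs) (\<lambda>_. F). T (pre @ map (\<lambda>i. v i (J i)) xs))"
proof (induction xs arbitrary: pre)
  case Nil
  then show ?case by simp
next
  case (Cons x xs)
  have xs: "(\<Sum>b\<in>F. v i b) \<in> H" if "i \<in> set xs" for i
    using Cons.prems(4) that by (intro subspace_sum[OF H]) auto
  have "T (pre @ map (\<lambda>i. \<Sum>b\<in>F. v i b) (x # xs)) =
     (\<Sum>b\<in>F. T (pre @ v x b # map (\<lambda>i. \<Sum>b\<in>F. v i b) xs))"
    unfolding list.map using Cons.prems xs F by (intro multilinear_slot_sum[OF H T]) auto
  also have "\<dots> = (\<Sum>b\<in>F. \<Sum>J\<in>PiE (set xs) (\<lambda>_. F). T ((pre @ [v x b]) @ map (\<lambda>i. v i (J i)) xs))"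
    using Cons.prems Cons.IH[of "pre @ [v x b]" for b] by (intro sum.cong refl) auto
  also have "\<dots> = (\<Sum>(b, J)\<in>F \<times> PiE (set xs) (\<lambda>_. F). T (pre @ v x b # map (\<lambda>i. v i (J i)) xs))"
    by (simp add: sum.cartesian_product)
  also have "\<dots> = (\<Sum>J\<in>PiE (set (x # xs)) (\<lambda>_. F). T (pre @ map (\<lambda>i. v i (J i)) (x # xs)))"
  proof -
    have *: "map (\<lambda>i. v i ((J(x := b)) i)) xs = map (\<lambda>i. v i (J i)) xs" for b J
      using Cons.prems(1) by auto
    have inj: "inj_on (\<lambda>(b, J). J(x := b)) (F \<times> PiE (set xs) (\<lambda>_. F))"
      using inj_combinator[of x "set xs" "\<lambda>_. F"] Cons.prems(1) by simp
    show ?thesis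
      unfolding list.set PiE_insert_eq
      by (subst sum.reindex[OF inj])
        (auto intro!: sum.cong simp: * case_prod_beta comp_def simp del: fun_upd_apply, simp)
  qed
  finally show ?case .
qed

lemma sum_Pow_insert:
  assumes "finite A" "x \<notin> A"
  shows "(\<Sum>S\<in>Pow (insert x A). g S) = (\<Sum>S\<in>Pow A. g (insert x S)) + (\<Sum>S\<in>Pow A. g S)"
proof -
  have "inj_on (insert x) (Pow A)" using assms by (auto simp: inj_on_def)
  then have "(\<Sum>S\<in>insert x ` Pow A. g S) = (\<Sum>S\<in>Pow A. g (insert x S))"
    by (simp add: sum.reindex)
  moreover have "Pow A \<inter> insert x ` Pow A = {}" using assms by auto
  ultimately show ?thesis
    using assms by (simp add: Pow_insert sum.union_disjoint add.commute)
qed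

lemma multilinear_expand_add:
  assumes H: "subspace H" and T: "multilinear_form H k T"
  shows "distinct xs \<Longrightarrow> length pre + length xs = k \<Longrightarrow> set pre \<subseteq> H \<Longrightarrow>
    (\<And>i. i \<in> set xs \<Longrightarrow> a i \<in> H \<and> b i \<in> H) \<Longrightarrow>
    T (pre @ map (\<lambda>i. a i + b i) xs) =
      (\<Sum>S\<in>Pow (set xs). T (pre @ map (\<lambda>i. if i \<in> S then a i else b i) xs))"
proof (induction xs arbitrary: pre)
  case Nil
  then show ?case by simp
next
  case (Cons x xs)
  have ab: "a i + b i \<in> H" if "i \<in> set xs" for i
    using Cons.prems(4) that by (intro subspace_add[OF H]) auto
  have m: "map (\<lambda>i. if i \<in> insert x S then a i else b i) xs = map (\<lambda>i. if i \<in> S then a i else b i) xs" for S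
    using Cons.prems(1) by auto
  have "T (pre @ map (\<lambda>i. a i + b i) (x # xs)) =
     T (pre @ a x # map (\<lambda>i. a i + b i) xs) + T (pre @ b x # map (\<lambda>i. a i + b i) xs)"
    unfolding list.map using Cons.prems ab by (intro multilinear_slot_add[OF T]) auto
  also have "\<dots> = (\<Sum>S\<in>Pow (set xs). T (pre @ a x # map (\<lambda>i. if i \<in> S then a i else b i) xs)) +
       (\<Sum>S\<in>Pow (set xs). T (pre @ b x # map (\<lambda>i. if i \<in> S then a i else b i) xs))"
    using Cons.prems Cons.IH[of "pre @ [a x]"] Cons.IH[of "pre @ [b x]"] by simp
  also have "\<dots> = (\<Sum>S\<in>Pow (set (x # xs)). T (pre @ map (\<lambda>i. if i \<in> S then a i else b i) (x # xs)))"
    using Cons.prems(1) m by (auto simp: sum_Pow_insert intro!: sum.cong arg_cong2[of _ _ _ _ "(+)"]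
        arg_cong[of _ _ T])
  finally show ?case .
qed

lemma multilinear_scale:
  assumes H: "subspace H" and T: "multilinear_form H k T"
  shows "distinct xs \<Longrightarrow> length pre + length xs = k \<Longrightarrow> set pre \<subseteq> H \<Longrightarrow>
    (\<And>i. i \<in> set xs \<Longrightarrow> u i \<in> H) \<Longrightarrow>
    T (pre @ map (\<lambda>i. c i *\<^sub>R u i) xs) = (\<Prod>i\<in>set xs. c i) * T (pre @ map u xs)"
proof (induction xs arbitrary: pre)
  case Nil
  then show ?case by simp
next
  case (Cons x xs)
  have "T (pre @ map (\<lambda>i. c i *\<^sub>R u i) (x # xs)) = c x * T (pre @ u x # map (\<lambda>i. c i *\<^sub>R u i) xs)"
    unfolding list.map using Cons.prems subspace_scale[OF H]
    by (intro multilinear_slot_scale[OF T]) auto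
  also have "\<dots> = c x * ((\<Prod>i\<in>set xs. c i) * T (pre @ map u (x # xs)))"
    using Cons.prems Cons.IH[of "pre @ [u x]"] by simp
  finally show ?case using Cons.prems(1) by simp
qed

lemma form_leD:
  "form_le H k T c \<Longrightarrow> length hs = k \<Longrightarrow> set hs \<subseteq> H \<Longrightarrow> \<bar>T hs\<bar> \<le> c * prod_list (map norm hs)"
  by (simp add: form_le_def)

lemma prod_list_norm_nonneg [simp]: "0 \<le> prod_list (map norm (hs :: 'a::real_normed_vector list))"
  by (induction hs) auto

lemma form_le_append:
  assumes "form_le H k T c" "set pre \<subseteq> H" "length pre + l = k"
  shows "form_le H l (\<lambda>hs. T (pre @ hs)) (c * prod_list (map norm pre))"
  unfolding form_le_def
proof (intro allI impI)
  fix hs :: "'a list" assume "length hs = l \<and> set hs \<subseteq> H"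
  then show "\<bar>T (pre @ hs)\<bar> \<le> c * prod_list (map norm pre) * prod_list (map norm hs)"
    using form_leD[OF assms(1), of "pre @ hs"] assms(2,3) by (simp add: mult.assoc)
qed

text \<open>Each argument is divided by its norm and multilinearity pulls the norms out; a zero
  argument makes the form vanish.\<close>

lemma spec_norm_form_le:
  assumes H: "subspace H" and T: "multilinear_form H k T" and le: "spec_norm H k T \<le> ereal c"
    and c: "0 \<le> c"
  shows "form_le H k T c"
  unfolding form_le_def
proof (intro allI impI)
  fix hs :: "'a list" assume hs: "length hs = k \<and> set hs \<subseteq> H"
  show "\<bar>T hs\<bar> \<le> c * prod_list (map norm hs)"
  proof (cases "0 \<in> set hs")
    case True
    then obtain pre post where e: "hs = pre @ 0 # post" by (meson split_list)
    then have "T hs = 0" using hs by (auto intro!: multilinear_slot_0[OF H T])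
    then show ?thesis using c by simp
  next
    case False
    define u where "u i = (1 / norm (hs ! i)) *\<^sub>R hs ! i" for i
    have nz: "norm (hs ! i) \<noteq> 0" if "i < k" for i
      using False hs that by (metis norm_eq_zero nth_mem)
    have uH: "u i \<in> H" if "i < k" for i
      unfolding u_def using hs that by (intro subspace_scale[OF H]) (auto intro: nth_mem)
    have hs': "hs = map (\<lambda>i. norm (hs ! i) *\<^sub>R u i) [0..<k]"
      using hs nz by (intro nth_equalityI) (auto simp: u_def)
    have "T hs = T ([] @ map (\<lambda>i. norm (hs ! i) *\<^sub>R u i) [0..<k])" using hs' by simp
    also have "\<dots> = (\<Prod>i\<in>set [0..<k]. norm (hs ! i)) * T ([] @ map u [0..<k])"
      using uH by (intro multilinear_scale[OF H T]) auto
    also have "(\<Prod>i\<in>set [0..<k]. norm (hs ! i)) = prod_list (map norm hs)"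
      using hs by (simp add: prod.list_conv_set_nth atLeast0LessThan)
    finally have eq: "T hs = prod_list (map norm hs) * T (map u [0..<k])" by simp
    have "ereal \<bar>T (map u [0..<k])\<bar> \<le> spec_norm H k T"
      unfolding spec_norm_def using uH nz by (intro SUP_upper) (auto simp: u_def)
    then have "\<bar>T (map u [0..<k])\<bar> \<le> c" using le by (metis ereal_less_eq(3) order_trans)
    then show ?thesis
      unfolding eq abs_mult
      by (simp add: mult_left_mono mult.commute[of "prod_list _"] mult_right_mono abs_of_nonneg)
  qed
qed

lemma spec_norm_nonneg:
  assumes "h \<in> H" "norm h = 1"
  shows "0 \<le> spec_norm H k T"
proof -
  have "ereal \<bar>T (replicate k h)\<bar> \<le> spec_norm H k T"
    unfolding spec_norm_def using assms by (intro SUP_upper) auto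
  then show ?thesis by (rule order_trans[rotated]) simp
qed

text \<open>Each argument is written as its limit plus an increment. In the expansion over the set
  \<open>S\<close> of slots with an increment, every term with \<open>S\<close> nonempty is bounded
  by a product with a factor tending to zero.\<close>

lemma tendsto_multilinear:
  assumes H: "subspace H" and T: "multilinear_form H k T" "form_le H k T c"
    and xs: "distinct xs" "length xs = k"
    and zH: "\<And>N i. i \<in> set xs \<Longrightarrow> z N i \<in> H" "\<And>i. i \<in> set xs \<Longrightarrow> w i \<in> H"
    and lim: "\<And>i. i \<in> set xs \<Longrightarrow> ((\<lambda>N. z N i) \<longlongrightarrow> w i) G"
  shows "((\<lambda>N. T (map (z N) xs)) \<longlongrightarrow> T (map w xs)) G"
proof -
  let ?t = "\<lambda>N S. T (map (\<lambda>i. if i \<in> S then z N i - w i else w i) xs)"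
  have *: "T (map (z N) xs) = (\<Sum>S\<in>Pow (set xs). ?t N S)" for N
    using multilinear_expand_add[OF H T(1) xs(1), of "[]" "\<lambda>i. z N i - w i" w] xs zH
      subspace_diff[OF H] by simp
  have lt: "((\<lambda>N. ?t N S) \<longlongrightarrow> (if S = {} then T (map w xs) else 0)) G" if S: "S \<subseteq> set xs" for S
  proof (cases "S = {}")
    case False
    then obtain i0 where i0: "i0 \<in> S" by auto
    let ?m = "\<lambda>N i. if i \<in> S then z N i - w i else w i"
    have b: "\<bar>?t N S\<bar> \<le> c * (\<Prod>i\<in>set xs. norm (?m N i))" for N
    proof -
      have "set (map (?m N) xs) \<subseteq> H" using zH subspace_diff[OF H] by auto
      from form_leD[OF T(2) _ this] show ?thesis
        using xs by (simp add: prod.distinct_set_conv_list comp_def)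
    qed
    have "((\<lambda>N. c * (\<Prod>i\<in>set xs. norm (?m N i))) \<longlongrightarrow>
        c * (\<Prod>i\<in>set xs. norm (if i \<in> S then w i - w i else w i))) G"
    proof (intro tendsto_intros)
      fix i assume "i \<in> set xs"
      then show "((\<lambda>N. if i \<in> S then z N i - w i else w i) \<longlongrightarrow> (if i \<in> S then w i - w i else w i)) G"
        using tendsto_diff[OF lim tendsto_const, of i "w i"] by (cases "i \<in> S") auto
    qed
    moreover have "(\<Prod>i\<in>set xs. norm (if i \<in> S then w i - w i else w i)) = 0"
      using i0 S by (intro prod_zero) auto
    ultimately have "((\<lambda>N. c * (\<Prod>i\<in>set xs. norm (?m N i))) \<longlongrightarrow> 0) G" by simp
    then show ?thesis
      using False b by (auto intro!: Lim_null_comparison[of "\<lambda>N. ?t N S"])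
  qed simp
  have "((\<lambda>N. T (map (z N) xs)) \<longlongrightarrow> (\<Sum>S\<in>Pow (set xs). if S = {} then T (map w xs) else 0)) G"
    unfolding * using lt by (intro tendsto_sum) auto
  then show ?thesis by simp
qed

text \<open>The minimiser of the energy \<open>J z = (norm z)\<^sup>2 - 2 * \<phi> z\<close> over
  \<open>H\<close> represents \<open>\<phi>\<close>: a minimising sequence is Cauchy, and the first
  variation at its limit gives the identity. The alternative \<open>a = 0\<close> is for a trivial
  \<open>H\<close>, where \<open>C\<close> can be negative.\<close>

lemma Riesz_on_subspace:
  fixes H :: "'a::{real_inner,banach} set"
  assumes H: "subspace H" "closed H"
    and add: "\<And>u v. u \<in> H \<Longrightarrow> v \<in> H \<Longrightarrow> \<phi> (u + v) = \<phi> u + \<phi> v"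
    and scale: "\<And>a u. u \<in> H \<Longrightarrow> \<phi> (a *\<^sub>R u) = a * \<phi> u"
    and bd: "\<And>u. u \<in> H \<Longrightarrow> \<bar>\<phi> u\<bar> \<le> C * norm u"
  obtains a where "a \<in> H" "norm a \<le> C \<or> a = 0" "\<And>z. z \<in> H \<Longrightarrow> \<phi> z = a \<bullet> z"
proof -
  define J where "J z = (norm z)\<^sup>2 - 2 * \<phi> z" for z
  have lb: "- C\<^sup>2 \<le> J z" if "z \<in> H" for z
  proof -
    have "0 \<le> (norm z - C)\<^sup>2" by simp
    then show ?thesis
      using bd[OF that] unfolding J_def power2_diff by (simp add: mult.commute)
  qed
  have H0: "0 \<in> H" using H(1) by (rule subspace_0)
  define I where "I = Inf (J ` H)"
  have bdd: "bdd_below (J ` H)" using lb by (intro bdd_belowI[of _ "- C\<^sup>2"]) auto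
  have Ile: "I \<le> J z" if "z \<in> H" for z
    unfolding I_def using bdd that by (intro cINF_lower) auto
  have "\<exists>z\<in>H. J z < I + 1 / real (Suc N)" for N
  proof -
    have "Inf (J ` H) < I + 1 / real (Suc N)" unfolding I_def by simp
    then show ?thesis using H0 bdd by (subst (asm) cINF_less_iff) auto
  qed
  then obtain a where a: "\<And>N. a N \<in> H" "\<And>N. J (a N) < I + 1 / real (Suc N)" by metis
  \<comment> \<open>Parallelogram identity for the energy: the linear part cancels, so two nearly
    minimal points must be close to each other.\<close>
  have para: "(norm (u - v))\<^sup>2 = 2 * J u + 2 * J v - 4 * J ((1/2) *\<^sub>R (u + v))"
    if "u \<in> H" "v \<in> H" for u v
  proof -
    have 1: "\<phi> ((1/2) *\<^sub>R (u + v)) = (1/2) * (\<phi> u + \<phi> v)"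
      using that add[of u v] scale[of "u + v" "1/2"] subspace_add[OF H(1), of u v] by simp
    have 2: "(norm (u - v))\<^sup>2 = 2 * (norm u)\<^sup>2 + 2 * (norm v)\<^sup>2 - 4 * (norm ((1/2) *\<^sub>R (u + v)))\<^sup>2"
      by (simp add: power2_norm_eq_inner inner_add_left inner_add_right inner_diff_left
        inner_diff_right inner_commute power_divide add_divide_distrib)
    have gen: "A = 2 * a + 2 * b - 4 * c \<Longrightarrow> q = 1 / 2 * (x + y) \<Longrightarrow>
        A = 2 * (a - 2 * x) + 2 * (b - 2 * y) - 4 * (c - 2 * q)" for A a b c q x y :: real
      by simp
    show ?thesis unfolding J_def by (rule gen[OF 2 1])
  qed
  have cau: "(norm (a i - a j))\<^sup>2 \<le> 2 / real (Suc i) + 2 / real (Suc j)" for i j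
  proof -
    have "I \<le> J ((1/2) *\<^sub>R (a i + a j))"
      using a(1) by (intro Ile subspace_scale[OF H(1)] subspace_add[OF H(1)])
    then show ?thesis using para[OF a(1)[of i] a(1)[of j]] a(2)[of i] a(2)[of j] by simp
  qed
  have "Cauchy a"
  proof (rule CauchyI)
    fix e :: real assume e: "0 < e"
    obtain N where N: "inverse (real (Suc N)) < e\<^sup>2 / 4"
      using e reals_Archimedean[of "e\<^sup>2 / 4"] by auto
    show "\<exists>N. \<forall>i\<ge>N. \<forall>j\<ge>N. norm (a i - a j) < e"
    proof (intro exI allI impI)
      fix i j assume ij: "N \<le> i" "N \<le> j"
      have "2 / real (Suc i) \<le> 2 / real (Suc N)" "2 / real (Suc j) \<le> 2 / real (Suc N)"
        using ij by (auto intro!: divide_left_mono)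
      then have "(norm (a i - a j))\<^sup>2 < e\<^sup>2"
        using cau[of i j] N divide_inverse[of 2 "real (Suc N)"] by linarith
      then show "norm (a i - a j) < e" using e by (intro power_less_imp_less_base[of _ 2 e]) auto
    qed
  qed
  then obtain b where b: "a \<longlonglongrightarrow> b" by (auto simp: Cauchy_convergent_iff convergent_def)
  have bH: "b \<in> H" using closed_sequentially[OF H(2) _ b] a(1) by simp
  have diff: "\<phi> (u - v) = \<phi> u - \<phi> v" if "u \<in> H" "v \<in> H" for u v
    using add[of u "(-1) *\<^sub>R v"] scale[of v "-1"] that subspace_scale[OF H(1), of v "-1"] by simp
  have lim\<phi>: "(\<lambda>N. \<phi> (a N)) \<longlonglongrightarrow> \<phi> b"
  proof (rule LIM_zero_cancel, rule Lim_null_comparison)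
    show "\<forall>\<^sub>F N in sequentially. norm (\<phi> (a N) - \<phi> b) \<le> C * norm (a N - b)"
      using bd[OF subspace_diff[OF H(1) a(1) bH]] diff[OF a(1) bH] by simp
    show "(\<lambda>N. C * norm (a N - b)) \<longlonglongrightarrow> 0"
      using b by (intro tendsto_mult_right_zero tendsto_norm_zero) (simp add: LIM_zero)
  qed
  have "(\<lambda>N. J (a N)) \<longlonglongrightarrow> J b"
    unfolding J_def by (intro tendsto_intros b lim\<phi>)
  moreover have "(\<lambda>N. I + 1 / real (Suc N)) \<longlonglongrightarrow> I + 0"
    by (intro tendsto_intros LIMSEQ_Suc[OF lim_1_over_n])
  ultimately have "J b \<le> I + 0" using a(2) by (intro LIMSEQ_le) (auto intro: less_imp_le)
  then have Jb: "J b \<le> J z" if "z \<in> H" for z using Ile[OF that] by simp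
  have eq: "\<phi> z = b \<bullet> z" if z: "z \<in> H" for z
  proof -
    let ?g = "b \<bullet> z - \<phi> z"
    have q: "0 \<le> 2 * t * ?g + t\<^sup>2 * (norm z)\<^sup>2" for t
    proof -
      have "J b \<le> J (b + t *\<^sub>R z)"
        using z bH by (intro Jb subspace_add[OF H(1)] subspace_scale[OF H(1)])
      moreover have "(norm (b + t *\<^sub>R z))\<^sup>2 = (norm b)\<^sup>2 + 2 * t * (b \<bullet> z) + t\<^sup>2 * (norm z)\<^sup>2"
        unfolding power2_norm_eq_inner
        by (simp add: inner_add_left inner_add_right inner_commute power2_eq_square algebra_simps)
      ultimately show ?thesis
        using add[OF bH subspace_scale[OF H(1) z, of t]] scale[OF z, of t]
        by (simp add: J_def algebra_simps)
    qed
    show ?thesis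
    proof (cases "z = 0")
      case True
      then show ?thesis using scale[OF z, of 0] by simp
    next
      case False
      then have n: "(norm z)\<^sup>2 > 0" by simp
      have gen: "0 < N \<Longrightarrow> 2 * (- g / N) * g + (- g / N)\<^sup>2 * N = - (g\<^sup>2 / N)" for g N :: real
        by (simp add: field_simps power2_eq_square)
      \<comment> \<open>The vertex of the parabola in \<open>t\<close>, where its value is negative
        unless \<open>?g\<close> vanishes.\<close>
      define t where "t = - ?g / (norm z)\<^sup>2"
      have "2 * t * ?g + t\<^sup>2 * (norm z)\<^sup>2 = - (?g\<^sup>2 / (norm z)\<^sup>2)"
        unfolding t_def by (rule gen[OF n])
      with q[of t] have "?g\<^sup>2 / (norm z)\<^sup>2 \<le> 0" by simp
      then have "?g\<^sup>2 \<le> 0" using n by (simp add: divide_le_0_iff)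
      then show ?thesis by simp
    qed
  qed
  have "norm b \<le> C \<or> b = 0"
  proof (cases "b = 0")
    case False
    have "(norm b)\<^sup>2 = \<phi> b" using eq[OF bH] by (simp add: power2_norm_eq_inner)
    also have "\<dots> \<le> C * norm b" using bd[OF bH] by simp
    finally have "norm b * norm b \<le> C * norm b" by (simp add: power2_eq_square)
    then show ?thesis using False by simp
  qed simp
  with bH eq show ?thesis using that by blast
qed

section \<open>Iterated derivatives and Taylor expansion\<close>

lemma ereal_divide_leD:
  assumes "a / ereal p \<le> ereal c" "0 < p"
  shows "a \<le> ereal (c * p)"
  using assms by (cases a) (auto simp: field_simps)

text \<open>Turns a limit of extended-real quotients into one inequality for all argument lists at
  once; the uniformity in \<open>hs\<close> is what the spectral norm in the definition
  provides.\<close>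

lemma has_form_derivative_bound:
  assumes H: "subspace H" and A: "\<And>y. y \<in> H \<Longrightarrow> multilinear_form H k (A y)"
    and D: "has_form_derivative H k A T x" and x: "x \<in> H" and e: "0 < e"
  shows "\<forall>\<^sub>F y in at x within H. \<forall>hs. length hs = k \<and> set hs \<subseteq> H \<longrightarrow>
    \<bar>A y hs - A x hs - T ((y - x) # hs)\<bar> \<le> e * norm (y - x) * prod_list (map norm hs)"
proof -
  let ?s = "\<lambda>y. spec_norm H k (\<lambda>hs. A y hs - A x hs - T ((y - x) # hs))"
  have T: "multilinear_form H (Suc k) T" and lim: "((\<lambda>y. ?s y / ereal (norm (y - x))) \<longlongrightarrow> 0) (at x within H)"
    using D by (auto simp: has_form_derivative_def)
  have "\<forall>\<^sub>F y in at x within H. ?s y / ereal (norm (y - x)) < ereal e"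
    using lim e by (intro order_tendstoD(2)) auto
  moreover have "\<forall>\<^sub>F y in at x within H. y \<in> H \<and> y \<noteq> x"
    by (auto simp: eventually_at_filter)
  ultimately show ?thesis
  proof eventually_elim
    case (elim y)
    have yx: "y - x \<in> H" using elim x H by (simp add: subspace_diff)
    have "?s y \<le> ereal (e * norm (y - x))"
      using elim by (intro ereal_divide_leD) auto
    moreover have "multilinear_form H k (\<lambda>hs. A y hs - A x hs - T ([y - x] @ hs))"
      using elim x yx by (intro multilinear_form_diff A multilinear_form_append[OF T]) auto
    ultimately have "form_le H k (\<lambda>hs. A y hs - A x hs - T ((y - x) # hs)) (e * norm (y - x))"
      using e by (intro spec_norm_form_le[OF H]) auto
    then show ?case by (auto simp: form_le_def)
  qed
qed

text \<open>Reduces iterated Frechet derivatives to one-variable calculus: along a line and with the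
  other arguments frozen, the next derivative is an ordinary one.\<close>

lemma has_form_derivative_line_at_0:
  assumes H: "subspace H" and A: "\<And>y. y \<in> H \<Longrightarrow> multilinear_form H k (A y)"
    and D: "has_form_derivative H k A T x" and x: "x \<in> H"
    and hs: "length hs = k" "set hs \<subseteq> H" and u: "u \<in> H"
  shows "((\<lambda>t. A (x + t *\<^sub>R u) hs) has_real_derivative T (u # hs)) (at 0)"
proof (cases "u = 0")
  case True
  have "T ([] @ 0 # hs) = 0"
    using D hs by (intro multilinear_slot_0[OF H]) (auto simp: has_form_derivative_def)
  then show ?thesis using True by simp
next
  case False
  have T: "multilinear_form H (Suc k) T" using D by (simp add: has_form_derivative_def)
  \<comment> \<open>The added 1 keeps \<open>?P\<close> positive when some argument in
    \<open>hs\<close> is zero and makes the final estimate strict.\<close>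
  let ?P = "norm u * prod_list (map norm hs) + 1"
  have P: "0 < ?P" by (simp add: add_nonneg_pos)
  have "(\<lambda>h. (A (x + h *\<^sub>R u) hs - A x hs) / h) \<midarrow>0\<rightarrow> T (u # hs)"
  proof (rule tendstoI)
    fix e :: real assume e: "0 < e"
    have "0 < e / ?P" using e P by simp
    from has_form_derivative_bound[OF H A D x this]
    obtain d where d: "0 < d" and bd: "\<And>y. y \<in> H \<Longrightarrow> y \<noteq> x \<Longrightarrow> dist y x < d \<Longrightarrow>
      \<bar>A y hs - A x hs - T ((y - x) # hs)\<bar> \<le> e / ?P * norm (y - x) * prod_list (map norm hs)"
      using hs unfolding eventually_at by blast
    show "\<forall>\<^sub>F h in at 0. dist ((A (x + h *\<^sub>R u) hs - A x hs) / h) (T (u # hs)) < e"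
      unfolding eventually_at
    proof (intro exI[of _ "d / norm u"] conjI ballI impI)
      show "0 < d / norm u" using d False by simp
      fix h :: real assume h: "h \<noteq> 0 \<and> dist h 0 < d / norm u"
      then have h0: "h \<noteq> 0" and hd: "\<bar>h\<bar> * norm u < d" using False by (auto simp: field_simps)
      let ?y = "x + h *\<^sub>R u"
      have yH: "?y \<in> H" using H x u by (simp add: subspace_add subspace_scale)
      have "T ([] @ (h *\<^sub>R u) # hs) = h * T ([] @ u # hs)"
        using hs u by (intro multilinear_slot_scale[OF T]) auto
      then have "\<bar>A ?y hs - A x hs - h * T (u # hs)\<bar>
          \<le> e / ?P * (\<bar>h\<bar> * norm u) * prod_list (map norm hs)"
        using bd[OF yH] h0 False hd by (simp add: dist_norm)
      also have "\<dots> = \<bar>h\<bar> * (e * ((?P - 1) / ?P))" by simp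
      also have "\<dots> < \<bar>h\<bar> * e"
        using h0 e P by (intro mult_strict_left_mono) (auto simp: field_simps)
      finally have "\<bar>A ?y hs - A x hs - h * T (u # hs)\<bar> / \<bar>h\<bar> < e"
        using h0 by (simp add: field_simps)
      moreover have "(A ?y hs - A x hs) / h - T (u # hs) = (A ?y hs - A x hs - h * T (u # hs)) / h"
        using h0 by (simp add: field_simps)
      ultimately show "dist ((A ?y hs - A x hs) / h) (T (u # hs)) < e"
        by (simp add: dist_norm)
    qed
  qed
  then show ?thesis by (simp add: DERIV_def)
qed

context
  fixes H :: "'a::{real_inner,banach,second_countable_topology} set" and f :: "'a \<Rightarrow> real" and m :: nat
  assumes H: "subspace H" "closed H" and diff: "times_differentiable_on m H f"
begin

lemma has_form_derivative_fderiv: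
  "x \<in> H \<Longrightarrow> k < m \<Longrightarrow> has_form_derivative H k (fderiv H f k) (fderiv H f (Suc k) x) x"
  unfolding fderiv.simps
  by (rule someI_ex[of "\<lambda>T. has_form_derivative H k (fderiv H f k) T x"])
    (use diff in \<open>auto simp: times_differentiable_on_def\<close>)

lemma multilinear_fderiv: "x \<in> H \<Longrightarrow> k \<le> m \<Longrightarrow> multilinear_form H k (fderiv H f k x)"
  using has_form_derivative_fderiv[of x "k - 1"]
  by (cases k) (auto simp: has_form_derivative_def, simp add: multilinear_form_def)

text \<open>For \<open>k = 0\<close> the norm is that of the constant \<open>f x\<close>; for larger
  \<open>k\<close> finiteness is part of \<open>has_form_derivative\<close>. The maximum with 0
  absorbs a spectral norm equal to \<open>-\<infinity>\<close>.\<close>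

lemma form_le_fderiv:
  assumes "x \<in> H" "k \<le> m"
  obtains c where "form_le H k (fderiv H f k x) c" "0 \<le> c"
proof -
  have fin: "spec_norm H k (fderiv H f k x) < \<infinity>"
  proof (cases k)
    case 0
    have "spec_norm H 0 (fderiv H f 0 x) \<le> ereal \<bar>f x\<bar>"
      unfolding spec_norm_def by (intro SUP_least) auto
    also have "\<dots> < \<infinity>" by simp
    finally show ?thesis using 0 by simp
  next
    case (Suc j)
    then show ?thesis using has_form_derivative_fderiv[of x j] assms by (simp add: has_form_derivative_def)
  qed
  define c where "c = max 0 (real_of_ereal (spec_norm H k (fderiv H f k x)))"
  have "spec_norm H k (fderiv H f k x) \<le> ereal c"
    using fin unfolding c_def by (cases "spec_norm H k (fderiv H f k x)") auto
  then have "form_le H k (fderiv H f k x) c"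
    by (intro spec_norm_form_le[OF H(1) multilinear_fderiv[OF assms]]) (auto simp: c_def)
  then show ?thesis using that by (auto simp: c_def)
qed

lemma fderiv_line:
  assumes x: "x \<in> H" and k: "k < m" and hs: "length hs = k" "set hs \<subseteq> H" and u: "u \<in> H"
  shows "((\<lambda>t. fderiv H f k (x + t *\<^sub>R u) hs) has_real_derivative
     fderiv H f (Suc k) (x + t *\<^sub>R u) (u # hs)) (at t)"
proof -
  have xt: "x + t *\<^sub>R u \<in> H" using x u H by (simp add: subspace_add subspace_scale)
  have "((\<lambda>r. fderiv H f k ((x + t *\<^sub>R u) + r *\<^sub>R u) hs) has_real_derivative
     fderiv H f (Suc k) (x + t *\<^sub>R u) (u # hs)) (at 0)"
    using k by (intro has_form_derivative_line_at_0[OF H(1) multilinear_fderiv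
          has_form_derivative_fderiv[OF xt k] xt hs u]) auto
  moreover have "x + t *\<^sub>R u + r *\<^sub>R u = x + (r + t) *\<^sub>R u" for r by (simp add: algebra_simps)
  ultimately show ?thesis
    using DERIV_shift[of "\<lambda>t. fderiv H f k (x + t *\<^sub>R u) hs" _ 0 t] by simp
qed

text \<open>Makes \<open>f\<close> at a random point measurable, the base case for the derivatives
  below.\<close>

lemma continuous_on_if_times_differentiable:
  assumes m: "0 < m"
  shows "continuous_on H f"
  unfolding continuous_on_def
proof
  fix x assume x: "x \<in> H"
  let ?T = "fderiv H f (Suc 0) x"
  obtain c where c: "form_le H (Suc 0) ?T c"
    using form_le_fderiv[OF x, of "Suc 0"] m by auto
  have ev: "\<forall>\<^sub>F y in at x within H. norm (f y - f x) \<le> (1 + c) * norm (y - x)"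
  proof -
    have "\<forall>\<^sub>F y in at x within H. \<forall>hs. length hs = 0 \<and> set hs \<subseteq> H \<longrightarrow>
      \<bar>fderiv H f 0 y hs - fderiv H f 0 x hs - ?T ((y - x) # hs)\<bar> \<le> 1 * norm (y - x) * prod_list (map norm hs)"
      using m by (intro has_form_derivative_bound[OF H(1) _ has_form_derivative_fderiv[OF x m] x]) (auto simp: multilinear_form_def)
    moreover have "\<forall>\<^sub>F y in at x within H. y \<in> H" by (auto simp: eventually_at_filter)
    ultimately show ?thesis
    proof eventually_elim
      case (elim y)
      have "y - x \<in> H" using elim x H by (simp add: subspace_diff)
      then have "\<bar>?T [y - x]\<bar> \<le> c * norm (y - x)" using form_leD[OF c, of "[y - x]"] by simp
      with elim show ?case by (simp add: algebra_simps)
    qed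
  qed
  have "((\<lambda>y. (1 + c) * norm (y - x)) \<longlongrightarrow> (1 + c) * norm (x - x)) (at x within H)"
    by (intro tendsto_intros)
  then have "((\<lambda>y. f y - f x) \<longlongrightarrow> 0) (at x within H)"
    using ev by (intro Lim_null_comparison[OF ev]) simp
  then show "(f \<longlongrightarrow> f x) (at x within H)" by (simp add: LIM_zero_iff)
qed

text \<open>The top derivative is not assumed continuous, and its values come from a choice.
  Measurability is inherited upwards instead: the next derivative is the pointwise limit of
  difference quotients of the previous one with step \<open>1 / Suc i\<close>. Their base point
  moves, so \<open>Y\<close> is general in the induction.\<close>

lemma measurable_fderiv:
  assumes m: "0 < m"
  shows "k \<le> m \<Longrightarrow> length xs = k \<Longrightarrow> Y \<in> borel_measurable N \<Longrightarrow> (\<And>\<omega>. \<omega> \<in> space N \<Longrightarrow> Y \<omega> \<in> H) \<Longrightarrow>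
    (\<And>i. i \<in> set xs \<Longrightarrow> Z i \<in> borel_measurable N) \<Longrightarrow>
    (\<And>i \<omega>. i \<in> set xs \<Longrightarrow> \<omega> \<in> space N \<Longrightarrow> Z i \<omega> \<in> H) \<Longrightarrow>
    (\<lambda>\<omega>. fderiv H f k (Y \<omega>) (map (\<lambda>i. Z i \<omega>) xs)) \<in> borel_measurable N"
proof (induction k arbitrary: xs Y)
  case 0
  have "f \<in> borel_measurable (restrict_space borel H)"
    using continuous_on_if_times_differentiable[OF m] by (rule borel_measurable_continuous_on_restrict)
  moreover have "Y \<in> measurable N (restrict_space borel H)"
    using 0 by (intro measurable_restrict_space2) auto
  ultimately have "(\<lambda>\<omega>. f (Y \<omega>)) \<in> borel_measurable N"
    using measurable_compose by blast
  then show ?case by simp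
next
  case (Suc k)
  obtain x xs' where xs: "xs = x # xs'" using Suc.prems by (cases xs) auto
  have k: "k < m" "length xs' = k" using Suc.prems xs by auto
  have [measurable]: "Y \<in> borel_measurable N" "Z x \<in> borel_measurable N" using Suc.prems xs by auto
  let ?A = "\<lambda>i \<omega>. fderiv H f k (Y \<omega> + (1 / real (Suc i)) *\<^sub>R Z x \<omega>) (map (\<lambda>i. Z i \<omega>) xs')"
  let ?B = "\<lambda>\<omega>. fderiv H f k (Y \<omega>) (map (\<lambda>i. Z i \<omega>) xs')"
  have A: "?A i \<in> borel_measurable N" for i
    using Suc.prems xs k H by (intro Suc.IH) (auto intro!: subspace_add subspace_scale)
  have B: "?B \<in> borel_measurable N"
    using Suc.prems xs k by (intro Suc.IH) auto
  show ?case
  proof (rule borel_measurable_LIMSEQ_real)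
    show "(\<lambda>\<omega>. (?A i \<omega> - ?B \<omega>) / (1 / real (Suc i))) \<in> borel_measurable N" for i
      by (intro borel_measurable_divide borel_measurable_diff A B borel_measurable_const)
    fix \<omega> assume w: "\<omega> \<in> space N"
    let ?hs = "map (\<lambda>i. Z i \<omega>) xs'"
    have "((\<lambda>t. fderiv H f k (Y \<omega> + t *\<^sub>R Z x \<omega>) ?hs) has_real_derivative
       fderiv H f (Suc k) (Y \<omega> + 0 *\<^sub>R Z x \<omega>) (Z x \<omega> # ?hs)) (at 0)"
      using Suc.prems xs k w by (intro fderiv_line) auto
    then have "(\<lambda>h. (fderiv H f k (Y \<omega> + h *\<^sub>R Z x \<omega>) ?hs - ?B \<omega>) / h) \<midarrow>0\<rightarrow>
       fderiv H f (Suc k) (Y \<omega>) (map (\<lambda>i. Z i \<omega>) xs)"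
      by (simp add: DERIV_def xs)
    moreover have "(\<lambda>i. 1 / real (Suc i)) \<longlonglongrightarrow> 0"
      by (rule LIMSEQ_Suc[OF lim_1_over_n])
    ultimately have "((\<lambda>h. (fderiv H f k (Y \<omega> + h *\<^sub>R Z x \<omega>) ?hs - ?B \<omega>) / h) \<circ> (\<lambda>i. 1 / real (Suc i)))
       \<longlonglongrightarrow> fderiv H f (Suc k) (Y \<omega>) (map (\<lambda>i. Z i \<omega>) xs)"
      unfolding tendsto_at_iff_sequentially by (auto simp del: of_nat_Suc fderiv.simps)
    then show "(\<lambda>i. (?A i \<omega> - ?B \<omega>) / (1 / real (Suc i))) \<longlonglongrightarrow>
       fderiv H f (Suc k) (Y \<omega>) (map (\<lambda>i. Z i \<omega>) xs)"
      by (simp only: comp_def)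
  qed
qed

text \<open>The Lagrange form of the remainder is used for one real function, the weighted sum over
  \<open>F\<close> along the segment from \<open>\<theta>\<close> to \<open>\<theta> + h\<close>.
  Hence one \<open>t\<close> serves all summands, and the remainder is again a weighted sum of
  values of one form. The polynomial includes the term of order \<open>m\<close>, so an increment of
  the top derivative is left.\<close>

lemma taylor_combination:
  assumes \<theta>: "\<theta> \<in> H" and h: "h \<in> H" and l: "l \<le> m"
    and g: "\<And>a. a \<in> F \<Longrightarrow> length (g a) = l \<and> set (g a) \<subseteq> H"
  shows "\<exists>t. 0 < t \<and> t \<le> 1 \<and>
    (\<Sum>a\<in>F. w a * (fderiv H f l (\<theta> + h) (g a) -
        (\<Sum>i\<le>m - l. fderiv H f (l + i) \<theta> (replicate i h @ g a) / fact i))) =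
    (\<Sum>a\<in>F. w a * (fderiv H f m (\<theta> + t *\<^sub>R h) (replicate (m - l) h @ g a) -
        fderiv H f m \<theta> (replicate (m - l) h @ g a))) / fact (m - l)"
proof -
  define D where "D i t = (\<Sum>a\<in>F. w a * fderiv H f (l + i) (\<theta> + t *\<^sub>R h) (replicate i h @ g a))" for i t
  have L: "(\<Sum>a\<in>F. w a * (fderiv H f l (\<theta> + h) (g a) -
        (\<Sum>i\<le>m - l. fderiv H f (l + i) \<theta> (replicate i h @ g a) / fact i))) =
     D 0 1 - (\<Sum>i\<le>m - l. D i 0 / fact i)"
  proof -
    have "(\<Sum>a\<in>F. w a * (\<Sum>i\<le>m - l. fderiv H f (l + i) \<theta> (replicate i h @ g a) / fact i)) =
       (\<Sum>i\<le>m - l. D i 0 / fact i)"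
      unfolding D_def sum_divide_distrib sum_distrib_left
      by (subst sum.swap) simp
    then show ?thesis by (simp add: right_diff_distrib sum_subtractf D_def)
  qed
  have R: "(\<Sum>a\<in>F. w a * (fderiv H f m (\<theta> + t *\<^sub>R h) (replicate (m - l) h @ g a) -
        fderiv H f m \<theta> (replicate (m - l) h @ g a))) = D (m - l) t - D (m - l) 0" for t
    using l by (simp add: right_diff_distrib sum_subtractf D_def)
  have "\<exists>t. 0 < t \<and> t \<le> 1 \<and> D 0 1 - (\<Sum>i\<le>m - l. D i 0 / fact i) =
     (D (m - l) t - D (m - l) 0) / fact (m - l)"
  proof (cases "l = m")
    case True
    \<comment> \<open>With no derivative left to take, both sides are the same increment.\<close>
    then show ?thesis by (intro exI[of _ 1]) simp
  next
    case False
    have "\<exists>t>0. t < 1 \<and> D 0 1 = (\<Sum>i<m - l. D i 0 / fact i * 1 ^ i) + D (m - l) t / fact (m - l) * 1 ^ (m - l)"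
    proof (rule Maclaurin)
      show "\<forall>i t. i < m - l \<and> 0 \<le> t \<and> t \<le> 1 \<longrightarrow> (D i has_real_derivative D (Suc i) t) (at t)"
      proof (intro allI impI)
        fix i t assume i: "i < m - l \<and> (0::real) \<le> t \<and> t \<le> 1"
        have "((\<lambda>t. fderiv H f (l + i) (\<theta> + t *\<^sub>R h) (replicate i h @ g a)) has_real_derivative
          fderiv H f (Suc (l + i)) (\<theta> + t *\<^sub>R h) (h # replicate i h @ g a)) (at t)" if "a \<in> F" for a
          using g[OF that] i h by (intro fderiv_line[OF \<theta>]) auto
        then show "(D i has_real_derivative D (Suc i) t) (at t)"
          unfolding D_def by (intro DERIV_sum DERIV_cmult) simp
      qed
    qed (use False l in auto)
    then obtain t where t: "0 < t" "t < 1"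
      "D 0 1 = (\<Sum>i<m - l. D i 0 / fact i) + D (m - l) t / fact (m - l)" by auto
    have "(\<Sum>i\<le>m - l. D i 0 / fact i) = (\<Sum>i<m - l. D i 0 / fact i) + D (m - l) 0 / fact (m - l)"
      by (simp add: lessThan_Suc_atMost[symmetric])
    with t show ?thesis by (intro exI[of _ t]) (simp add: diff_divide_distrib)
  qed
  then show ?thesis unfolding L R .
qed

end

section \<open>The Lindeberg central limit theorem\<close>

text \<open>For the upper half, \<open>(1 - a + a\<^sup>2) * (1 + a) = 1 + a ^ 3\<close> is combined
  with \<open>1 + a \<le> exp a\<close>.\<close>

lemma abs_exp_minus_le: "0 \<le> (a::real) \<Longrightarrow> \<bar>exp (- a) - (1 - a)\<bar> \<le> a\<^sup>2"
proof -
  assume a: "0 \<le> a"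
  have "1 - a \<le> exp (- a)" using exp_ge_add_one_self[of "- a"] by simp
  moreover have "exp (- a) \<le> 1 - a + a\<^sup>2"
  proof -
    have "1 \<le> (1 - a + a\<^sup>2) * (1 + a)" using a by (simp add: algebra_simps power2_eq_square)
    also have "\<dots> \<le> (1 - a + a\<^sup>2) * exp a"
    proof (rule mult_left_mono)
      show "1 + a \<le> exp a" by (rule exp_ge_add_one_self)
      have "0 \<le> (1 - a / 2)\<^sup>2 + 3 / 4 * a\<^sup>2" by simp
      then show "0 \<le> 1 - a + a\<^sup>2" by (simp add: power2_diff power_divide)
    qed
    finally show ?thesis by (simp add: exp_minus field_simps)
  qed
  ultimately show ?thesis by linarith
qed

text \<open>Each characteristic function is compared with the Gaussian factor of the same variance;
  all factors have modulus at most 1, so the errors add. The Taylor error is split at the level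
  \<open>\<eta>\<close>: below it a factor \<open>\<eta>\<close> is gained, above it the second
  moment belongs to \<open>L\<close>. The last term handles squared variances through their maximum,
  which is at most \<open>\<eta>\<^sup>2 + L\<close>.\<close>

lemma (in prob_space) char_lindeberg_bound:
  fixes X :: "nat \<Rightarrow> 'a \<Rightarrow> real"
  assumes ind: "indep_vars (\<lambda>_. borel) X {1..n}"
    and int: "\<And>j. j \<in> {1..n} \<Longrightarrow> integrable M (X j)"
    and mean: "\<And>j. j \<in> {1..n} \<Longrightarrow> expectation (X j) = 0"
    and int2: "\<And>j. j \<in> {1..n} \<Longrightarrow> integrable M (\<lambda>\<omega>. (X j \<omega>)\<^sup>2)"
    and var: "(\<Sum>j=1..n. expectation (\<lambda>\<omega>. (X j \<omega>)\<^sup>2)) = 1"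
    and \<eta>: "0 < \<eta>"
  defines "L \<equiv> (\<Sum>j=1..n. expectation (\<lambda>\<omega>. (X j \<omega>)\<^sup>2 * indicator {\<omega>. \<bar>X j \<omega>\<bar> > \<eta>} \<omega>))"
  shows "cmod (char (distr M borel (\<lambda>\<omega>. \<Sum>j=1..n. X j \<omega>)) t - of_real (exp (- t\<^sup>2 / 2)))
    \<le> t\<^sup>2 * L + \<bar>t\<bar> ^ 3 * \<eta> / 6 + t ^ 4 / 4 * (\<eta>\<^sup>2 + L)"
proof -
  let ?v = "\<lambda>j. expectation (\<lambda>\<omega>. (X j \<omega>)\<^sup>2)"
  let ?L = "\<lambda>j. expectation (\<lambda>\<omega>. (X j \<omega>)\<^sup>2 * indicator {\<omega>. \<bar>X j \<omega>\<bar> > \<eta>} \<omega>)"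
  let ?\<phi> = "\<lambda>j. char (distr M borel (X j)) t"
  let ?e = "\<lambda>j. exp (- (t\<^sup>2 * ?v j / 2))"
  have meas: "X j \<in> borel_measurable M" if "j \<in> {1..n}" for j
    using ind that by (auto simp: indep_vars_def2)
  have intL: "integrable M (\<lambda>\<omega>. (X j \<omega>)\<^sup>2 * indicator {\<omega>. \<bar>X j \<omega>\<bar> > \<eta>} \<omega>)"
    if j: "j \<in> {1..n}" for j
  proof (rule Bochner_Integration.integrable_bound[OF int2[OF j]])
    have [measurable]: "X j \<in> borel_measurable M" using meas[OF j] .
    show "(\<lambda>\<omega>. (X j \<omega>)\<^sup>2 * indicator {\<omega>. \<bar>X j \<omega>\<bar> > \<eta>} \<omega>) \<in> borel_measurable M"
      unfolding indicator_def by measurable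
  qed (auto simp: indicator_def)
  have v0: "0 \<le> ?v j" for j by (intro integral_nonneg_AE) auto
  have L0: "0 \<le> ?L j" for j by (intro integral_nonneg_AE) (auto simp: indicator_def)
  have Lj: "?L j \<le> L" if "j \<in> {1..n}" for j
    unfolding L_def using that L0 by (intro member_le_sum) auto
  have vle: "?v j \<le> \<eta>\<^sup>2 + L" if j: "j \<in> {1..n}" for j
  proof -
    have "?v j \<le> expectation (\<lambda>\<omega>. \<eta>\<^sup>2 + (X j \<omega>)\<^sup>2 * indicator {\<omega>. \<bar>X j \<omega>\<bar> > \<eta>} \<omega>)"
    proof (rule integral_mono[OF int2[OF j]])
      show "integrable M (\<lambda>\<omega>. \<eta>\<^sup>2 + (X j \<omega>)\<^sup>2 * indicator {\<omega>. \<bar>X j \<omega>\<bar> > \<eta>} \<omega>)"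
        using intL[OF j] by simp
      fix \<omega>
      have "\<bar>X j \<omega>\<bar> \<le> \<eta> \<Longrightarrow> (X j \<omega>)\<^sup>2 \<le> \<eta>\<^sup>2" using \<eta> by (metis abs_le_square_iff abs_of_pos)
      then show "(X j \<omega>)\<^sup>2 \<le> \<eta>\<^sup>2 + (X j \<omega>)\<^sup>2 * indicator {\<omega>. \<bar>X j \<omega>\<bar> > \<eta>} \<omega>"
        by (auto simp: indicator_def)
    qed
    also have "\<dots> = \<eta>\<^sup>2 + ?L j" using intL[OF j] by (simp add: prob_space)
    finally show ?thesis using Lj[OF j] by linarith
  qed
  have step: "cmod (?\<phi> j - of_real (?e j)) \<le> t\<^sup>2 * ?L j + \<bar>t\<bar> ^ 3 * \<eta> / 6 * ?v j + t ^ 4 / 4 * (\<eta>\<^sup>2 + L) * ?v j"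
    if j: "j \<in> {1..n}" for j
  proof -
    have [measurable]: "X j \<in> borel_measurable M" using meas[OF j] .
    have "cmod (?\<phi> j - (1 - t\<^sup>2 * ?v j / 2)) \<le>
      (t\<^sup>2 / 6) * expectation (\<lambda>x. min (6 * (X j x)\<^sup>2) (\<bar>t\<bar> * \<bar>X j x\<bar>^3))"
      using char_approx3'[OF meas[OF j] int[OF j] int2[OF j] mean[OF j] _ refl, of "?v j"] mean[OF j]
      by simp
    also have "\<dots> \<le> (t\<^sup>2 / 6) * expectation (\<lambda>\<omega>. 6 * ((X j \<omega>)\<^sup>2 * indicator {\<omega>. \<bar>X j \<omega>\<bar> > \<eta>} \<omega>)
         + \<bar>t\<bar> * \<eta> * (X j \<omega>)\<^sup>2)"
    proof (intro mult_left_mono integral_mono)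
      show "integrable M (\<lambda>x. min (6 * (X j x)\<^sup>2) (\<bar>t\<bar> * \<bar>X j x\<bar> ^ 3))"
        by (rule Bochner_Integration.integrable_bound[of M "\<lambda>\<omega>. 6 * (X j \<omega>)\<^sup>2"]) (use int2[OF j] in auto)
      show "integrable M (\<lambda>\<omega>. 6 * ((X j \<omega>)\<^sup>2 * indicator {\<omega>. \<bar>X j \<omega>\<bar> > \<eta>} \<omega>) + \<bar>t\<bar> * \<eta> * (X j \<omega>)\<^sup>2)"
        using intL[OF j] int2[OF j] by auto
      fix \<omega>
      have "\<bar>t\<bar> * \<bar>X j \<omega>\<bar> ^ 3 \<le> \<bar>t\<bar> * \<eta> * (X j \<omega>)\<^sup>2" if "\<bar>X j \<omega>\<bar> \<le> \<eta>"
      proof -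
        have "\<bar>X j \<omega>\<bar> ^ 3 = \<bar>X j \<omega>\<bar> * (X j \<omega>)\<^sup>2" by (simp add: power3_eq_cube power2_eq_square)
        also have "\<dots> \<le> \<eta> * (X j \<omega>)\<^sup>2" using that by (intro mult_right_mono) auto
        finally show ?thesis by (simp add: mult_left_mono mult.assoc)
      qed
      moreover have "0 \<le> \<bar>t\<bar> * \<eta> * (X j \<omega>)\<^sup>2" using \<eta> by simp
      ultimately show "min (6 * (X j \<omega>)\<^sup>2) (\<bar>t\<bar> * \<bar>X j \<omega>\<bar> ^ 3) \<le>
        6 * ((X j \<omega>)\<^sup>2 * indicator {\<omega>. \<bar>X j \<omega>\<bar> > \<eta>} \<omega>) + \<bar>t\<bar> * \<eta> * (X j \<omega>)\<^sup>2"
        by (auto simp: indicator_def min_def not_less)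
    qed auto
    also have "\<dots> = (t\<^sup>2 / 6) * (6 * ?L j + \<bar>t\<bar> * \<eta> * ?v j)"
      using intL[OF j] int2[OF j] by simp
    also have "\<dots> = t\<^sup>2 * ?L j + \<bar>t\<bar> ^ 3 * \<eta> / 6 * ?v j"
      by (simp add: algebra_simps power3_eq_cube power2_eq_square)
    finally have 1: "cmod (?\<phi> j - (1 - t\<^sup>2 * ?v j / 2)) \<le> t\<^sup>2 * ?L j + \<bar>t\<bar> ^ 3 * \<eta> / 6 * ?v j" .
    have "cmod ((1 - t\<^sup>2 * ?v j / 2) - of_real (?e j)) = \<bar>?e j - (1 - t\<^sup>2 * ?v j / 2)\<bar>"
      by (simp only: norm_of_real of_real_eq_id id_apply abs_minus_commute)
    also have "\<dots> \<le> (t\<^sup>2 * ?v j / 2)\<^sup>2"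
      using v0 by (intro abs_exp_minus_le) auto
    also have "\<dots> = t ^ 4 / 4 * (?v j * ?v j)"
      by (simp add: power2_eq_square power4_eq_xxxx)
    also have "\<dots> \<le> t ^ 4 / 4 * ((\<eta>\<^sup>2 + L) * ?v j)"
      using vle[OF j] v0 by (intro mult_left_mono mult_right_mono) auto
    finally have 2: "cmod ((1 - t\<^sup>2 * ?v j / 2) - of_real (?e j)) \<le> t ^ 4 / 4 * (\<eta>\<^sup>2 + L) * ?v j"
      by (simp add: mult.assoc)
    have "cmod (?\<phi> j - of_real (?e j)) \<le> cmod (?\<phi> j - (1 - t\<^sup>2 * ?v j / 2)) +
        cmod ((1 - t\<^sup>2 * ?v j / 2) - of_real (?e j))"
      by (rule order_trans[OF _ norm_triangle_ineq]) simp
    then show ?thesis using 1 2 by linarith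
  qed
  have "char (distr M borel (\<lambda>\<omega>. \<Sum>j=1..n. X j \<omega>)) t = (\<Prod>j\<in>{1..n}. ?\<phi> j)"
    by (rule char_distr_sum[OF ind])
  moreover have "of_real (exp (- t\<^sup>2 / 2)) = (\<Prod>j\<in>{1..n}. complex_of_real (?e j))"
  proof -
    have "exp (- t\<^sup>2 / 2) = exp (\<Sum>j=1..n. - (t\<^sup>2 * ?v j / 2))"
      using var by (simp add: sum_negf sum_distrib_left[symmetric] sum_divide_distrib[symmetric])
    also have "\<dots> = (\<Prod>j\<in>{1..n}. ?e j)" by (rule exp_sum) simp
    finally show ?thesis by simp
  qed
  moreover have "cmod ((\<Prod>j\<in>{1..n}. ?\<phi> j) - (\<Prod>j\<in>{1..n}. complex_of_real (?e j))) \<le>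
    (\<Sum>j\<in>{1..n}. cmod (?\<phi> j - of_real (?e j)))"
  proof (rule norm_prod_diff)
    fix j assume j: "j \<in> {1..n}"
    interpret D: real_distribution "distr M borel (X j)" using meas[OF j] by simp
    show "cmod (?\<phi> j) \<le> 1" by (rule D.cmod_char_le_1)
    show "cmod (complex_of_real (?e j)) \<le> 1" using v0[of j] by simp
  qed
  moreover have "(\<Sum>j\<in>{1..n}. cmod (?\<phi> j - of_real (?e j))) \<le>
    (\<Sum>j\<in>{1..n}. t\<^sup>2 * ?L j + \<bar>t\<bar> ^ 3 * \<eta> / 6 * ?v j + t ^ 4 / 4 * (\<eta>\<^sup>2 + L) * ?v j)"
    using step by (rule sum_mono)
  moreover have "\<dots> = t\<^sup>2 * L + \<bar>t\<bar> ^ 3 * \<eta> / 6 + t ^ 4 / 4 * (\<eta>\<^sup>2 + L)"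
    unfolding sum.distrib sum_distrib_left[symmetric] var L_def[symmetric] by simp
  ultimately show ?thesis by simp
qed

text \<open>Slutsky's argument on characteristic functions: \<open>iexp (t * Z \<omega>)\<close> is
  within \<open>\<bar>t\<bar> * \<eta>\<close> of 1 where \<open>Z\<close> is small and within 2 of
  it elsewhere.\<close>

lemma (in prob_space) char_add_perturbation:
  fixes X Z :: "'a \<Rightarrow> real"
  assumes [measurable]: "X \<in> borel_measurable M" "Z \<in> borel_measurable M" and \<eta>: "0 < \<eta>"
  shows "cmod (char (distr M borel (\<lambda>\<omega>. X \<omega> + Z \<omega>)) t - char (distr M borel X) t)
    \<le> \<bar>t\<bar> * \<eta> + 2 * prob {\<omega>\<in>space M. \<bar>Z \<omega>\<bar> > \<eta>}"
proof -
  let ?B = "{\<omega>\<in>space M. \<bar>Z \<omega>\<bar> > \<eta>}"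
  have int: "integrable M (\<lambda>\<omega>. iexp (t * Y \<omega>))" if [measurable]: "Y \<in> borel_measurable M" for Y :: "'a \<Rightarrow> real"
    by (intro integrable_const_bound[of _ 1]) auto
  have "char (distr M borel (\<lambda>\<omega>. X \<omega> + Z \<omega>)) t - char (distr M borel X) t =
     (CLINT \<omega>|M. iexp (t * (X \<omega> + Z \<omega>)) - iexp (t * X \<omega>))"
    using int[of "\<lambda>\<omega>. X \<omega> + Z \<omega>"] int[of X] by (simp add: char_def integral_distr)
  also have "cmod \<dots> \<le> expectation (\<lambda>\<omega>. cmod (iexp (t * (X \<omega> + Z \<omega>)) - iexp (t * X \<omega>)))"
    by (rule integral_norm_bound)
  also have "\<dots> \<le> expectation (\<lambda>\<omega>. \<bar>t\<bar> * \<eta> + 2 * indicator ?B \<omega>)"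
  proof (rule integral_mono)
    show "integrable M (\<lambda>\<omega>. cmod (iexp (t * (X \<omega> + Z \<omega>)) - iexp (t * X \<omega>)))"
      using int[of "\<lambda>\<omega>. X \<omega> + Z \<omega>"] int[of X] by (intro integrable_norm Bochner_Integration.integrable_diff) auto
    show "integrable M (\<lambda>\<omega>. \<bar>t\<bar> * \<eta> + 2 * indicator ?B \<omega>)"
      by (intro Bochner_Integration.integrable_add integrable_mult_right) (auto simp: emeasure_eq_measure)
    fix \<omega> assume w: "\<omega> \<in> space M"
    have "iexp (t * (X \<omega> + Z \<omega>)) - iexp (t * X \<omega>) = iexp (t * X \<omega>) * (iexp (t * Z \<omega>) - 1)"
      by (simp add: algebra_simps exp_add[symmetric])
    then have e: "cmod (iexp (t * (X \<omega> + Z \<omega>)) - iexp (t * X \<omega>)) = cmod (iexp (t * Z \<omega>) - 1)"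
      by (simp add: norm_mult)
    have "cmod (iexp (t * Z \<omega>) - 1) \<le> \<bar>t * Z \<omega>\<bar>" "cmod (iexp (t * Z \<omega>) - 1) \<le> 2"
      using iexp_approx1[of "t * Z \<omega>" 0] iexp_approx2[of "t * Z \<omega>" 0] by simp_all
    moreover have "\<bar>t * Z \<omega>\<bar> \<le> \<bar>t\<bar> * \<eta>" if "\<bar>Z \<omega>\<bar> \<le> \<eta>"
      using that by (simp add: abs_mult mult_left_mono)
    moreover have "0 \<le> \<bar>t\<bar> * \<eta>" using \<eta> by simp
    ultimately show "cmod (iexp (t * (X \<omega> + Z \<omega>)) - iexp (t * X \<omega>)) \<le> \<bar>t\<bar> * \<eta> + 2 * indicator ?B \<omega>"
      unfolding e using w by (cases "\<bar>Z \<omega>\<bar> \<le> \<eta>") (auto simp: indicator_def not_le)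
  qed
  also have "\<dots> = \<bar>t\<bar> * \<eta> + 2 * prob ?B"
    by (subst Bochner_Integration.integral_add) (auto simp: emeasure_eq_measure prob_space)
  finally show ?thesis .
qed

text \<open>Levy's theorem wants a distribution at every index, while the hypothesis holds only for
  large \<open>n\<close>; the finitely many exceptions are replaced by the normal law
  itself.\<close>

lemma eventually_weak_conv_m:
  fixes N :: "nat \<Rightarrow> real measure"
  assumes ev: "\<forall>\<^sub>F n in sequentially. real_distribution (N n)"
    and lim: "\<And>t. (\<lambda>n. char (N n) t) \<longlonglongrightarrow> of_real (exp (- t\<^sup>2 / 2))"
  shows "weak_conv_m N std_normal_distribution"
proof -
  define N' where "N' n = (if real_distribution (N n) then N n else std_normal_distribution)" for n
  have eq: "\<forall>\<^sub>F n in sequentially. N' n = N n" using ev by eventually_elim (simp add: N'_def)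
  have "weak_conv_m N' std_normal_distribution"
  proof (rule levy_continuity)
    show "real_distribution (N' n)" for n by (simp add: N'_def real_dist_normal_dist)
    show "(\<lambda>n. char (N' n) t) \<longlonglongrightarrow> char std_normal_distribution t" for t
    proof -
      have "\<forall>\<^sub>F n in sequentially. char (N n) t = char (N' n) t" using eq by eventually_elim simp
      from tendsto_cong[OF this] lim[of t] show ?thesis by (simp add: char_std_normal_distribution)
    qed
  qed (rule real_dist_normal_dist)
  then show ?thesis
    unfolding weak_conv_m_def weak_conv_def
  proof safe
    fix x assume "\<forall>x. isCont (cdf std_normal_distribution) x \<longrightarrow>
        (\<lambda>n. cdf (N' n) x) \<longlonglongrightarrow> cdf std_normal_distribution x"
      and "isCont (cdf std_normal_distribution) x"
    then have "(\<lambda>n. cdf (N' n) x) \<longlonglongrightarrow> cdf std_normal_distribution x" by blast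
    moreover have "\<forall>\<^sub>F n in sequentially. cdf (N' n) x = cdf (N n) x" using eq by eventually_elim simp
    ultimately show "(\<lambda>n. cdf (N n) x) \<longlonglongrightarrow> cdf std_normal_distribution x"
      by (rule Lim_transform_eventually)
  qed
qed

text \<open>The perturbation \<open>Z\<close> is built in, so that Slutsky's step and the limit of
  the sum are one estimate. The threshold \<open>\<eta>\<close> is fixed first, to make the terms
  that carry only \<open>\<eta>\<close> small; then \<open>n\<close> grows, and the Lindeberg sum
  and the probability of a large \<open>Z\<close> vanish.\<close>

theorem lindeberg_central_limit_theorem:
  fixes M :: "nat \<Rightarrow> 'w measure" and X :: "nat \<Rightarrow> nat \<Rightarrow> 'w \<Rightarrow> real" and Z :: "nat \<Rightarrow> 'w \<Rightarrow> real"
  assumes X: "\<forall>\<^sub>F n in sequentially. prob_space (M n) \<and>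
      prob_space.indep_vars (M n) (\<lambda>_. borel) (X n) {1..n} \<and>
      (\<forall>j\<in>{1..n}. integrable (M n) (X n j) \<and> (\<integral>\<omega>. X n j \<omega> \<partial>M n) = 0 \<and>
         integrable (M n) (\<lambda>\<omega>. (X n j \<omega>)\<^sup>2)) \<and>
      (\<Sum>j=1..n. \<integral>\<omega>. (X n j \<omega>)\<^sup>2 \<partial>M n) = 1"
    and lindeberg: "\<And>\<eta>. 0 < \<eta> \<Longrightarrow>
      (\<lambda>n. \<Sum>j=1..n. \<integral>\<omega>. (X n j \<omega>)\<^sup>2 * indicator {\<omega>. \<bar>X n j \<omega>\<bar> > \<eta>} \<omega> \<partial>M n) \<longlonglongrightarrow> 0"
    and Z: "\<forall>\<^sub>F n in sequentially. Z n \<in> borel_measurable (M n)"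
    and Z0: "\<And>\<eta>. 0 < \<eta> \<Longrightarrow> (\<lambda>n. measure (M n) {\<omega>\<in>space (M n). \<bar>Z n \<omega>\<bar> > \<eta>}) \<longlonglongrightarrow> 0"
  shows "weak_conv_m (\<lambda>n. distr (M n) borel (\<lambda>\<omega>. (\<Sum>j=1..n. X n j \<omega>) + Z n \<omega>)) std_normal_distribution"
proof (rule eventually_weak_conv_m)
  have meas: "\<forall>\<^sub>F n in sequentially. prob_space (M n) \<and> Z n \<in> borel_measurable (M n) \<and>
      (\<lambda>\<omega>. \<Sum>j=1..n. X n j \<omega>) \<in> borel_measurable (M n)"
    using X Z
  proof eventually_elim
    case (elim n)
    then interpret prob_space "M n" by simp
    have "X n j \<in> borel_measurable (M n)" if "j \<in> {1..n}" for j
      using elim that by (auto simp: indep_vars_def2)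
    then show ?case using elim prob_space_axioms by auto
  qed
  then show "\<forall>\<^sub>F n in sequentially. real_distribution (distr (M n) borel (\<lambda>\<omega>. (\<Sum>j=1..n. X n j \<omega>) + Z n \<omega>))"
  proof eventually_elim
    case (elim n)
    then interpret prob_space "M n" by simp
    show ?case using elim by (intro real_distribution_distr) auto
  qed
  fix t :: real
  show "(\<lambda>n. char (distr (M n) borel (\<lambda>\<omega>. (\<Sum>j=1..n. X n j \<omega>) + Z n \<omega>)) t) \<longlonglongrightarrow>
    of_real (exp (- t\<^sup>2 / 2))"
  proof (rule LIM_zero_cancel, rule tendstoI)
    fix e :: real assume e: "0 < e"
    define L where "L \<eta> n = (\<Sum>j=1..n. \<integral>\<omega>. (X n j \<omega>)\<^sup>2 * indicator {\<omega>. \<bar>X n j \<omega>\<bar> > \<eta>} \<omega> \<partial>M n)" for \<eta> n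
    define q where "q \<eta> n = measure (M n) {\<omega>\<in>space (M n). \<bar>Z n \<omega>\<bar> > \<eta>}" for \<eta> n
    have "((\<lambda>\<eta>. \<bar>t\<bar> * \<eta> + \<bar>t\<bar> ^ 3 * \<eta> / 6 + t ^ 4 / 4 * \<eta>\<^sup>2) \<longlongrightarrow> \<bar>t\<bar> * 0 + \<bar>t\<bar> ^ 3 * 0 / 6 + t ^ 4 / 4 * 0\<^sup>2) (at_right 0)"
      by (intro tendsto_intros) auto
    then have "\<forall>\<^sub>F \<eta> in at_right 0. \<bar>t\<bar> * \<eta> + \<bar>t\<bar> ^ 3 * \<eta> / 6 + t ^ 4 / 4 * \<eta>\<^sup>2 < e / 2"
      using e by (intro order_tendstoD(2)) auto
    moreover have "\<forall>\<^sub>F \<eta>::real in at_right 0. 0 < \<eta>" by (simp add: eventually_at_right_less)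
    ultimately have "\<forall>\<^sub>F \<eta> in at_right 0. 0 < \<eta> \<and> \<bar>t\<bar> * \<eta> + \<bar>t\<bar> ^ 3 * \<eta> / 6 + t ^ 4 / 4 * \<eta>\<^sup>2 < e / 2"
      by eventually_elim simp
    then obtain \<eta> where \<eta>: "0 < \<eta>" "\<bar>t\<bar> * \<eta> + \<bar>t\<bar> ^ 3 * \<eta> / 6 + t ^ 4 / 4 * \<eta>\<^sup>2 < e / 2"
      using eventually_happens'[OF trivial_limit_at_right_real] by blast
    have "(\<lambda>n. t\<^sup>2 * L \<eta> n + t ^ 4 / 4 * L \<eta> n + 2 * q \<eta> n) \<longlonglongrightarrow> t\<^sup>2 * 0 + t ^ 4 / 4 * 0 + 2 * 0"
      using lindeberg[OF \<eta>(1)] Z0[OF \<eta>(1)] unfolding L_def q_def by (intro tendsto_intros)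
    then have "\<forall>\<^sub>F n in sequentially. t\<^sup>2 * L \<eta> n + t ^ 4 / 4 * L \<eta> n + 2 * q \<eta> n < e / 2"
      using e by (intro order_tendstoD(2)) auto
    then show "\<forall>\<^sub>F n in sequentially. dist (char (distr (M n) borel
        (\<lambda>\<omega>. (\<Sum>j=1..n. X n j \<omega>) + Z n \<omega>)) t - of_real (exp (- t\<^sup>2 / 2))) 0 < e"
      using X meas
    proof eventually_elim
      case (elim n)
      then interpret prob_space "M n" by simp
      let ?c = "char (distr (M n) borel (\<lambda>\<omega>. \<Sum>j=1..n. X n j \<omega>)) t"
      have "cmod (?c - of_real (exp (- t\<^sup>2 / 2)))
         \<le> t\<^sup>2 * L \<eta> n + \<bar>t\<bar> ^ 3 * \<eta> / 6 + t ^ 4 / 4 * (\<eta>\<^sup>2 + L \<eta> n)"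
        unfolding L_def using elim \<eta>(1) by (intro char_lindeberg_bound) auto
      moreover have "cmod (char (distr (M n) borel (\<lambda>\<omega>. (\<Sum>j=1..n. X n j \<omega>) + Z n \<omega>)) t - ?c)
         \<le> \<bar>t\<bar> * \<eta> + 2 * q \<eta> n"
        unfolding q_def using elim \<eta>(1) by (intro char_add_perturbation) auto
      moreover have "cmod (char (distr (M n) borel (\<lambda>\<omega>. (\<Sum>j=1..n. X n j \<omega>) + Z n \<omega>)) t -
          of_real (exp (- t\<^sup>2 / 2))) \<le>
        cmod (char (distr (M n) borel (\<lambda>\<omega>. (\<Sum>j=1..n. X n j \<omega>) + Z n \<omega>)) t - ?c) +
        cmod (?c - of_real (exp (- t\<^sup>2 / 2)))"
        by (rule order_trans[OF _ norm_triangle_ineq]) simp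
      moreover have "t ^ 4 / 4 * (\<eta>\<^sup>2 + L \<eta> n) = t ^ 4 / 4 * \<eta>\<^sup>2 + t ^ 4 / 4 * L \<eta> n"
        by (rule distrib_left)
      ultimately show ?case
        unfolding dist_0_norm dist_norm diff_zero using elim(1) \<eta>(2) by linarith
    qed
  qed
qed

section \<open>Centred sums and Hilbert-Schmidt norms\<close>

lemma sum_Pow_card:
  fixes g :: "nat \<Rightarrow> real"
  assumes "finite A"
  shows "(\<Sum>S\<in>Pow A. g (card S)) = (\<Sum>l\<le>card A. real (card A choose l) * g l)"
proof -
  have "(\<Sum>S\<in>Pow A. g (card S)) = (\<Sum>l\<le>card A. \<Sum>S\<in>{S\<in>Pow A. card S = l}. g (card S))"
    using assms by (intro sum.group[symmetric]) (auto intro: card_mono)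
  also have "\<dots> = (\<Sum>l\<le>card A. real (card {S. S \<subseteq> A \<and> card S = l}) * g l)"
    by (intro sum.cong refl) simp
  finally show ?thesis using n_subsets[OF assms] by simp
qed

text \<open>The slots receiving \<open>y\<close> form a set \<open>S\<close>. Symmetry of the form
  and invariance of the permutation average move \<open>S\<close> to the first \<open>card S\<close>
  slots, so only its size matters; the binomial coefficient counts the sets of that size.\<close>

lemma perm_avg_symmetric_binomial:
  assumes H: "subspace H" and T: "multilinear_form H q T" "symmetric_form H q T"
    and q: "q \<le> n" and \<delta>: "\<delta> \<in> H" and y: "\<And>j. j \<in> {1..n} \<Longrightarrow> y j \<in> H"
  shows "perm_avg n (\<lambda>p. T (map (\<lambda>i. y (p i) + \<delta>) [1..<Suc q])) =
    (\<Sum>l\<le>q. real (q choose l) *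
       perm_avg n (\<lambda>p. T (replicate (q - l) \<delta> @ map (\<lambda>i. y (p i)) [1..<Suc l])))"
proof -
  let ?xs = "[1..<Suc q]"
  have xs: "set ?xs = {1..q}" by auto
  have yp: "y (p i) \<in> H" if "p permutes {1..n}" "i \<in> {1..q}" for p i
    using permutes_in_image[OF that(1), of i] that(2) q by (intro y) auto
  let ?b = "\<lambda>l. perm_avg n (\<lambda>p. T (replicate (q - l) \<delta> @ map (\<lambda>i. y (p i)) [1..<Suc l]))"
  have one: "perm_avg n (\<lambda>p. T (map (\<lambda>i. if i \<in> S then y (p i) else \<delta>) ?xs)) = ?b (card S)"
    if S: "S \<subseteq> {1..q}" for S
  proof -
    let ?l = "card S"
    have l: "?l \<le> q" using card_mono[OF _ S] by simp
    obtain \<pi> where \<pi>: "\<pi> permutes {1..q}" "\<pi> ` {1..?l} = S"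
      using ex_permutes_image_eq[OF S] by blast
    have \<pi>n: "\<pi> permutes {1..n}" using \<pi>(1) q by (intro permutes_subset[OF \<pi>(1)]) auto
    have mem: "\<pi> i \<in> S \<longleftrightarrow> i \<in> {1..?l}" for i
      using inj_image_mem_iff[OF permutes_inj[OF \<pi>(1)], of i "{1..?l}"] unfolding \<pi>(2) .
    \<comment> \<open>After composition with the inverse of \<open>\<pi>\<close>, slot
      \<open>\<pi> i\<close> carries \<open>y (p i)\<close>; reordering the slots by
      \<open>\<pi>\<close> then brings the slots of \<open>S\<close> to the front.\<close>
    have "perm_avg n (\<lambda>p. T (map (\<lambda>i. if i \<in> S then y (p i) else \<delta>) ?xs)) =
      perm_avg n (\<lambda>p. T (map (\<lambda>i. if i \<in> S then y ((p \<circ> inv \<pi>) i) else \<delta>) ?xs))"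
      using perm_avg_compose[OF permutes_inv[OF \<pi>n],
          of "\<lambda>p. T (map (\<lambda>i. if i \<in> S then y (p i) else \<delta>) ?xs)"] by simp
    also have "\<dots> = ?b ?l"
    proof (rule perm_avg_cong)
      fix p assume p: "p permutes {1..n}"
      let ?v = "\<lambda>i. if i \<in> S then y ((p \<circ> inv \<pi>) i) else \<delta>"
      have "mset (map \<pi> ?xs) = mset ?xs"
      proof -
        have "image_mset \<pi> (mset_set {1..q}) = mset_set {1..q}"
          using permutes_image[OF \<pi>(1)] permutes_inj_on[OF \<pi>(1)] image_mset_mset_set[of \<pi> "{1..q}"] by simp
        moreover have "mset ?xs = mset_set {1..q}"
          using mset_set_set[of ?xs] xs by (simp del: upt_Suc)
        ultimately show ?thesis by (simp del: upt_Suc)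
      qed
      then have "mset (map ?v ?xs) = mset (map ?v (map \<pi> ?xs))" by (simp del: upt_Suc map_map)
      also have "map ?v (map \<pi> ?xs) = map (\<lambda>i. if i \<in> {1..?l} then y (p i) else \<delta>) ?xs"
        using mem permutes_inverses(2)[OF \<pi>(1)] by (simp del: upt_Suc atLeastAtMost_iff)
      also have "map (\<lambda>i. if i \<in> {1..?l} then y (p i) else \<delta>) ?xs =
          map (\<lambda>i. y (p i)) [1..<Suc ?l] @ replicate (q - ?l) \<delta>"
      proof -
        have "?xs = [1..<Suc ?l] @ [Suc ?l..<Suc q]"
          using l upt_add_eq_append[of 1 "Suc ?l" "q - ?l"] by (simp del: upt_Suc)
        then have "map (\<lambda>i. if i \<in> {1..?l} then y (p i) else \<delta>) ?xs =
          map (\<lambda>i. y (p i)) [1..<Suc ?l] @ map (\<lambda>i. \<delta>) [Suc ?l..<Suc q]"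
          by (auto simp del: upt_Suc)
        then show ?thesis by (simp add: map_replicate_const del: upt_Suc)
      qed
      finally have m: "mset (map ?v ?xs) = mset (replicate (q - ?l) \<delta> @ map (\<lambda>i. y (p i)) [1..<Suc ?l])"
        by (simp add: ac_simps del: upt_Suc)
      have "set (replicate (q - ?l) \<delta> @ map (\<lambda>i. y (p i)) [1..<Suc ?l]) \<subseteq> H"
        using \<delta> yp[OF p] l by (auto simp del: upt_Suc split: if_splits)
      then show "T (map ?v ?xs) = T (replicate (q - ?l) \<delta> @ map (\<lambda>i. y (p i)) [1..<Suc ?l])"
        using T(2) m l unfolding symmetric_form_def by (auto simp del: upt_Suc)
    qed
    finally show ?thesis .
  qed
  have "perm_avg n (\<lambda>p. T (map (\<lambda>i. y (p i) + \<delta>) ?xs)) =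
    perm_avg n (\<lambda>p. \<Sum>S\<in>Pow {1..q}. T (map (\<lambda>i. if i \<in> S then y (p i) else \<delta>) ?xs))"
  proof (rule perm_avg_cong)
    fix p assume p: "p permutes {1..n}"
    show "T (map (\<lambda>i. y (p i) + \<delta>) ?xs) = (\<Sum>S\<in>Pow {1..q}. T (map (\<lambda>i. if i \<in> S then y (p i) else \<delta>) ?xs))"
      using multilinear_expand_add[OF H T(1), of ?xs "[]" "\<lambda>i. y (p i)" "\<lambda>_. \<delta>"] yp[OF p] \<delta>
      unfolding xs by (simp del: upt_Suc)
  qed
  also have "\<dots> = (\<Sum>S\<in>Pow {1..q}. ?b (card S))"
    unfolding perm_avg_sum by (intro sum.cong refl one) auto
  also have "\<dots> = (\<Sum>l\<le>q. real (q choose l) * ?b l)"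
    using sum_Pow_card[of "{1..q}" ?b] by (simp del: upt_Suc)
  finally show ?thesis .
qed

text \<open>Indices of \<open>w\<close> that occur only once are eliminated through \<open>\<Sum>j. y j = 0\<close>; when every index
  occurs at least twice, the bound is \<open>\<Sum>j. \<parallel>y j\<parallel>^c \<le> Q^(c/2)\<close>.\<close>

lemma perm_avg_centred_bound:
  fixes y :: "nat \<Rightarrow> 'a::real_normed_vector"
  assumes H: "subspace H" and T: "multilinear_form H k T" "form_le H k T N" and N: "0 \<le> N"
    and y: "\<And>j. j \<in> {1..n} \<Longrightarrow> y j \<in> H" and sum0: "(\<Sum>j=1..n. y j) = 0"
    and w: "length w = k" "set w \<subseteq> {1..n}"
  shows "\<bar>perm_avg n (\<lambda>p. T (map (\<lambda>i. y (p i)) w))\<bar> \<le>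
    fact (card (set w)) * N * sqrt (\<Sum>j=1..n. (norm (y j))\<^sup>2) ^ k / ffact n (card (set w))"
  using w
proof (induction "card (set w)" arbitrary: w rule: less_induct)
  case less
  let ?q = "sqrt (\<Sum>j=1..n. (norm (y j))\<^sup>2)"
  have q0: "0 \<le> ?q" by (simp add: sum_nonneg)
  have q2: "?q\<^sup>2 = (\<Sum>j=1..n. (norm (y j))\<^sup>2)" by (simp add: sum_nonneg)
  have yp: "y (p i) \<in> H" if "p permutes {1..n}" "i \<in> {1..n}" for p i
    using permutes_in_image[OF that(1), of i] that(2) by (intro y) auto
  have cw: "card (set w) \<le> n" using card_mono[OF _ less.prems(2)] by simp
  have fp: "0 < ffact n (card (set w))" using cw by (rule ffact_pos)
  show ?case
  proof (cases "\<forall>t\<in>set w. 2 \<le> count (mset w) t")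
    case True
    let ?c = "count (mset w)"
    have yq: "norm (y j) \<le> ?q" if "j \<in> {1..n}" for j
    proof (rule power2_le_imp_le[OF _ q0])
      show "(norm (y j))\<^sup>2 \<le> ?q\<^sup>2"
        unfolding q2 using that by (intro member_le_sum) auto
    qed
    have cb: "(\<Sum>j=1..n. norm (y j) ^ ?c t) \<le> ?q ^ ?c t" if t: "t \<in> set w" for t
    proof -
      \<comment> \<open>Two of the factors are kept and summed to the square of \<open>?q\<close>;
        every further factor is at most \<open>?q\<close>.\<close>
      have c: "?c t = 2 + (?c t - 2)" using True t by auto
      have "(\<Sum>j=1..n. norm (y j) ^ ?c t) = (\<Sum>j=1..n. (norm (y j))\<^sup>2 * norm (y j) ^ (?c t - 2))"
        by (subst c) (simp only: power_add)
      also have "\<dots> \<le> (\<Sum>j=1..n. (norm (y j))\<^sup>2 * ?q ^ (?c t - 2))"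
        using yq by (intro sum_mono mult_left_mono power_mono) auto
      also have "\<dots> = ?q\<^sup>2 * ?q ^ (?c t - 2)" by (simp only: q2 sum_distrib_right)
      also have "\<dots> = ?q ^ ?c t" by (subst (2) c) (simp only: power_add)
      finally show ?thesis .
    qed
    have "\<bar>perm_avg n (\<lambda>p. T (map (\<lambda>i. y (p i)) w))\<bar> \<le> perm_avg n (\<lambda>p. \<bar>T (map (\<lambda>i. y (p i)) w)\<bar>)"
      by (rule perm_avg_abs_le)
    also have "\<dots> \<le> perm_avg n (\<lambda>p. N * (\<Prod>t\<in>set w. norm (y (p t)) ^ ?c t))"
    proof (rule perm_avg_mono)
      fix p assume p: "p permutes {1..n}"
      have "\<bar>T (map (\<lambda>i. y (p i)) w)\<bar> \<le> N * prod_list (map norm (map (\<lambda>i. y (p i)) w))"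
        using less.prems yp[OF p] by (intro form_leD[OF T(2)]) auto
      also have "prod_list (map norm (map (\<lambda>i. y (p i)) w)) =
          prod_mset (image_mset (\<lambda>i. norm (y (p i))) (mset w))"
        by (simp add: prod_mset_prod_list[symmetric] comp_def)
      also have "\<dots> = (\<Prod>t\<in>set w. norm (y (p t)) ^ ?c t)"
        by (simp add: image_prod_mset_multiplicity)
      finally show "\<bar>T (map (\<lambda>i. y (p i)) w)\<bar> \<le> N * (\<Prod>t\<in>set w. norm (y (p t)) ^ ?c t)" .
    qed
    also have "\<dots> \<le> N * ((\<Prod>t\<in>set w. \<Sum>j=1..n. norm (y j) ^ ?c t) / ffact n (card (set w)))"
      unfolding perm_avg_cmult using less.prems N
      by (intro mult_left_mono perm_avg_prod_le) auto
    also have "\<dots> \<le> N * ((\<Prod>t\<in>set w. ?q ^ ?c t) / ffact n (card (set w)))"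
      using N fp cb by (intro mult_left_mono divide_right_mono prod_mono) (auto intro!: sum_nonneg)
    also have "(\<Prod>t\<in>set w. ?q ^ ?c t) = ?q ^ k"
      using size_multiset_overloaded_eq[of "mset w"] less.prems(1) by (simp add: power_sum[symmetric])
    also have "N * (?q ^ k / ffact n (card (set w))) \<le>
       fact (card (set w)) * (N * (?q ^ k / ffact n (card (set w))))"
    proof -
      have "1 * (N * (?q ^ k / ffact n (card (set w)))) \<le>
         fact (card (set w)) * (N * (?q ^ k / ffact n (card (set w))))"
        using N q0 fp by (intro mult_right_mono fact_ge_1 mult_nonneg_nonneg divide_nonneg_pos zero_le_power) auto
      then show ?thesis by simp
    qed
    finally show ?thesis by (simp add: mult.assoc)
  next
    case False
    then obtain t where t: "t \<in> set w" "count (mset w) t < 2" by auto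
    have "0 < count (mset w) t" using t(1) by (simp only: count_greater_zero_iff set_mset_mset)
    then have "count (mset w) t = 1" using t(2) by linarith
    moreover obtain a b where ab: "w = a @ t # b" using split_list[OF t(1)] by auto
    ultimately have nt: "t \<notin> set a" "t \<notin> set b"
      by (auto simp: count_eq_zero_iff)
    let ?I = "set a \<union> set b"
    have cI: "card (set w) = Suc (card ?I)" using nt ab by simp
    have I: "?I \<subseteq> {1..n}" "t \<in> {1..n} - ?I" using less.prems ab nt by auto
    have pos: "real n - real (card ?I) > 0" using cI cw by simp
    let ?A = "\<lambda>p u. T (map (\<lambda>i. y (p i)) (a @ u # b))"
    have "perm_avg n (\<lambda>p. T (map (\<lambda>i. y (p i)) w)) =
      perm_avg n (\<lambda>p. (\<Sum>i\<in>{1..n} - ?I. T (map (\<lambda>s. y ((p \<circ> Transposition.transpose t i) s)) w)) / (real n - real (card ?I)))"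
      by (rule perm_avg_resample[OF I])
    also have "\<dots> = perm_avg n (\<lambda>p. (- (\<Sum>u\<in>?I. ?A p u)) / (real n - real (card ?I)))"
    proof (rule perm_avg_cong, rule arg_cong2[of _ _ _ _ "(/)"])
      fix p assume p: "p permutes {1..n}"
      have m: "map (\<lambda>s. y ((p \<circ> Transposition.transpose t i) s)) w =
         map (\<lambda>i. y (p i)) a @ y (p i) # map (\<lambda>i. y (p i)) b" if "i \<in> {1..n} - ?I" for i
        using that nt ab by (auto simp: Transposition.transpose_def)
      let ?a = "map (\<lambda>i. y (p i)) a" and ?b = "map (\<lambda>i. y (p i)) b"
      have ab': "length ?a + length ?b + 1 = k" "set ?a \<subseteq> H" "set ?b \<subseteq> H"
        using less.prems ab yp[OF p] I by auto
      have "(\<Sum>i\<in>{1..n} - ?I. T (map (\<lambda>s. y ((p \<circ> Transposition.transpose t i) s)) w)) =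
         (\<Sum>i\<in>{1..n} - ?I. T (?a @ y (p i) # ?b))"
        using m by (intro sum.cong refl arg_cong[of _ _ T])
      also have "\<dots> = T (?a @ (\<Sum>i\<in>{1..n} - ?I. y (p i)) # ?b)"
        using yp[OF p] by (intro multilinear_slot_sum[OF H T(1) ab', symmetric]) auto
      also have "(\<Sum>i\<in>{1..n} - ?I. y (p i)) = (-1) *\<^sub>R (\<Sum>i\<in>?I. y (p i))"
      proof -
        have "(\<Sum>i\<in>{1..n}. y (p i)) = (\<Sum>j\<in>{1..n}. y j)"
          using sum.permute[OF p, of y] by (simp add: comp_def)
        then show ?thesis using sum0 I by (simp add: sum_diff)
      qed
      also have "T (?a @ (-1) *\<^sub>R (\<Sum>i\<in>?I. y (p i)) # ?b) = - T (?a @ (\<Sum>i\<in>?I. y (p i)) # ?b)"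
        using yp[OF p] I by (subst multilinear_slot_scale[OF T(1) ab']) (auto intro!: subspace_sum[OF H])
      also have "T (?a @ (\<Sum>i\<in>?I. y (p i)) # ?b) = (\<Sum>i\<in>?I. T (?a @ y (p i) # ?b))"
        using yp[OF p] I by (intro multilinear_slot_sum[OF H T(1) ab']) auto
      finally show "(\<Sum>i\<in>{1..n} - ?I. T (map (\<lambda>s. y ((p \<circ> Transposition.transpose t i) s)) w)) = - (\<Sum>u\<in>?I. ?A p u)"
        by simp
    qed simp
    also have "\<dots> = - (\<Sum>u\<in>?I. perm_avg n (\<lambda>p. ?A p u)) / (real n - real (card ?I))"
      using perm_avg_cmult[of n "-1"] by (simp add: perm_avg_divide perm_avg_sum)
    finally have eq: "\<bar>perm_avg n (\<lambda>p. T (map (\<lambda>i. y (p i)) w))\<bar> =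
       \<bar>\<Sum>u\<in>?I. perm_avg n (\<lambda>p. ?A p u)\<bar> / (real n - real (card ?I))"
      using pos by simp
    let ?r = "fact (card ?I) * N * ?q ^ k / ffact n (card ?I)"
    have r0: "0 \<le> ?r" using N q0 cI cw ffact_pos[of "card ?I" n] by (simp del: real_sqrt_pow2)
    have "\<bar>\<Sum>u\<in>?I. perm_avg n (\<lambda>p. ?A p u)\<bar> \<le> (\<Sum>u\<in>?I. ?r)"
    proof (rule order_trans[OF sum_abs sum_mono])
      fix u assume u: "u \<in> ?I"
      then have s: "set (a @ u # b) = ?I" by auto
      \<comment> \<open>Putting a used label \<open>u\<close> in place of \<open>t\<close> leaves
        the labels \<open>?I\<close>, one fewer than before, so the induction hypothesis
        applies.\<close>
      have "\<bar>perm_avg n (\<lambda>p. ?A p u)\<bar> \<le> fact (card (set (a @ u # b))) * N * ?q ^ k / ffact n (card (set (a @ u # b)))"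
        using cI s less.prems ab I by (intro less.hyps) auto
      then show "\<bar>perm_avg n (\<lambda>p. ?A p u)\<bar> \<le> ?r" unfolding s .
    qed
    also have "\<dots> = real (card ?I) * ?r" by simp
    \<comment> \<open>One more than the true number of choices, so that the numerator follows the
      recursion of the factorial; the denominator \<open>n - card ?I\<close> completes the falling
      factorial.\<close>
    also have "\<dots> \<le> real (card (set w)) * ?r"
      using r0 cI by (intro mult_right_mono) auto
    finally have "\<bar>perm_avg n (\<lambda>p. T (map (\<lambda>i. y (p i)) w))\<bar> \<le>
       (real (card (set w)) * ?r) / (real n - real (card ?I))"
      unfolding eq using pos by (intro divide_right_mono) auto
    also have "\<dots> = fact (card (set w)) * N * ?q ^ k / ffact n (card (set w))"
      unfolding cI fact_Suc ffact_Suc by (simp add: mult.assoc)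
    finally show ?thesis .
  qed
qed

section \<open>Orthonormal bases and coordinates of multilinear forms\<close>

lemma countable_orthonormal:
  fixes B :: "'a::{real_inner,second_countable_topology} set"
  assumes "orthonormal_basis H B"
  shows "countable B"
proof -
  \<comment> \<open>Distinct orthonormal vectors are \<open>sqrt 2\<close> apart, so the balls of
    radius 1/2 around them are disjoint, and a second countable space has room for countably many
    only.\<close>
  have d: "sqrt 2 \<le> dist u v" if "u \<in> B" "v \<in> B" "u \<noteq> v" for u v
  proof -
    have "u \<bullet> v = 0" "norm u = 1" "norm v = 1"
      using assms that by (auto simp: orthonormal_basis_def pairwise_def orthogonal_def)
    then have "(dist u v)\<^sup>2 = 2"
      by (simp add: dist_norm power2_norm_eq_inner inner_diff_left inner_diff_right inner_commute
          norm_eq_1)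
    then show ?thesis by (metis order_refl real_sqrt_abs abs_of_nonneg zero_le_dist)
  qed
  have "pairwise disjnt ((\<lambda>u. ball u (1/2)) ` B)"
  proof (rule pairwise_imageI)
    fix u v assume uv: "u \<in> B" "v \<in> B" "u \<noteq> v"
    have "1 < sqrt (2::real)" by simp
    then have "1 < dist u v" using d[OF uv] by linarith
    then show "disjnt (ball u (1/2)) (ball v (1/2))"
      unfolding disjnt_def by (metis disjoint_ballI field_sum_of_halves less_imp_le)
  qed
  then have "countable ((\<lambda>u. ball u (1/2)) ` B)"
    by (intro countable_disjoint_open_subsets) auto
  moreover have "inj_on (\<lambda>u. ball u (1/2)) B"
  proof (rule inj_onI)
    fix u v assume uv: "u \<in> B" "v \<in> B" "ball u (1/2) = ball v (1/2 :: real)"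
    have "u \<in> ball v (1/2)" unfolding uv(3)[symmetric] by simp
    then have "dist u v < 1/2" by (simp add: dist_commute)
    moreover have "1 < sqrt (2::real)" by simp
    ultimately show "u = v" using d[OF uv(1,2)] by fastforce
  qed
  ultimately show ?thesis by (rule countable_image_inj_on)
qed

text \<open>The sets \<open>F N\<close> are finite sections of an enumeration of \<open>B\<close>.
  Once the span of such a section contains an approximant \<open>w\<close> of \<open>z\<close>, the
  projection is at least as close to \<open>z\<close> as \<open>w\<close> is, by Pythagoras.\<close>

lemma orthonormal_basis_projections:
  fixes H :: "'a::{real_inner,second_countable_topology} set"
  assumes B: "orthonormal_basis H B"
  obtains F :: "nat \<Rightarrow> 'a set" where "\<And>N. finite (F N)" "\<And>N. F N \<subseteq> B"
    "\<And>z. z \<in> H \<Longrightarrow> (\<lambda>N. \<Sum>e\<in>F N. (z \<bullet> e) *\<^sub>R e) \<longlonglongrightarrow> z"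
proof -
  have cB: "countable B" by (rule countable_orthonormal[OF B])
  have on: "u \<bullet> v = (if u = v then 1 else 0)" if "u \<in> B" "v \<in> B" for u v
    using B that by (auto simp: orthonormal_basis_def pairwise_def orthogonal_def norm_eq_1)
  define F where "F N = {e \<in> B. to_nat_on B e \<le> N}" for N
  have fin: "finite (F N)" for N
  proof -
    have "inj_on (to_nat_on B) (F N)"
      by (rule inj_on_subset[OF inj_on_to_nat_on[OF cB]]) (auto simp: F_def)
    moreover have "to_nat_on B ` F N \<subseteq> {..N}" by (auto simp: F_def)
    ultimately show ?thesis by (meson finite_atMost finite_imageD finite_subset)
  qed
  have sub: "F N \<subseteq> B" for N by (auto simp: F_def)
  have "(\<lambda>N. \<Sum>e\<in>F N. (z \<bullet> e) *\<^sub>R e) \<longlonglongrightarrow> z" if z: "z \<in> H" for z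
  proof (rule LIMSEQ_I)
    fix r :: real assume r: "0 < r"
    have "z \<in> closure (span B)" using B z by (auto simp: orthonormal_basis_def)
    then obtain w where w: "w \<in> span B" "dist w z < r" using r by (meson closure_approachable)
    have "\<exists>B0 c. w = (\<Sum>e\<in>B0. c e *\<^sub>R e) \<and> finite B0 \<and> B0 \<subseteq> B"
      using w(1) unfolding span_explicit by simp
    then obtain B0 c where B0: "finite B0" "B0 \<subseteq> B" "w = (\<Sum>e\<in>B0. c e *\<^sub>R e)"
      by metis
    have "norm ((\<Sum>e\<in>F N. (z \<bullet> e) *\<^sub>R e) - z) < r" if N: "N \<ge> Max (to_nat_on B ` B0)" for N
    proof -
      let ?P = "\<Sum>e\<in>F N. (z \<bullet> e) *\<^sub>R e"
      have "B0 \<subseteq> F N"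
      proof
        fix e assume e: "e \<in> B0"
        then have "to_nat_on B e \<le> Max (to_nat_on B ` B0)" using B0(1) by (intro Max_ge) auto
        then show "e \<in> F N" using e B0(2) N by (auto simp: F_def)
      qed
      then have wF: "w \<in> span (F N)"
        unfolding B0(3) by (intro span_sum span_scale span_base) auto
      have PF: "?P \<in> span (F N)" by (intro span_sum span_scale span_base)
      have "orthogonal (z - ?P) (?P - w)"
      proof (rule orthogonal_to_span[OF span_diff[OF PF wF]])
        fix e assume e: "e \<in> F N"
        have "?P \<bullet> e = (\<Sum>u\<in>F N. (z \<bullet> u) * (u \<bullet> e))" by (simp add: inner_sum_left)
        also have "\<dots> = (\<Sum>u\<in>F N. if u = e then z \<bullet> e else 0)"
          using on sub[of N] e by (intro sum.cong refl) (auto simp: subset_iff)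
        also have "\<dots> = z \<bullet> e" using e fin[of N] by simp
        finally show "orthogonal (z - ?P) e" by (simp add: orthogonal_def inner_diff_left)
      qed
      then have "(norm ((z - ?P) + (?P - w)))\<^sup>2 = (norm (z - ?P))\<^sup>2 + (norm (?P - w))\<^sup>2"
        by (rule norm_add_Pythagorean)
      then have "(norm (z - ?P))\<^sup>2 \<le> (norm (z - w))\<^sup>2" by simp
      then have "norm (z - ?P) \<le> norm (z - w)" by (rule power2_le_imp_le) simp
      also have "\<dots> < r" using w(2) by (simp add: dist_norm norm_minus_commute)
      finally show ?thesis by (simp add: norm_minus_commute)
    qed
    then show "\<exists>M. \<forall>N\<ge>M. norm ((\<Sum>e\<in>F N. (z \<bullet> e) *\<^sub>R e) - z) < r" by blast
  qed
  with fin sub show ?thesis using that by blast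
qed

lemma hs_norm_sum_le:
  assumes N: "hs_norm B k T \<le> ereal N" and F: "finite F" "F \<subseteq> B"
  shows "(\<Sum>J\<in>PiE {..<k} (\<lambda>_. F). (T (map J [0..<k]))\<^sup>2) \<le> N\<^sup>2"
proof -
  let ?E = "PiE {..<k} (\<lambda>_. F)" and ?g = "\<lambda>J. map J [0..<k]"
  have fE: "finite ?E" using F by (intro finite_PiE) auto
  have inj: "inj_on ?g ?E"
  proof (rule inj_onI)
    fix J J' assume J: "J \<in> ?E" "J' \<in> ?E" "?g J = ?g J'"
    then have "J i = J' i" if "i < k" for i using that by (auto simp: map_eq_conv)
    then show "J = J'" using J by (intro PiE_ext[OF J(1,2)]) auto
  qed
  have "ereal (L2_set T (?g ` ?E)) \<le> hs_norm B k T"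
    unfolding hs_norm_def using F fE by (intro SUP_upper) (auto simp: PiE_iff subset_iff)
  then have "L2_set T (?g ` ?E) \<le> N" using N by (metis ereal_less_eq(3) order_trans)
  then have "(L2_set T (?g ` ?E))\<^sup>2 \<le> N\<^sup>2" by (intro power_mono) auto
  moreover have "(L2_set T (?g ` ?E))\<^sup>2 = (\<Sum>es\<in>?g ` ?E. (T es)\<^sup>2)"
    by (simp add: L2_set_def sum_nonneg)
  ultimately show ?thesis using inj by (simp add: sum.reindex comp_def)
qed

text \<open>The double sum is the squared norm of the weighted sum of the elementary tensors of the
  lists \<open>h a\<close>, so this is Cauchy-Schwarz in a tensor product that is never constructed.
  The arguments are projected to finitely many coordinates, where both norms are finite sums, and
  the projections are removed in the limit. The constant \<open>c\<close> gives the continuity for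
  that limit and does not enter the bound.\<close>

lemma hs_norm_Cauchy_Schwarz:
  fixes H :: "'a::{real_inner,second_countable_topology} set"
  assumes H: "subspace H" and B: "orthonormal_basis H B"
    and T: "multilinear_form H k T" "form_le H k T c" and N: "hs_norm B k T \<le> ereal N"
    and h: "\<And>a. a \<in> A \<Longrightarrow> length (h a) = k \<and> set (h a) \<subseteq> H"
  shows "(\<Sum>a\<in>A. w a * T (h a))\<^sup>2 \<le>
    N\<^sup>2 * (\<Sum>a\<in>A. \<Sum>b\<in>A. w a * w b * (\<Prod>i<k. (h a ! i) \<bullet> (h b ! i)))"
proof -
  obtain F where F: "\<And>M. finite (F M)" "\<And>M. F M \<subseteq> B"
    and lim: "\<And>z. z \<in> H \<Longrightarrow> (\<lambda>M. \<Sum>e\<in>F M. (z \<bullet> e) *\<^sub>R e) \<longlonglongrightarrow> z"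
    using orthonormal_basis_projections[OF B] by metis
  have BH: "B \<subseteq> H" using B by (simp add: orthonormal_basis_def)
  have hH: "h a ! i \<in> H" if "a \<in> A" "i < k" for a i
    using h[OF that(1)] that(2) by (auto intro: nth_mem)
  define P where "P M z = (\<Sum>e\<in>F M. (z \<bullet> e) *\<^sub>R e)" for M z
  have PH: "P M z \<in> H" for M z
    unfolding P_def using F(2)[of M] BH by (intro subspace_sum[OF H] subspace_scale[OF H]) auto
  have fin: "(\<Sum>a\<in>A. w a * T (map (\<lambda>i. P M (h a ! i)) [0..<k]))\<^sup>2 \<le>
    N\<^sup>2 * (\<Sum>a\<in>A. \<Sum>b\<in>A. w a * w b * (\<Prod>i<k. P M (h a ! i) \<bullet> (h b ! i)))" for M
  proof -
    let ?E = "PiE {..<k} (\<lambda>_. F M)"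
    let ?X = "\<lambda>J. \<Sum>a\<in>A. w a * (\<Prod>i<k. h a ! i \<bullet> J i)"
    have "T (map (\<lambda>i. P M (h a ! i)) [0..<k]) = (\<Sum>J\<in>?E. (\<Prod>i<k. h a ! i \<bullet> J i) * T (map J [0..<k]))" for a
    proof -
      have "T ([] @ map (\<lambda>i. \<Sum>e\<in>F M. (h a ! i \<bullet> e) *\<^sub>R e) [0..<k]) =
         (\<Sum>J\<in>PiE (set [0..<k]) (\<lambda>_. F M). T ([] @ map (\<lambda>i. (h a ! i \<bullet> J i) *\<^sub>R J i) [0..<k]))"
        using F(2)[of M] BH subspace_scale[OF H] by (intro multilinear_expand[OF H T(1) F(1)]) auto
      also have "\<dots> = (\<Sum>J\<in>PiE (set [0..<k]) (\<lambda>_. F M). (\<Prod>i\<in>set [0..<k]. h a ! i \<bullet> J i) * T ([] @ map J [0..<k]))"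
        using F(2)[of M] BH by (intro sum.cong refl multilinear_scale[OF H T(1)]) (auto simp: PiE_iff subset_iff)
      finally show ?thesis by (simp add: P_def atLeast0LessThan)
    qed
    then have "(\<Sum>a\<in>A. w a * T (map (\<lambda>i. P M (h a ! i)) [0..<k])) =
       (\<Sum>a\<in>A. \<Sum>J\<in>?E. w a * ((\<Prod>i<k. h a ! i \<bullet> J i) * T (map J [0..<k])))"
      by (simp add: sum_distrib_left)
    also have "\<dots> = (\<Sum>J\<in>?E. T (map J [0..<k]) * ?X J)"
      by (subst sum.swap) (simp add: sum_distrib_left sum_distrib_right mult_ac)
    finally have "(\<Sum>a\<in>A. w a * T (map (\<lambda>i. P M (h a ! i)) [0..<k]))\<^sup>2 =
       (\<Sum>J\<in>?E. T (map J [0..<k]) * ?X J)\<^sup>2" by simp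
    also have "\<dots> \<le> (\<Sum>J\<in>?E. (T (map J [0..<k]))\<^sup>2) * (\<Sum>J\<in>?E. (?X J)\<^sup>2)"
      by (rule Cauchy_Schwarz_ineq_sum)
    also have "\<dots> \<le> N\<^sup>2 * (\<Sum>J\<in>?E. (?X J)\<^sup>2)"
      by (intro mult_right_mono hs_norm_sum_le[OF N F] sum_nonneg) auto
    also have "(\<Sum>J\<in>?E. (?X J)\<^sup>2) = (\<Sum>J\<in>?E. \<Sum>a\<in>A. \<Sum>b\<in>A. w a * w b * (\<Prod>i<k. (h a ! i \<bullet> J i) * (h b ! i \<bullet> J i)))"
      unfolding power2_eq_square sum_product by (simp add: prod.distrib mult_ac)
    also have "\<dots> = (\<Sum>a\<in>A. \<Sum>b\<in>A. \<Sum>J\<in>?E. w a * w b * (\<Prod>i<k. (h a ! i \<bullet> J i) * (h b ! i \<bullet> J i)))"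
      by (subst sum.swap, rule sum.cong[OF refl], rule sum.swap)
    also have "\<dots> = (\<Sum>a\<in>A. \<Sum>b\<in>A. w a * w b * (\<Prod>i<k. P M (h a ! i) \<bullet> (h b ! i)))"
    proof -
      \<comment> \<open>Distributivity turns the sum over coordinate tuples into a product over
        slots; within a slot, the coordinate sum over \<open>F M\<close> is an inner product with
        the projection on one side.\<close>
      have "(\<Sum>J\<in>?E. \<Prod>i<k. (h a ! i \<bullet> J i) * (h b ! i \<bullet> J i)) = (\<Prod>i<k. P M (h a ! i) \<bullet> (h b ! i))" for a b
      proof -
        have "P M u \<bullet> v = (\<Sum>e\<in>F M. (u \<bullet> e) * (v \<bullet> e))" for u v
          by (simp add: P_def inner_sum_left inner_commute[of v])
        then show ?thesis
          using F(1) by (simp only:) (intro prod_sum_PiE[symmetric], auto)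
      qed
      then show ?thesis by (simp add: sum_distrib_left[symmetric])
    qed
    finally show ?thesis .
  qed
  have hl: "map (\<lambda>i. h a ! i) [0..<k] = h a" if "a \<in> A" for a
    using h[OF that] by (auto simp: map_nth)
  have T_lim: "(\<lambda>M. T (map (\<lambda>i. P M (h a ! i)) [0..<k])) \<longlonglongrightarrow> T (h a)" if a: "a \<in> A" for a
  proof -
    have "(\<lambda>M. T (map (\<lambda>i. P M (h a ! i)) [0..<k])) \<longlonglongrightarrow> T (map (\<lambda>i. h a ! i) [0..<k])"
      using PH hH[OF a] lim by (intro tendsto_multilinear[OF H T]) (auto simp: P_def)
    then show ?thesis using hl[OF a] by simp
  qed
  have L: "(\<lambda>M. (\<Sum>a\<in>A. w a * T (map (\<lambda>i. P M (h a ! i)) [0..<k]))\<^sup>2) \<longlonglongrightarrow> (\<Sum>a\<in>A. w a * T (h a))\<^sup>2"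
    by (intro tendsto_intros T_lim)
  have R: "(\<lambda>M. N\<^sup>2 * (\<Sum>a\<in>A. \<Sum>b\<in>A. w a * w b * (\<Prod>i<k. P M (h a ! i) \<bullet> (h b ! i)))) \<longlonglongrightarrow>
     N\<^sup>2 * (\<Sum>a\<in>A. \<Sum>b\<in>A. w a * w b * (\<Prod>i<k. (h a ! i) \<bullet> (h b ! i)))"
  proof (intro tendsto_intros)
    fix a b i assume "a \<in> A" "i \<in> {..<k}"
    then show "(\<lambda>M. P M (h a ! i)) \<longlonglongrightarrow> h a ! i" unfolding P_def by (intro lim hH) auto
  qed
  show ?thesis using fin by (intro LIMSEQ_le[OF L R]) auto
qed

section \<open>Moments of independent noise\<close>

text \<open>With every argument projected to finitely many coordinates the value is a polynomial in
  measurable coordinates; boundedness of the form lets the projections converge.\<close>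

lemma measurable_form:
  fixes H :: "'a::{real_inner,banach,second_countable_topology} set"
  assumes H: "subspace H" and B: "orthonormal_basis H B"
    and T: "multilinear_form H k T" "form_le H k T c" and xs: "distinct xs" "length xs = k"
    and Z: "\<And>i. i \<in> set xs \<Longrightarrow> Z i \<in> borel_measurable N"
      "\<And>i \<omega>. i \<in> set xs \<Longrightarrow> \<omega> \<in> space N \<Longrightarrow> Z i \<omega> \<in> H"
  shows "(\<lambda>\<omega>. T (map (\<lambda>i. Z i \<omega>) xs)) \<in> borel_measurable N"
proof -
  obtain F where F: "\<And>M. finite (F M)" "\<And>M. F M \<subseteq> B"
    and lim: "\<And>z. z \<in> H \<Longrightarrow> (\<lambda>M. \<Sum>e\<in>F M. (z \<bullet> e) *\<^sub>R e) \<longlonglongrightarrow> z"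
    using orthonormal_basis_projections[OF B] by metis
  have BH: "B \<subseteq> H" using B by (simp add: orthonormal_basis_def)
  have FH: "e \<in> H" if "e \<in> F M" for e M using F(2) BH that by blast
  let ?P = "\<lambda>M z. \<Sum>e\<in>F M. (z \<bullet> e) *\<^sub>R e"
  have PH: "?P M z \<in> H" for M z
    using FH by (intro subspace_sum[OF H] subspace_scale[OF H]) auto
  have eq: "T (map (\<lambda>i. ?P M (Z i \<omega>)) xs) =
     (\<Sum>J\<in>PiE (set xs) (\<lambda>_. F M). (\<Prod>i\<in>set xs. Z i \<omega> \<bullet> J i) * T (map J xs))" for M \<omega>
  proof -
    have "T ([] @ map (\<lambda>i. ?P M (Z i \<omega>)) xs) =
       (\<Sum>J\<in>PiE (set xs) (\<lambda>_. F M). T ([] @ map (\<lambda>i. (Z i \<omega> \<bullet> J i) *\<^sub>R J i) xs))"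
      using FH subspace_scale[OF H] xs by (intro multilinear_expand[OF H T(1) F(1)]) auto
    also have "\<dots> = (\<Sum>J\<in>PiE (set xs) (\<lambda>_. F M). (\<Prod>i\<in>set xs. Z i \<omega> \<bullet> J i) * T ([] @ map J xs))"
      using FH xs by (intro sum.cong refl multilinear_scale[OF H T(1)]) (auto simp: PiE_iff)
    finally show ?thesis by simp
  qed
  show ?thesis
  proof (rule borel_measurable_LIMSEQ_real)
    show "(\<lambda>\<omega>. T (map (\<lambda>i. ?P M (Z i \<omega>)) xs)) \<in> borel_measurable N" for M
      unfolding eq
      using Z(1) by (intro borel_measurable_sum borel_measurable_times borel_measurable_const
          borel_measurable_prod borel_measurable_inner)
    show "(\<lambda>M. T (map (\<lambda>i. ?P M (Z i \<omega>)) xs)) \<longlonglongrightarrow> T (map (\<lambda>i. Z i \<omega>) xs)"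
      if "\<omega> \<in> space N" for \<omega>
      using Z(2)[OF _ that] lim PH
      by (intro tendsto_multilinear[OF H T xs]) auto
  qed
qed

lemma perm_avg_swap:
  "perm_avg n (\<lambda>p. perm_avg n (\<lambda>p'. K p p')) = perm_avg n (\<lambda>p'. perm_avg n (\<lambda>p. K p p'))"
  unfolding perm_avg_def sum_divide_distrib[symmetric] by (subst sum.swap) simp

text \<open>For fixed \<open>p\<close>, the proportion of \<open>p'\<close> with the same set of
  indices on \<open>I\<close> is \<open>fact (card I) / ffact n (card I)\<close>, and this is the
  entire gain from orthogonality. The majorant is symmetric in the two permutations, so both halves
  contribute the same.\<close>

lemma perm_avg_kernel_le:
  assumes I: "I \<subseteq> {1..n}"
    and K: "\<And>p p'. p permutes {1..n} \<Longrightarrow> p' permutes {1..n} \<Longrightarrow>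
      K p p' \<le> (if p' ` I = p ` I then (a p + a p') / 2 else 0)"
  shows "perm_avg n (\<lambda>p. perm_avg n (\<lambda>p'. K p p')) \<le>
    fact (card I) / ffact n (card I) * perm_avg n a"
proof -
  have fI: "finite I" using I finite_subset by auto
  have eq: "p' ` I = p ` I \<longleftrightarrow> p' ` I \<subseteq> p ` I" if "p permutes {1..n}" "p' permutes {1..n}" for p p'
  proof
    assume "p' ` I \<subseteq> p ` I"
    then show "p' ` I = p ` I"
      using fI permutes_inj_on[OF that(1), of I] permutes_inj_on[OF that(2), of I]
      by (intro card_subset_eq) (auto simp: card_image)
  qed simp
  let ?b = "\<lambda>p p'. of_bool (p' ` I \<subseteq> p ` I) :: real"
  have cnt: "perm_avg n (\<lambda>p'. ?b p p') = fact (card I) / ffact n (card I)" if p: "p permutes {1..n}" for p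
  proof -
    have "p ` I \<subseteq> {1..n}" using I permutes_image[OF p] by blast
    then show ?thesis
      using perm_avg_image_subset[OF I, of "p ` I"] permutes_inj_on[OF p, of I]
      by (simp add: card_image ffact_self)
  qed
  let ?A = "perm_avg n (\<lambda>p. perm_avg n (\<lambda>p'. ?b p p' * (a p / 2)))"
  let ?A' = "perm_avg n (\<lambda>p. perm_avg n (\<lambda>p'. ?b p p' * (a p' / 2)))"
  have A: "?A = fact (card I) / ffact n (card I) * (perm_avg n a / 2)"
  proof -
    have "?A = perm_avg n (\<lambda>p. (fact (card I) / ffact n (card I)) * (a p / 2))"
    proof (rule perm_avg_cong)
      fix p assume p: "p permutes {1..n}"
      have "perm_avg n (\<lambda>p'. ?b p p' * (a p / 2)) = (a p / 2) * perm_avg n (\<lambda>p'. ?b p p')"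
        using perm_avg_cmult[of n "a p / 2" "?b p"] by (simp only: mult.commute)
      then show "perm_avg n (\<lambda>p'. ?b p p' * (a p / 2)) = (fact (card I) / ffact n (card I)) * (a p / 2)"
        using cnt[OF p] by (simp add: mult.commute)
    qed
    also have "\<dots> = fact (card I) / ffact n (card I) * (perm_avg n a / 2)"
      unfolding perm_avg_cmult perm_avg_divide ..
    finally show ?thesis .
  qed
  have "?A' = perm_avg n (\<lambda>p. perm_avg n (\<lambda>p'. ?b p' p * (a p / 2)))"
    by (rule perm_avg_swap)
  also have "\<dots> = ?A"
  proof (intro perm_avg_cong)
    fix p p' assume "p permutes {1..n}" "p' permutes {1..n}"
    then have "(p ` I \<subseteq> p' ` I) = (p' ` I \<subseteq> p ` I)" using eq[of p p'] eq[of p' p] by auto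
    then show "?b p' p * (a p / 2) = ?b p p' * (a p / 2)" by simp
  qed
  finally have A': "?A' = ?A" .
  have "perm_avg n (\<lambda>p. perm_avg n (\<lambda>p'. K p p')) \<le>
    perm_avg n (\<lambda>p. perm_avg n (\<lambda>p'. ?b p p' * (a p / 2) + ?b p p' * (a p' / 2)))"
  proof (intro perm_avg_mono)
    fix p p' assume pp: "p permutes {1..n}" "p' permutes {1..n}"
    show "K p p' \<le> ?b p p' * (a p / 2) + ?b p p' * (a p' / 2)"
      using K[OF pp] eq[OF pp] by (cases "p' ` I = p ` I") (simp_all add: add_divide_distrib)
  qed
  also have "\<dots> = ?A + ?A'" by (simp add: perm_avg_add)
  finally show ?thesis unfolding A' A by simp
qed

locale hilbert_noise = prob_space M for M :: "'w measure" +
  fixes H B :: "'a::{real_inner,banach,second_countable_topology} set"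
    and n :: nat and \<epsilon> :: "nat \<Rightarrow> 'w \<Rightarrow> 'a"
  assumes H: "subspace H" "closed H" and B: "orthonormal_basis H B"
    and n: "0 < n"
    and indep: "indep_vars (\<lambda>_. borel) \<epsilon> {1..n}"
    and \<epsilon>_H: "\<And>j \<omega>. j \<in> {1..n} \<Longrightarrow> \<omega> \<in> space M \<Longrightarrow> \<epsilon> j \<omega> \<in> H"
    and integrable_\<epsilon>: "\<And>j. j \<in> {1..n} \<Longrightarrow> integrable M (\<epsilon> j)"
    and mean_\<epsilon>: "\<And>j. j \<in> {1..n} \<Longrightarrow> expectation (\<epsilon> j) = 0"
    and integrable_\<epsilon>2: "\<And>j. j \<in> {1..n} \<Longrightarrow> integrable M (\<lambda>\<omega>. (norm (\<epsilon> j \<omega>))\<^sup>2)"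
begin

section \<open>Joint law of the noise and integration of a single coordinate\<close>

lemma measurable_\<epsilon>: "j \<in> {1..n} \<Longrightarrow> \<epsilon> j \<in> borel_measurable M"
  using indep by (auto simp: indep_vars_def2)

definition e2 :: "nat \<Rightarrow> real" where "e2 j = expectation (\<lambda>\<omega>. (norm (\<epsilon> j \<omega>))\<^sup>2)"

lemma e2_nonneg: "0 \<le> e2 j"
  unfolding e2_def by (intro integral_nonneg_AE) auto

text \<open>Restricted to \<open>{1..n}\<close> so that it is a point of the product space, whose
  elements take the value \<open>undefined\<close> outside the index set.\<close>

definition sample :: "'w \<Rightarrow> nat \<Rightarrow> 'a" where "sample \<omega> = (\<lambda>i\<in>{1..n}. \<epsilon> i \<omega>)"

text \<open>The product construction asks for a measure at every natural index; outside
  \<open>{1..n}\<close> a point mass at 0 is supplied.\<close>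

definition law :: "nat \<Rightarrow> 'a measure" where
  "law i = distr M borel (if i \<in> {1..n} then \<epsilon> i else (\<lambda>_. 0))"

lemma prob_space_law: "prob_space (law i)"
  unfolding law_def using measurable_\<epsilon> by (intro prob_space_distr) auto

lemma sets_law [simp, measurable_cong]: "sets (law i) = sets borel"
  by (simp add: law_def)

lemma measurable_sample [measurable]: "sample \<in> measurable M (PiM {1..n} (\<lambda>_. borel))"
  unfolding sample_def using measurable_\<epsilon> by (intro measurable_restrict) auto

lemma sets_PiM_law: "sets (PiM I law) = sets (PiM I (\<lambda>_. borel))"
  by (intro sets_PiM_cong) auto

lemma distr_sample: "distr M (PiM {1..n} (\<lambda>_. borel)) sample = PiM {1..n} law"
proof -
  have "distr M (PiM {1..n} (\<lambda>_. borel)) sample = (\<Pi>\<^sub>M i\<in>{1..n}. distr M borel (\<epsilon> i))"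
    using indep_vars_iff_distr_eq_PiM'[where I = "{1..n}" and X = \<epsilon> and M' = "\<lambda>_. borel"] indep n measurable_\<epsilon>
    unfolding sample_def[abs_def] by auto
  also have "\<dots> = PiM {1..n} law" by (intro PiM_cong) (auto simp: law_def)
  finally show ?thesis .
qed

lemma sample_upd_measurable:
  assumes "j \<in> {1..n}"
  shows "(\<lambda>(x, \<omega>). x(j := \<epsilon> j \<omega>)) \<in> measurable (PiM ({1..n} - {j}) (\<lambda>_. borel) \<Otimes>\<^sub>M M) (PiM {1..n} (\<lambda>_. borel))"
proof -
  have [measurable]: "\<epsilon> j \<in> borel_measurable M" using assms by (rule measurable_\<epsilon>)
  have "(\<lambda>(x, y). x(j := y)) \<in> measurable (PiM ({1..n} - {j}) (\<lambda>_. borel) \<Otimes>\<^sub>M borel) (PiM (insert j ({1..n} - {j})) (\<lambda>_. borel::'a measure))"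
    by (rule measurable_add_dim)
  moreover have "insert j ({1..n} - {j}) = {1..n}" using assms by auto
  moreover have "(\<lambda>(x, \<omega>). (x, \<epsilon> j \<omega>)) \<in> measurable (PiM ({1..n} - {j}) (\<lambda>_. borel) \<Otimes>\<^sub>M M) (PiM ({1..n} - {j}) (\<lambda>_. borel) \<Otimes>\<^sub>M borel)"
    by measurable
  ultimately show ?thesis
    using measurable_comp[of "\<lambda>(x, \<omega>). (x, \<epsilon> j \<omega>)" _ _ "\<lambda>(x, y). x(j := y)"]
    by (simp add: comp_def case_prod_beta')
qed

text \<open>Fubini's theorem with coordinate \<open>j\<close> integrated first and all others frozen
  at \<open>x\<close>. In this form the mean-zero property acts on expressions in many noise
  vectors.\<close>

lemma expectation_eq_0_if_slot:
  assumes \<Psi>: "\<Psi> \<in> borel_measurable (PiM {1..n} (\<lambda>_. borel))"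
    and int: "integrable M (\<lambda>\<omega>. \<Psi> (sample \<omega>))" and j: "j \<in> {1..n}"
    and 0: "\<And>x. (\<integral>\<omega>. \<Psi> (x(j := \<epsilon> j \<omega>)) \<partial>M) = (0::real)"
  shows "expectation (\<lambda>\<omega>. \<Psi> (sample \<omega>)) = 0"
proof -
  interpret P: product_sigma_finite law
    unfolding product_sigma_finite_def using prob_space_law prob_space_imp_sigma_finite by blast
  have ins: "insert j ({1..n} - {j}) = {1..n}" using j by auto
  have "expectation (\<lambda>\<omega>. \<Psi> (sample \<omega>)) = integral\<^sup>L (PiM {1..n} law) \<Psi>"
    unfolding distr_sample[symmetric] by (rule integral_distr[symmetric, OF measurable_sample \<Psi>])
  also have "\<dots> = (\<integral>x. (\<integral>y. \<Psi> (x(j := y)) \<partial>law j) \<partial>PiM ({1..n} - {j}) law)"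
  proof -
    have "integrable (PiM (insert j ({1..n} - {j})) law) \<Psi>"
      unfolding ins distr_sample[symmetric] using int by (subst integrable_distr_eq[OF measurable_sample \<Psi>])
    from P.product_integral_insert[OF _ _ this] show ?thesis unfolding ins by simp
  qed
  also have "\<dots> = (\<integral>x. 0 \<partial>PiM ({1..n} - {j}) law)"
  proof (intro Bochner_Integration.integral_cong refl)
    fix x assume x: "x \<in> space (PiM ({1..n} - {j}) law)"
    have "(\<lambda>y. \<Psi> (x(j := y))) \<in> borel_measurable borel"
    proof (rule measurable_compose[OF _ \<Psi>])
      have "(\<lambda>y. x(j := y)) \<in> measurable borel (PiM (insert j ({1..n} - {j})) (\<lambda>_. borel))"
        using x by (intro measurable_component_update[of x "{1..n} - {j}" "\<lambda>_. borel"])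
           (auto simp: space_PiM law_def)
      then show "(\<lambda>y. x(j := y)) \<in> measurable borel (PiM {1..n} (\<lambda>_. borel))" unfolding ins .
    qed
    then have "(\<integral>y. \<Psi> (x(j := y)) \<partial>law j) = (\<integral>\<omega>. \<Psi> (x(j := \<epsilon> j \<omega>)) \<partial>M)"
      unfolding law_def using j measurable_\<epsilon>[OF j] by (simp add: integral_distr)
    then show "(\<integral>y. \<Psi> (x(j := y)) \<partial>law j) = 0" using 0 by simp
  qed
  finally show ?thesis by simp
qed

text \<open>Replaces \<open>\<epsilon> j\<close> by an independent copy without enlarging the
  probability space: \<open>\<omega>'\<close> is a second variable of integration over the same
  measure. Nonnegative integrals avoid integrability questions for the inner one.\<close>

lemma nn_integral_decouple:
  assumes \<Psi>: "\<Psi> \<in> borel_measurable (PiM {1..n} (\<lambda>_. borel))" and j: "j \<in> {1..n}"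
  shows "(\<integral>\<^sup>+\<omega>. \<Psi> (sample \<omega>) \<partial>M) = (\<integral>\<^sup>+\<omega>. (\<integral>\<^sup>+\<omega>'. \<Psi> ((sample \<omega>)(j := \<epsilon> j \<omega>')) \<partial>M) \<partial>M)"
proof -
  interpret P: product_sigma_finite law
    unfolding product_sigma_finite_def using prob_space_law prob_space_imp_sigma_finite by blast
  have ins: "insert j ({1..n} - {j}) = {1..n}" using j by auto
  have [measurable]: "\<epsilon> j \<in> borel_measurable M" using j by (rule measurable_\<epsilon>)
  have main: "(\<integral>\<^sup>+\<omega>. G (sample \<omega>) \<partial>M) =
     (\<integral>\<^sup>+x. (\<integral>\<^sup>+\<omega>'. G (x(j := \<epsilon> j \<omega>')) \<partial>M) \<partial>PiM ({1..n} - {j}) law)"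
    if G: "G \<in> borel_measurable (PiM {1..n} (\<lambda>_. borel))" for G
  proof -
    have "(\<integral>\<^sup>+\<omega>. G (sample \<omega>) \<partial>M) = integral\<^sup>N (PiM {1..n} law) G"
      unfolding distr_sample[symmetric] by (subst nn_integral_distr[OF measurable_sample]) (use G in simp_all)
    also have "\<dots> = (\<integral>\<^sup>+x. (\<integral>\<^sup>+y. G (x(j := y)) \<partial>law j) \<partial>PiM ({1..n} - {j}) law)"
    proof -
      have "G \<in> borel_measurable (PiM (insert j ({1..n} - {j})) law)"
        unfolding ins using G sets_PiM_law[of "{1..n}"] by (simp cong: measurable_cong_sets)
      from P.product_nn_integral_insert[OF _ _ this] show ?thesis unfolding ins by simp
    qed
    also have "\<dots> = (\<integral>\<^sup>+x. (\<integral>\<^sup>+\<omega>'. G (x(j := \<epsilon> j \<omega>')) \<partial>M) \<partial>PiM ({1..n} - {j}) law)"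
    proof (intro nn_integral_cong)
      fix x assume x: "x \<in> space (PiM ({1..n} - {j}) law)"
      have "(\<lambda>y. G (x(j := y))) \<in> borel_measurable borel"
      proof (rule measurable_compose[OF _ G])
        have "(\<lambda>y. x(j := y)) \<in> measurable borel (PiM (insert j ({1..n} - {j})) (\<lambda>_. borel))"
          using x by (intro measurable_component_update[of x "{1..n} - {j}" "\<lambda>_. borel"])
             (auto simp: space_PiM law_def)
        then show "(\<lambda>y. x(j := y)) \<in> measurable borel (PiM {1..n} (\<lambda>_. borel))" unfolding ins .
      qed
      then show "(\<integral>\<^sup>+y. G (x(j := y)) \<partial>law j) = (\<integral>\<^sup>+\<omega>'. G (x(j := \<epsilon> j \<omega>')) \<partial>M)"
        unfolding law_def using j measurable_\<epsilon>[OF j] by (simp add: nn_integral_distr)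
    qed
    finally show ?thesis .
  qed
  let ?G = "\<lambda>x. \<integral>\<^sup>+\<omega>'. \<Psi> (x(j := \<epsilon> j \<omega>')) \<partial>M"
  have mG: "?G \<in> borel_measurable (PiM {1..n} (\<lambda>_. borel))"
  proof -
    \<comment> \<open>Measurability is known for updates of a vector of the other coordinates;
      \<open>?G\<close> ignores coordinate \<open>j\<close>, so it factors through the
      restriction.\<close>
    have r: "(\<lambda>x. restrict x ({1..n} - {j})) \<in> measurable (PiM {1..n} (\<lambda>_. borel)) (PiM ({1..n} - {j}) (\<lambda>_. borel::'a measure))"
      by (intro measurable_restrict_subset) auto
    have "(\<lambda>(x, \<omega>). \<Psi> ((restrict x ({1..n} - {j}))(j := \<epsilon> j \<omega>))) \<in> borel_measurable (PiM {1..n} (\<lambda>_. borel) \<Otimes>\<^sub>M M)"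
    proof -
      have "(\<lambda>(x, \<omega>). (restrict x ({1..n} - {j}), \<omega>)) \<in> measurable (PiM {1..n} (\<lambda>_. borel) \<Otimes>\<^sub>M M) (PiM ({1..n} - {j}) (\<lambda>_. borel) \<Otimes>\<^sub>M M)"
        using r by measurable
      from measurable_compose[OF this measurable_compose[OF sample_upd_measurable[OF j] \<Psi>]]
      show ?thesis by (simp add: case_prod_beta')
    qed
    then have "(\<lambda>x. \<integral>\<^sup>+\<omega>. \<Psi> ((restrict x ({1..n} - {j}))(j := \<epsilon> j \<omega>)) \<partial>M) \<in> borel_measurable (PiM {1..n} (\<lambda>_. borel))"
      by (intro borel_measurable_nn_integral) simp
    moreover have "(restrict x ({1..n} - {j}))(j := y) = x(j := y)" if "x \<in> space (PiM {1..n} (\<lambda>_. borel :: 'a measure))" for x y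
      using that by (auto simp: space_PiM PiE_def extensional_def fun_eq_iff)
    ultimately show ?thesis by (subst measurable_cong) auto
  qed
  have "(\<integral>\<^sup>+\<omega>. ?G (sample \<omega>) \<partial>M) = (\<integral>\<^sup>+x. (\<integral>\<^sup>+\<omega>'. ?G (x(j := \<epsilon> j \<omega>')) \<partial>M) \<partial>PiM ({1..n} - {j}) law)"
    by (rule main[OF mG])
  \<comment> \<open>\<open>?G\<close> overwrites coordinate \<open>j\<close>, so an earlier update
    of it is lost and integrating that update gives the factor 1.\<close>
  also have "\<dots> = (\<integral>\<^sup>+x. ?G x \<partial>PiM ({1..n} - {j}) law)"
    by (simp add: emeasure_space_1)
  also have "\<dots> = (\<integral>\<^sup>+\<omega>. \<Psi> (sample \<omega>) \<partial>M)" by (rule main[OF \<Psi>, symmetric])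
  finally show ?thesis by simp
qed

lemma
  assumes "I \<subseteq> {1..n}"
  shows integrable_prod_norm2: "integrable M (\<lambda>\<omega>. \<Prod>i\<in>I. (norm (\<epsilon> i \<omega>))\<^sup>2)"
    and expectation_prod_norm2: "expectation (\<lambda>\<omega>. \<Prod>i\<in>I. (norm (\<epsilon> i \<omega>))\<^sup>2) = (\<Prod>i\<in>I. e2 i)"
proof -
  have fin: "finite I" using assms finite_subset by auto
  have ind: "indep_vars (\<lambda>_. borel) (\<lambda>i \<omega>. (norm (\<epsilon> i \<omega>))\<^sup>2) I"
    by (rule indep_vars_compose2[OF indep_vars_subset[OF indep assms]]) auto
  have int: "integrable M (\<lambda>\<omega>. (norm (\<epsilon> i \<omega>))\<^sup>2)" if "i \<in> I" for i
    using integrable_\<epsilon>2 assms that by auto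
  show "integrable M (\<lambda>\<omega>. \<Prod>i\<in>I. (norm (\<epsilon> i \<omega>))\<^sup>2)"
    by (rule indep_vars_integrable[OF fin ind int])
  show "expectation (\<lambda>\<omega>. \<Prod>i\<in>I. (norm (\<epsilon> i \<omega>))\<^sup>2) = (\<Prod>i\<in>I. e2 i)"
    unfolding e2_def by (rule indep_vars_lebesgue_integral[OF fin ind int])
qed

end

section \<open>Second moments of averages over distinct indices\<close>

context hilbert_noise
begin

text \<open>Forms are controlled on \<open>H\<close> only, while the product space runs over the
  whole ambient type. Clipping makes the integrands measurable there and changes nothing on the
  sample.\<close>

definition clip :: "'a \<Rightarrow> 'a" where "clip z = (if z \<in> H then z else 0)"

lemma clip_H [simp]: "clip z \<in> H"
  using subspace_0[OF H(1)] by (simp add: clip_def)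

lemma clip_\<epsilon> [simp]: "j \<in> {1..n} \<Longrightarrow> \<omega> \<in> space M \<Longrightarrow> clip (\<epsilon> j \<omega>) = \<epsilon> j \<omega>"
  using \<epsilon>_H by (simp add: clip_def)

lemma measurable_clip [measurable]: "clip \<in> borel_measurable borel"
proof -
  have [measurable]: "H \<in> sets borel" using H(2) by simp
  show ?thesis unfolding clip_def[abs_def] by measurable
qed

lemma coordinate_measurable:
  "i \<in> {1..n} \<Longrightarrow> (\<lambda>x. x i) \<in> borel_measurable (PiM {1..n} (\<lambda>_. borel :: 'a measure))"
  by (rule measurable_component_singleton)

lemma expectation_double_sum:
  fixes g :: "'b \<Rightarrow> 'b \<Rightarrow> 'w \<Rightarrow> real"
  assumes int: "\<And>a b. a \<in> A \<Longrightarrow> b \<in> A \<Longrightarrow> integrable M (g a b)"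
  shows "expectation (\<lambda>\<omega>. (\<Sum>a\<in>A. \<Sum>b\<in>A. g a b \<omega>) / c) = (\<Sum>a\<in>A. \<Sum>b\<in>A. expectation (g a b)) / c"
proof -
  have "expectation (\<lambda>\<omega>. \<Sum>a\<in>A. \<Sum>b\<in>A. g a b \<omega>) = (\<Sum>a\<in>A. expectation (\<lambda>\<omega>. \<Sum>b\<in>A. g a b \<omega>))"
    by (rule Bochner_Integration.integral_sum) (intro Bochner_Integration.integrable_sum int)
  also have "\<dots> = (\<Sum>a\<in>A. \<Sum>b\<in>A. expectation (g a b))"
    by (intro sum.cong refl Bochner_Integration.integral_sum int)
  finally show ?thesis by simp
qed

text \<open>With the other arguments frozen, a slot is a bounded functional on \<open>H\<close>.
  Written as an inner product it commutes with the Bochner expectation, and its second moment can be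
  compared with the covariance.\<close>

lemma slot_Riesz:
  assumes T: "multilinear_form H k T" "form_le H k T N" and N: "0 \<le> N"
    and len: "length pre + length post + 1 = k" "set pre \<subseteq> H" "set post \<subseteq> H"
  obtains a where "a \<in> H" "norm a \<le> N * (prod_list (map norm pre) * prod_list (map norm post))"
    "\<And>z. z \<in> H \<Longrightarrow> T (pre @ z # post) = a \<bullet> z"
proof -
  let ?C = "N * (prod_list (map norm pre) * prod_list (map norm post))"
  have C: "0 \<le> ?C" using N by (intro mult_nonneg_nonneg) auto
  have bd: "\<bar>T (pre @ u # post)\<bar> \<le> ?C * norm u" if "u \<in> H" for u
    using form_leD[OF T(2), of "pre @ u # post"] len that by (simp add: mult_ac)
  show ?thesis
  proof (rule Riesz_on_subspace[OF H multilinear_slot_add[OF T(1) len] multilinear_slot_scale[OF T(1) len] bd])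
    fix a assume a: "a \<in> H" "norm a \<le> ?C \<or> a = 0" "\<And>z. z \<in> H \<Longrightarrow> T (pre @ z # post) = a \<bullet> z"
    moreover have "norm a \<le> ?C" using a(2) C by auto
    ultimately show ?thesis by (intro that)
  qed
qed

lemma expectation_slot:
  assumes T: "multilinear_form H k T" "form_le H k T N" and N: "0 \<le> N"
    and len: "length pre + length post + 1 = k" "set pre \<subseteq> H" "set post \<subseteq> H" and j: "j \<in> {1..n}"
  shows "expectation (\<lambda>\<omega>. T (pre @ \<epsilon> j \<omega> # post)) = 0"
proof -
  obtain a where a: "\<And>z. z \<in> H \<Longrightarrow> T (pre @ z # post) = a \<bullet> z"
    using slot_Riesz[OF T N len] by metis
  have "expectation (\<lambda>\<omega>. T (pre @ \<epsilon> j \<omega> # post)) = expectation (\<lambda>\<omega>. a \<bullet> \<epsilon> j \<omega>)"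
    using a \<epsilon>_H[OF j] by (intro Bochner_Integration.integral_cong) auto
  also have "\<dots> = 0" using integrable_\<epsilon>[OF j] mean_\<epsilon>[OF j] by simp
  finally show ?thesis .
qed

lemma prod_norm2_permuted:
  assumes I: "I \<subseteq> {1..n}" and p: "p permutes {1..n}"
  shows "integrable M (\<lambda>\<omega>. \<Prod>i\<in>I. (norm (\<epsilon> (p i) \<omega>))\<^sup>2)"
    and "expectation (\<lambda>\<omega>. \<Prod>i\<in>I. (norm (\<epsilon> (p i) \<omega>))\<^sup>2) = (\<Prod>i\<in>I. e2 (p i))"
proof -
  have s: "p ` I \<subseteq> {1..n}" using I permutes_image[OF p] by blast
  have eq: "(\<Prod>i\<in>I. g (p i)) = (\<Prod>j\<in>p ` I. g j)" for g :: "nat \<Rightarrow> real"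
    using permutes_inj_on[OF p] by (simp add: prod.reindex comp_def)
  show "integrable M (\<lambda>\<omega>. \<Prod>i\<in>I. (norm (\<epsilon> (p i) \<omega>))\<^sup>2)"
    using integrable_prod_norm2[OF s] by (simp only: eq[of "\<lambda>j. (norm (\<epsilon> j _))\<^sup>2"])
  show "expectation (\<lambda>\<omega>. \<Prod>i\<in>I. (norm (\<epsilon> (p i) \<omega>))\<^sup>2) = (\<Prod>i\<in>I. e2 (p i))"
    using expectation_prod_norm2[OF s] by (simp only: eq[of "\<lambda>j. (norm (\<epsilon> j _))\<^sup>2"] eq[of e2])
qed

context
  fixes T :: "'a form" and k :: nat and N :: real and xs :: "nat list"
  assumes T: "multilinear_form H k T" "form_le H k T N" and N: "0 \<le> N"
    and xs: "distinct xs" "length xs = k" "set xs \<subseteq> {1..n}"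
begin

lemma form_permuted_measurable:
  assumes p: "p permutes {1..n}"
  shows "(\<lambda>\<omega>. T (map (\<lambda>i. \<epsilon> (p i) \<omega>) xs)) \<in> borel_measurable M"
proof -
  have "p i \<in> {1..n}" if "i \<in> set xs" for i using permutes_in_image[OF p] xs(3) that by blast
  then show ?thesis
    using measurable_\<epsilon> \<epsilon>_H by (intro measurable_form[OF H(1) B T xs(1,2)]) auto
qed

text \<open>Provides the dominating function for the square: a product of squared norms over
  distinct indices is integrable by independence, although no moment beyond the second is
  assumed.\<close>

lemma form_permuted_sq_le:
  assumes p: "p permutes {1..n}" and \<omega>: "\<omega> \<in> space M"
  shows "(T (map (\<lambda>i. \<epsilon> (p i) \<omega>) xs))\<^sup>2 \<le> N\<^sup>2 * (\<Prod>i\<in>set xs. (norm (\<epsilon> (p i) \<omega>))\<^sup>2)"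
proof -
  have pi: "p i \<in> {1..n}" if "i \<in> set xs" for i using permutes_in_image[OF p] xs(3) that by blast
  have "\<bar>T (map (\<lambda>i. \<epsilon> (p i) \<omega>) xs)\<bar> \<le> N * prod_list (map norm (map (\<lambda>i. \<epsilon> (p i) \<omega>) xs))"
    using xs pi \<epsilon>_H \<omega> by (intro form_leD[OF T(2)]) auto
  also have "prod_list (map norm (map (\<lambda>i. \<epsilon> (p i) \<omega>) xs)) = (\<Prod>i\<in>set xs. norm (\<epsilon> (p i) \<omega>))"
    using xs(1) by (simp add: prod.distinct_set_conv_list comp_def)
  finally have "\<bar>T (map (\<lambda>i. \<epsilon> (p i) \<omega>) xs)\<bar>\<^sup>2 \<le> (N * (\<Prod>i\<in>set xs. norm (\<epsilon> (p i) \<omega>)))\<^sup>2"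
    by (intro power_mono) auto
  then show ?thesis by (simp add: power_mult_distrib prod_power_distrib)
qed

lemma form_permuted_sq_integrable:
  assumes p: "p permutes {1..n}"
  shows "integrable M (\<lambda>\<omega>. (T (map (\<lambda>i. \<epsilon> (p i) \<omega>) xs))\<^sup>2)"
proof (rule Bochner_Integration.integrable_bound)
  show "integrable M (\<lambda>\<omega>. N\<^sup>2 * (\<Prod>i\<in>set xs. (norm (\<epsilon> (p i) \<omega>))\<^sup>2))"
    using prod_norm2_permuted(1)[OF xs(3) p] by simp
  show "(\<lambda>\<omega>. (T (map (\<lambda>i. \<epsilon> (p i) \<omega>) xs))\<^sup>2) \<in> borel_measurable M"
    using form_permuted_measurable[OF p] by simp
  show "AE \<omega> in M. norm ((T (map (\<lambda>i. \<epsilon> (p i) \<omega>) xs))\<^sup>2) \<le>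
     norm (N\<^sup>2 * (\<Prod>i\<in>set xs. (norm (\<epsilon> (p i) \<omega>))\<^sup>2))"
  proof (rule AE_I2)
    fix \<omega> assume "\<omega> \<in> space M"
    from form_permuted_sq_le[OF p this]
    show "norm ((T (map (\<lambda>i. \<epsilon> (p i) \<omega>) xs))\<^sup>2) \<le> norm (N\<^sup>2 * (\<Prod>i\<in>set xs. (norm (\<epsilon> (p i) \<omega>))\<^sup>2))"
      by simp
  qed
qed

text \<open>If the index sets differ, some \<open>p i0\<close> occurs in the first factor only, and
  integrating that observation alone gives zero. If they coincide, the product is at most the mean
  of the two squares.\<close>

lemma form_permuted_product:
  assumes p: "p permutes {1..n}" and p': "p' permutes {1..n}"
  shows "integrable M (\<lambda>\<omega>. T (map (\<lambda>i. \<epsilon> (p i) \<omega>) xs) * T (map (\<lambda>i. \<epsilon> (p' i) \<omega>) xs))" (is "integrable M ?f")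
    and "expectation (\<lambda>\<omega>. T (map (\<lambda>i. \<epsilon> (p i) \<omega>) xs) * T (map (\<lambda>i. \<epsilon> (p' i) \<omega>) xs)) \<le>
      (if p' ` set xs = p ` set xs
       then (expectation (\<lambda>\<omega>. (T (map (\<lambda>i. \<epsilon> (p i) \<omega>) xs))\<^sup>2) + expectation (\<lambda>\<omega>. (T (map (\<lambda>i. \<epsilon> (p' i) \<omega>) xs))\<^sup>2)) / 2
       else 0)"
proof -
  let ?F = "\<lambda>p \<omega>. T (map (\<lambda>i. \<epsilon> (p i) \<omega>) xs)"
  note int = form_permuted_sq_integrable[OF p] form_permuted_sq_integrable[OF p']
  have b: "\<bar>?F p \<omega> * ?F p' \<omega>\<bar> \<le> ((?F p \<omega>)\<^sup>2 + (?F p' \<omega>)\<^sup>2) / 2" for \<omega>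
    using sum_squares_bound[of "\<bar>?F p \<omega>\<bar>" "\<bar>?F p' \<omega>\<bar>"] by (simp add: abs_mult)
  have intb: "integrable M (\<lambda>\<omega>. ((?F p \<omega>)\<^sup>2 + (?F p' \<omega>)\<^sup>2) / 2)" using int by auto
  show I: "integrable M ?f"
  proof (rule Bochner_Integration.integrable_bound[OF intb])
    show "?f \<in> borel_measurable M"
      using form_permuted_measurable[OF p] form_permuted_measurable[OF p'] by simp
    have "norm (?f \<omega>) \<le> norm (((?F p \<omega>)\<^sup>2 + (?F p' \<omega>)\<^sup>2) / 2)" for \<omega>
      using b[of \<omega>] by simp
    then show "AE \<omega> in M. norm (?f \<omega>) \<le> norm (((?F p \<omega>)\<^sup>2 + (?F p' \<omega>)\<^sup>2) / 2)" by simp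
  qed
  have pi: "p i \<in> {1..n}" if "i \<in> set xs" for i using permutes_in_image[OF p] xs(3) that by blast
  have pi': "p' i \<in> {1..n}" if "i \<in> set xs" for i using permutes_in_image[OF p'] xs(3) that by blast
  show "expectation ?f \<le> (if p' ` set xs = p ` set xs
       then (expectation (\<lambda>\<omega>. (?F p \<omega>)\<^sup>2) + expectation (\<lambda>\<omega>. (?F p' \<omega>)\<^sup>2)) / 2 else 0)"
  proof (cases "p' ` set xs = p ` set xs")
    case True
    have "expectation ?f \<le> expectation (\<lambda>\<omega>. ((?F p \<omega>)\<^sup>2 + (?F p' \<omega>)\<^sup>2) / 2)"
      using b by (intro integral_mono I intb) (meson abs_ge_self order_trans)
    then show ?thesis using True int by simp
  next
    case False
    have "\<not> p ` set xs \<subseteq> p' ` set xs"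
    proof
      assume "p ` set xs \<subseteq> p' ` set xs"
      then have "p ` set xs = p' ` set xs"
        using permutes_inj_on[OF p, of "set xs"] permutes_inj_on[OF p', of "set xs"]
        by (intro card_subset_eq) (auto simp: card_image)
      then show False using False by simp
    qed
    then obtain i0 where i0: "i0 \<in> set xs" "p i0 \<notin> p' ` set xs" by blast
    obtain us vs where uv: "xs = us @ i0 # vs" using split_list[OF i0(1)] by auto
    have ni: "i0 \<notin> set us" "i0 \<notin> set vs" using xs(1) uv by auto
    let ?j = "p i0"
    let ?\<Psi> = "\<lambda>x. T (map (\<lambda>i. clip (x (p i))) xs) * T (map (\<lambda>i. clip (x (p' i))) xs)"
    have eq: "?f \<omega> = ?\<Psi> (sample \<omega>)" if "\<omega> \<in> space M" for \<omega>
    proof -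
      have "map (\<lambda>i. clip (sample \<omega> (p i))) xs = map (\<lambda>i. \<epsilon> (p i) \<omega>) xs"
        "map (\<lambda>i. clip (sample \<omega> (p' i))) xs = map (\<lambda>i. \<epsilon> (p' i) \<omega>) xs"
        using pi pi' that by (auto simp: sample_def)
      then show ?thesis by (simp only:)
    qed
    have "expectation (\<lambda>\<omega>. ?\<Psi> (sample \<omega>)) = 0"
    proof (rule expectation_eq_0_if_slot[where j = ?j])
      have "(\<lambda>x. T (map (\<lambda>i. clip (x (q i))) xs)) \<in> borel_measurable (PiM {1..n} (\<lambda>_. borel))"
        if "\<And>i. i \<in> set xs \<Longrightarrow> q i \<in> {1..n}" for q
        using that by (intro measurable_form[OF H(1) B T xs(1,2)]
            measurable_compose[OF coordinate_measurable measurable_clip]) auto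
      then show "?\<Psi> \<in> borel_measurable (PiM {1..n} (\<lambda>_. borel))"
        using pi pi' by (intro borel_measurable_times) auto
      show "integrable M (\<lambda>\<omega>. ?\<Psi> (sample \<omega>))"
        using I eq by (subst Bochner_Integration.integrable_cong[where g = ?f]) auto
      show j: "?j \<in> {1..n}" using pi i0 by simp
      fix x :: "nat \<Rightarrow> 'a"
      let ?pre = "map (\<lambda>i. clip (x (p i))) us" and ?post = "map (\<lambda>i. clip (x (p i))) vs"
      let ?c = "T (map (\<lambda>i. clip (x (p' i))) xs)"
      have pe: "p i \<noteq> p i0" if "i \<in> set us \<union> set vs" for i
        using that ni permutes_inj[OF p] by (auto dest: injD)
      have upd: "?\<Psi> (x(?j := \<epsilon> ?j \<omega>)) = T (?pre @ \<epsilon> ?j \<omega> # ?post) * ?c" if "\<omega> \<in> space M" for \<omega>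
      proof -
        have m1: "map (\<lambda>i. clip ((x(?j := \<epsilon> ?j \<omega>)) (p i))) xs = ?pre @ \<epsilon> ?j \<omega> # ?post"
          using pe j that unfolding uv by auto
        have m2: "map (\<lambda>i. clip ((x(?j := \<epsilon> ?j \<omega>)) (p' i))) xs = map (\<lambda>i. clip (x (p' i))) xs"
        proof (intro map_cong refl)
          fix i assume "i \<in> set xs"
          then have "p' i \<noteq> ?j" using i0(2) by (metis imageI)
          then show "clip ((x(?j := \<epsilon> ?j \<omega>)) (p' i)) = clip (x (p' i))" by simp
        qed
        show ?thesis unfolding m1 m2 ..
      qed
      have "(\<integral>\<omega>. ?\<Psi> (x(?j := \<epsilon> ?j \<omega>)) \<partial>M) = (\<integral>\<omega>. T (?pre @ \<epsilon> ?j \<omega> # ?post) * ?c \<partial>M)"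
        using upd by (intro Bochner_Integration.integral_cong) auto
      also have "\<dots> = 0"
      proof -
        have "expectation (\<lambda>\<omega>. T (?pre @ \<epsilon> ?j \<omega> # ?post)) = 0"
          using xs(2) uv by (intro expectation_slot[OF T N _ _ _ j]) auto
        then show ?thesis by simp
      qed
      finally show "(\<integral>\<omega>. ?\<Psi> (x(?j := \<epsilon> ?j \<omega>)) \<partial>M) = 0" .
    qed
    moreover have "expectation ?f = expectation (\<lambda>\<omega>. ?\<Psi> (sample \<omega>))"
      using eq by (intro Bochner_Integration.integral_cong) auto
    ultimately show ?thesis using False by simp
  qed
qed

lemma perm_avg_form_second_moment:
  shows "integrable M (\<lambda>\<omega>. (perm_avg n (\<lambda>p. T (map (\<lambda>i. \<epsilon> (p i) \<omega>) xs)))\<^sup>2)"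
    and "expectation (\<lambda>\<omega>. (perm_avg n (\<lambda>p. T (map (\<lambda>i. \<epsilon> (p i) \<omega>) xs)))\<^sup>2) \<le>
      fact k / ffact n k * perm_avg n (\<lambda>p. expectation (\<lambda>\<omega>. (T (map (\<lambda>i. \<epsilon> (p i) \<omega>) xs))\<^sup>2))"
proof -
  let ?F = "\<lambda>p \<omega>. T (map (\<lambda>i. \<epsilon> (p i) \<omega>) xs)"
  have sq: "(perm_avg n (\<lambda>p. ?F p \<omega>))\<^sup>2 =
      (\<Sum>p | p permutes {1..n}. \<Sum>p' | p' permutes {1..n}. ?F p \<omega> * ?F p' \<omega>) / (fact n * fact n)" for \<omega>
    unfolding power2_eq_square perm_avg_def by (simp add: sum_product)
  show "integrable M (\<lambda>\<omega>. (perm_avg n (\<lambda>p. ?F p \<omega>))\<^sup>2)"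
    unfolding sq using form_permuted_product(1)
    by (intro integrable_divide Bochner_Integration.integrable_sum) auto
  have "expectation (\<lambda>\<omega>. (perm_avg n (\<lambda>p. ?F p \<omega>))\<^sup>2) =
     (\<Sum>p | p permutes {1..n}. \<Sum>p' | p' permutes {1..n}. expectation (\<lambda>\<omega>. ?F p \<omega> * ?F p' \<omega>)) / (fact n * fact n)"
    unfolding sq using form_permuted_product(1)
    by (intro expectation_double_sum) auto
  also have "\<dots> = perm_avg n (\<lambda>p. perm_avg n (\<lambda>p'. expectation (\<lambda>\<omega>. ?F p \<omega> * ?F p' \<omega>)))"
    unfolding perm_avg_def by (simp add: sum_divide_distrib[symmetric])
  also have "\<dots> \<le> fact (card (set xs)) / ffact n (card (set xs)) * perm_avg n (\<lambda>p. expectation (\<lambda>\<omega>. (?F p \<omega>)\<^sup>2))"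
    by (rule perm_avg_kernel_le[OF xs(3) form_permuted_product(2)])
  finally show "expectation (\<lambda>\<omega>. (perm_avg n (\<lambda>p. ?F p \<omega>))\<^sup>2) \<le>
      fact k / ffact n k * perm_avg n (\<lambda>p. expectation (\<lambda>\<omega>. (?F p \<omega>)\<^sup>2))"
    using xs by (simp add: distinct_card)
qed

end

lemma sum_expectation_slot_sq:
  assumes T: "multilinear_form H (Suc k) T" "form_le H (Suc k) T N" and N: "0 \<le> N"
    and hs: "length hs = k" "set hs \<subseteq> H"
    and s2: "\<And>a. a \<in> H \<Longrightarrow> (\<Sum>j=1..n. expectation (\<lambda>\<omega>. (a \<bullet> \<epsilon> j \<omega>)\<^sup>2)) \<le> C * (norm a)\<^sup>2" and C: "0 \<le> C"
  shows "(\<Sum>j=1..n. expectation (\<lambda>\<omega>. (T (\<epsilon> j \<omega> # hs))\<^sup>2)) \<le> C * N\<^sup>2 * (prod_list (map norm hs))\<^sup>2"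
proof -
  obtain a where a: "a \<in> H" "norm a \<le> N * prod_list (map norm hs)" "\<And>z. z \<in> H \<Longrightarrow> T (z # hs) = a \<bullet> z"
    using slot_Riesz[OF T N, of "[]" hs] hs by auto
  have "(\<Sum>j=1..n. expectation (\<lambda>\<omega>. (T (\<epsilon> j \<omega> # hs))\<^sup>2)) = (\<Sum>j=1..n. expectation (\<lambda>\<omega>. (a \<bullet> \<epsilon> j \<omega>)\<^sup>2))"
    using a(3) \<epsilon>_H by (intro sum.cong refl Bochner_Integration.integral_cong) auto
  also have "\<dots> \<le> C * (norm a)\<^sup>2" by (rule s2[OF a(1)])
  also have "\<dots> \<le> C * (N * prod_list (map norm hs))\<^sup>2"
    using C a(2) by (intro mult_left_mono power_mono) auto
  finally show ?thesis by (simp add: power_mult_distrib mult.assoc)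
qed

text \<open>Redrawing slot 1 produces a sum over \<open>j\<close> of squared values at
  \<open>\<epsilon> j\<close>. With the other slots frozen that sum is the quadratic expression in
  \<open>s2\<close> at the Riesz vector of the slot. Its squared norm is a product of squared norms
  of the other noise vectors, to which independence applies.\<close>

lemma perm_avg_expectation_form_sq:
  assumes T: "multilinear_form H (Suc k) T" "form_le H (Suc k) T N" and N: "0 \<le> N" and k: "Suc k \<le> n"
    and s2: "\<And>a. a \<in> H \<Longrightarrow> (\<Sum>j=1..n. expectation (\<lambda>\<omega>. (a \<bullet> \<epsilon> j \<omega>)\<^sup>2)) \<le> C * (norm a)\<^sup>2" and C: "0 \<le> C"
  shows "perm_avg n (\<lambda>p. expectation (\<lambda>\<omega>. (T (map (\<lambda>i. \<epsilon> (p i) \<omega>) [1..<Suc (Suc k)]))\<^sup>2)) \<le>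
    C * N\<^sup>2 * (\<Sum>j=1..n. e2 j) ^ k / ffact n (Suc k)"
proof -
  let ?I = "{2..Suc k}" and ?ys = "[2..<Suc (Suc k)]"
  have ys: "set ?ys = ?I" "distinct ?ys" "length ?ys = k" by auto
  have xs: "[1..<Suc (Suc k)] = 1 # ?ys" by (simp add: upt_conv_Cons numeral_2_eq_2 del: upt_Suc)
  have I: "?I \<subseteq> {1..n}" "1 \<in> {1..n} - ?I" "card ?I = k" using k by auto
  let ?a = "\<lambda>p. expectation (\<lambda>\<omega>. (T (map (\<lambda>i. \<epsilon> (p i) \<omega>) [1..<Suc (Suc k)]))\<^sup>2)"
  have key: "(\<Sum>i\<in>{1..n} - ?I. ?a (p \<circ> Transposition.transpose 1 i)) \<le> C * N\<^sup>2 * (\<Prod>i\<in>?I. e2 (p i))"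
    if p: "p permutes {1..n}" for p
  proof -
    have pi: "p i \<in> {1..n}" if "i \<in> {1..n}" for i using permutes_in_image[OF p] that by simp
    have pI: "p i \<in> {1..n}" if "i \<in> set ?ys" for i using pi I that ys(1) by blast
    let ?L = "\<lambda>\<omega>. map (\<lambda>i. \<epsilon> (p i) \<omega>) ?ys"
    have LH: "set (?L \<omega>) \<subseteq> H" if "\<omega> \<in> space M" for \<omega>
      using pI \<epsilon>_H that by auto
    have Lm: "(\<lambda>(\<omega>, \<omega>'). T (\<epsilon> j \<omega>' # ?L \<omega>)) \<in> borel_measurable (M \<Otimes>\<^sub>M M)" if j: "j \<in> {1..n}" for j
    proof -
      let ?Z = "\<lambda>i (\<omega>, \<omega>'). if i = 1 then \<epsilon> j \<omega>' else \<epsilon> (p i) \<omega>"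
      have "(\<lambda>z. T (map (\<lambda>i. ?Z i z) (1 # ?ys))) \<in> borel_measurable (M \<Otimes>\<^sub>M M)"
      proof (rule measurable_form[OF H(1) B T])
        fix i assume i: "i \<in> set (1 # ?ys)"
        have mj: "\<epsilon> j \<in> borel_measurable M" using j by (rule measurable_\<epsilon>)
        show "?Z i \<in> borel_measurable (M \<Otimes>\<^sub>M M)"
        proof (cases "i = 1")
          case True
          then show ?thesis using measurable_compose[OF measurable_snd mj] by (simp add: case_prod_beta')
        next
          case False
          then have "\<epsilon> (p i) \<in> borel_measurable M" using i pI by (intro measurable_\<epsilon>) auto
          then show ?thesis using False measurable_compose[OF measurable_fst] by (simp add: case_prod_beta')
        qed
        fix z assume "z \<in> space (M \<Otimes>\<^sub>M M)"
        then show "?Z i z \<in> H" using i pI \<epsilon>_H j by (auto simp: space_pair_measure)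
      qed (auto simp: ys)
      moreover have "map (\<lambda>i. ?Z i z) (1 # ?ys) = \<epsilon> j (snd z) # ?L (fst z)" for z
        by (auto simp: case_prod_beta' simp del: upt_Suc)
      ultimately have "(\<lambda>z. T (\<epsilon> j (snd z) # ?L (fst z))) \<in> borel_measurable (M \<Otimes>\<^sub>M M)"
        by (simp only:)
      then show ?thesis by (simp only: case_prod_beta')
    qed
    \<comment> \<open>\<open>p i\<close> lies outside the indices used by the slots
      \<open>?ys\<close>, so its noise vector may be replaced by an independent copy without
      touching \<open>?L\<close>.\<close>
    have one: "ennreal (?a (p \<circ> Transposition.transpose 1 i)) =
       (\<integral>\<^sup>+\<omega>. (\<integral>\<^sup>+\<omega>'. ennreal ((T (\<epsilon> (p i) \<omega>' # ?L \<omega>))\<^sup>2) \<partial>M) \<partial>M)" if i: "i \<in> {1..n} - ?I" for i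
    proof -
      let ?j = "p i"
      have j: "?j \<in> {1..n}" using i pi by simp
      have q: "p \<circ> Transposition.transpose 1 i permutes {1..n}"
        using i I by (intro permutes_compose[OF permutes_swap_id p]) auto
      have nj: "p s \<noteq> ?j" if "s \<in> set ?ys" for s
        using that i permutes_inj[OF p] unfolding ys(1) by (auto dest: injD)
      have m: "map (\<lambda>s. \<epsilon> ((p \<circ> Transposition.transpose 1 i) s) \<omega>) [1..<Suc (Suc k)] = \<epsilon> ?j \<omega> # ?L \<omega>" for \<omega>
        using i unfolding xs by (auto simp: Transposition.transpose_def simp del: upt_Suc)
      let ?\<Psi> = "\<lambda>x. ennreal ((T (clip (x ?j) # map (\<lambda>i. clip (x (p i))) ?ys))\<^sup>2)"
      have "(\<lambda>x. T (map (\<lambda>s. clip (x ((p \<circ> Transposition.transpose 1 i) s))) [1..<Suc (Suc k)]))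
          \<in> borel_measurable (PiM {1..n} (\<lambda>_. borel))"
      proof (rule measurable_form[OF H(1) B T])
        fix s assume "s \<in> set [1..<Suc (Suc k)]"
        then have "s \<in> {1..n}" using k by auto
        then have "(p \<circ> Transposition.transpose 1 i) s \<in> {1..n}" using permutes_in_image[OF q] by blast
        then show "(\<lambda>x. clip (x ((p \<circ> Transposition.transpose 1 i) s))) \<in> borel_measurable (PiM {1..n} (\<lambda>_. borel))"
          by (intro measurable_compose[OF coordinate_measurable measurable_clip]) auto
      qed auto
      moreover have "map (\<lambda>s. clip (x ((p \<circ> Transposition.transpose 1 i) s))) [1..<Suc (Suc k)] =
         clip (x ?j) # map (\<lambda>i. clip (x (p i))) ?ys" for x :: "nat \<Rightarrow> 'a"
        using i unfolding xs by (auto simp: Transposition.transpose_def simp del: upt_Suc)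
      ultimately have m\<Psi>: "?\<Psi> \<in> borel_measurable (PiM {1..n} (\<lambda>_. borel))" by simp
      have "set [1..<Suc (Suc k)] \<subseteq> {1..n}" using k by auto
      from form_permuted_sq_integrable[OF T N _ _ this q]
      have int: "integrable M (\<lambda>\<omega>. (T (\<epsilon> ?j \<omega> # ?L \<omega>))\<^sup>2)" unfolding m by (simp del: upt_Suc)
      have "ennreal (?a (p \<circ> Transposition.transpose 1 i)) = (\<integral>\<^sup>+\<omega>. ennreal ((T (\<epsilon> ?j \<omega> # ?L \<omega>))\<^sup>2) \<partial>M)"
        unfolding m by (rule nn_integral_eq_integral[OF int, symmetric]) simp
      also have "\<dots> = (\<integral>\<^sup>+\<omega>. ?\<Psi> (sample \<omega>) \<partial>M)"
      proof (intro nn_integral_cong)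
        fix \<omega> assume w: "\<omega> \<in> space M"
        have "map (\<lambda>i. clip (sample \<omega> (p i))) ?ys = ?L \<omega>"
          using pI w by (intro map_cong refl) (simp add: sample_def)
        moreover have "clip (sample \<omega> ?j) = \<epsilon> ?j \<omega>" using j w by (simp add: sample_def)
        ultimately show "ennreal ((T (\<epsilon> ?j \<omega> # ?L \<omega>))\<^sup>2) = ?\<Psi> (sample \<omega>)"
          by (simp only:)
      qed
      also have "\<dots> = (\<integral>\<^sup>+\<omega>. (\<integral>\<^sup>+\<omega>'. ?\<Psi> ((sample \<omega>)(?j := \<epsilon> ?j \<omega>')) \<partial>M) \<partial>M)"
        by (rule nn_integral_decouple[OF m\<Psi> j])
      also have "\<dots> = (\<integral>\<^sup>+\<omega>. (\<integral>\<^sup>+\<omega>'. ennreal ((T (\<epsilon> ?j \<omega>' # ?L \<omega>))\<^sup>2) \<partial>M) \<partial>M)"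
      proof (intro nn_integral_cong)
        fix \<omega> \<omega>' assume w: "\<omega> \<in> space M" "\<omega>' \<in> space M"
        have "map (\<lambda>s. clip (((sample \<omega>)(?j := \<epsilon> ?j \<omega>')) (p s))) ?ys = ?L \<omega>"
          using pI w nj by (intro map_cong refl) (simp add: sample_def)
        moreover have "clip (((sample \<omega>)(?j := \<epsilon> ?j \<omega>')) ?j) = \<epsilon> ?j \<omega>'" using j w by simp
        ultimately show "?\<Psi> ((sample \<omega>)(?j := \<epsilon> ?j \<omega>')) = ennreal ((T (\<epsilon> ?j \<omega>' # ?L \<omega>))\<^sup>2)"
          by (simp only:)
      qed
      finally show ?thesis .
    qed
    have intj: "integrable M (\<lambda>\<omega>'. (T (\<epsilon> j \<omega>' # hs))\<^sup>2)" if j: "j \<in> {1..n}" and hs: "length hs = k" "set hs \<subseteq> H" for j hs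
    proof -
      obtain a where "a \<in> H" "norm a \<le> N * prod_list (map norm hs)"
        and a: "\<And>z. z \<in> H \<Longrightarrow> T (z # hs) = a \<bullet> z"
        using slot_Riesz[OF T N, of "[]" hs] hs by auto
      have "integrable M (\<lambda>\<omega>'. (a \<bullet> \<epsilon> j \<omega>')\<^sup>2)"
      proof (rule Bochner_Integration.integrable_bound)
        show "integrable M (\<lambda>\<omega>. (norm a)\<^sup>2 * (norm (\<epsilon> j \<omega>))\<^sup>2)" using integrable_\<epsilon>2[OF j] by simp
        have "(a \<bullet> \<epsilon> j \<omega>)\<^sup>2 \<le> (norm a)\<^sup>2 * (norm (\<epsilon> j \<omega>))\<^sup>2" for \<omega>
          using power_mono[OF Cauchy_Schwarz_ineq2[of a "\<epsilon> j \<omega>"], of 2] by (simp add: power_mult_distrib)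
        then show "AE \<omega> in M. norm ((a \<bullet> \<epsilon> j \<omega>)\<^sup>2) \<le> norm ((norm a)\<^sup>2 * (norm (\<epsilon> j \<omega>))\<^sup>2)" by simp
        show "(\<lambda>\<omega>'. (a \<bullet> \<epsilon> j \<omega>')\<^sup>2) \<in> borel_measurable M" using measurable_\<epsilon>[OF j] by simp
      qed
      then show ?thesis
        using a \<epsilon>_H[OF j] by (subst Bochner_Integration.integrable_cong[where g = "\<lambda>\<omega>'. (a \<bullet> \<epsilon> j \<omega>')\<^sup>2"]) auto
    qed
    have "ennreal (\<Sum>i\<in>{1..n} - ?I. ?a (p \<circ> Transposition.transpose 1 i)) =
       (\<Sum>i\<in>{1..n} - ?I. \<integral>\<^sup>+\<omega>. (\<integral>\<^sup>+\<omega>'. ennreal ((T (\<epsilon> (p i) \<omega>' # ?L \<omega>))\<^sup>2) \<partial>M) \<partial>M)"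
      using one by (subst sum_ennreal[symmetric]) (auto intro!: sum.cong integral_nonneg_AE)
    also have "\<dots> = (\<Sum>j\<in>{1..n} - p ` ?I. \<integral>\<^sup>+\<omega>. (\<integral>\<^sup>+\<omega>'. ennreal ((T (\<epsilon> j \<omega>' # ?L \<omega>))\<^sup>2) \<partial>M) \<partial>M)"
    proof -
      have "p ` ({1..n} - ?I) = {1..n} - p ` ?I"
        using permutes_image[OF p] image_set_diff[OF permutes_inj[OF p]] by simp
      then show ?thesis
        using sum.reindex[OF permutes_inj_on[OF p, of "{1..n} - ?I"], where
            g = "\<lambda>j. \<integral>\<^sup>+\<omega>. (\<integral>\<^sup>+\<omega>'. ennreal ((T (\<epsilon> j \<omega>' # ?L \<omega>))\<^sup>2) \<partial>M) \<partial>M"]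
        by (simp only: comp_def)
    qed
    \<comment> \<open>The used indices are added back: the terms are nonnegative, and
      \<open>s2\<close> speaks of the sum over all \<open>j\<close>.\<close>
    also have "\<dots> \<le> (\<Sum>j\<in>{1..n}. \<integral>\<^sup>+\<omega>. (\<integral>\<^sup>+\<omega>'. ennreal ((T (\<epsilon> j \<omega>' # ?L \<omega>))\<^sup>2) \<partial>M) \<partial>M)"
      by (intro sum_mono2) auto
    also have "\<dots> = (\<integral>\<^sup>+\<omega>. (\<Sum>j\<in>{1..n}. \<integral>\<^sup>+\<omega>'. ennreal ((T (\<epsilon> j \<omega>' # ?L \<omega>))\<^sup>2) \<partial>M) \<partial>M)"
    proof (intro nn_integral_sum[symmetric])
      fix j assume "j \<in> {1..n}"
      from Lm[OF this] have "(\<lambda>(\<omega>, \<omega>'). ennreal ((T (\<epsilon> j \<omega>' # ?L \<omega>))\<^sup>2)) \<in> borel_measurable (M \<Otimes>\<^sub>M M)"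
        by (simp add: case_prod_beta')
      then show "(\<lambda>\<omega>. \<integral>\<^sup>+\<omega>'. ennreal ((T (\<epsilon> j \<omega>' # ?L \<omega>))\<^sup>2) \<partial>M) \<in> borel_measurable M"
        by (intro borel_measurable_nn_integral)
    qed
    also have "\<dots> \<le> (\<integral>\<^sup>+\<omega>. ennreal (C * N\<^sup>2 * (\<Prod>i\<in>?I. (norm (\<epsilon> (p i) \<omega>))\<^sup>2)) \<partial>M)"
    proof (intro nn_integral_mono)
      fix \<omega> assume w: "\<omega> \<in> space M"
      have "(\<Sum>j\<in>{1..n}. \<integral>\<^sup>+\<omega>'. ennreal ((T (\<epsilon> j \<omega>' # ?L \<omega>))\<^sup>2) \<partial>M) =
         (\<Sum>j\<in>{1..n}. ennreal (expectation (\<lambda>\<omega>'. (T (\<epsilon> j \<omega>' # ?L \<omega>))\<^sup>2)))"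
        using LH[OF w] ys by (intro sum.cong refl nn_integral_eq_integral intj) auto
      also have "\<dots> = ennreal (\<Sum>j\<in>{1..n}. expectation (\<lambda>\<omega>'. (T (\<epsilon> j \<omega>' # ?L \<omega>))\<^sup>2))"
        by (intro sum_ennreal integral_nonneg_AE) auto
      also have "\<dots> \<le> ennreal (C * N\<^sup>2 * (prod_list (map norm (?L \<omega>)))\<^sup>2)"
        using LH[OF w] ys by (intro ennreal_leI sum_expectation_slot_sq[OF T N _ _ s2 C]) auto
      also have "prod_list (map norm (?L \<omega>)) = (\<Prod>i\<in>?I. norm (\<epsilon> (p i) \<omega>))"
        unfolding ys(1)[symmetric] map_map comp_def by (rule prod.distinct_set_conv_list[OF ys(2), symmetric])
      finally show "(\<Sum>j\<in>{1..n}. \<integral>\<^sup>+\<omega>'. ennreal ((T (\<epsilon> j \<omega>' # ?L \<omega>))\<^sup>2) \<partial>M) \<le>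
         ennreal (C * N\<^sup>2 * (\<Prod>i\<in>?I. (norm (\<epsilon> (p i) \<omega>))\<^sup>2))"
        by (simp only: prod_power_distrib)
    qed
    also have "\<dots> = ennreal (expectation (\<lambda>\<omega>. C * N\<^sup>2 * (\<Prod>i\<in>?I. (norm (\<epsilon> (p i) \<omega>))\<^sup>2)))"
      using prod_norm2_permuted(1)[OF I(1) p] C
      by (intro nn_integral_eq_integral) (auto intro!: mult_nonneg_nonneg prod_nonneg)
    also have "\<dots> = ennreal (C * N\<^sup>2 * (\<Prod>i\<in>?I. e2 (p i)))"
      using prod_norm2_permuted(2)[OF I(1) p] by simp
    finally show ?thesis
      by (rule ennreal_le_iff[THEN iffD1, rotated]) (use C in \<open>auto intro!: mult_nonneg_nonneg prod_nonneg e2_nonneg\<close>)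
  qed
  have pos: "0 < real n - real k" using k by simp
  have "perm_avg n ?a =
    perm_avg n (\<lambda>p. (\<Sum>i\<in>{1..n} - ?I. ?a (p \<circ> Transposition.transpose 1 i)) / (real n - real (card ?I)))"
    by (rule perm_avg_resample[OF I(1,2)])
  also have "\<dots> \<le> perm_avg n (\<lambda>p. (C * N\<^sup>2) * (\<Prod>i\<in>?I. e2 (p i)) / (real n - real k))"
    using key pos I(3) by (intro perm_avg_mono) (simp add: divide_right_mono)
  also have "\<dots> = C * N\<^sup>2 * perm_avg n (\<lambda>p. \<Prod>i\<in>?I. e2 (p i)) / (real n - real k)"
    unfolding perm_avg_divide perm_avg_cmult ..
  also have "\<dots> \<le> C * N\<^sup>2 * ((\<Prod>i\<in>?I. \<Sum>j=1..n. e2 j) / ffact n (card ?I)) / (real n - real k)"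
    using pos C by (intro divide_right_mono mult_left_mono perm_avg_prod_le I e2_nonneg) auto
  also have "\<dots> = C * N\<^sup>2 * (\<Sum>j=1..n. e2 j) ^ k / ffact n (Suc k)"
    unfolding I(3) by (simp add: ffact_Suc I(3))
  finally show ?thesis .
qed

text \<open>If the index sets differ, some \<open>\<epsilon> (p i0)\<close> occurs in exactly one
  inner product, linearly, and averages out. On equal index sets Cauchy-Schwarz leaves two products
  of squared norms, whose means factor by independence.\<close>

lemma gram_expectation:
  assumes S: "S \<subseteq> {1..n}"
  defines "G \<equiv> \<lambda>\<omega>. perm_avg n (\<lambda>p. perm_avg n (\<lambda>p'. \<Prod>i\<in>S. \<epsilon> (p i) \<omega> \<bullet> \<epsilon> (p' i) \<omega>))"
  shows "integrable M G"
    and "expectation G \<le> fact (card S) * (\<Sum>j=1..n. e2 j) ^ card S / (ffact n (card S))\<^sup>2"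
proof -
  have fS: "finite S" using S finite_subset by auto
  let ?K = "\<lambda>p p' \<omega>. \<Prod>i\<in>S. \<epsilon> (p i) \<omega> \<bullet> \<epsilon> (p' i) \<omega>"
  let ?a = "\<lambda>p. \<Prod>i\<in>S. e2 (p i)"
  have pm: "p i \<in> {1..n}" if "p permutes {1..n}" "i \<in> S" for p i
    using permutes_in_image[OF that(1)] that(2) S by blast
  have b: "\<bar>?K p p' \<omega>\<bar> \<le> ((\<Prod>i\<in>S. (norm (\<epsilon> (p i) \<omega>))\<^sup>2) + (\<Prod>i\<in>S. (norm (\<epsilon> (p' i) \<omega>))\<^sup>2)) / 2" for p p' \<omega>
  proof -
    have "\<bar>?K p p' \<omega>\<bar> = (\<Prod>i\<in>S. \<bar>\<epsilon> (p i) \<omega> \<bullet> \<epsilon> (p' i) \<omega>\<bar>)" by (rule abs_prod)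
    also have "\<dots> \<le> (\<Prod>i\<in>S. norm (\<epsilon> (p i) \<omega>) * norm (\<epsilon> (p' i) \<omega>))"
      by (intro prod_mono) (auto simp: Cauchy_Schwarz_ineq2)
    also have "\<dots> = (\<Prod>i\<in>S. norm (\<epsilon> (p i) \<omega>)) * (\<Prod>i\<in>S. norm (\<epsilon> (p' i) \<omega>))" by (rule prod.distrib)
    also have "\<dots> \<le> ((\<Prod>i\<in>S. norm (\<epsilon> (p i) \<omega>))\<^sup>2 + (\<Prod>i\<in>S. norm (\<epsilon> (p' i) \<omega>))\<^sup>2) / 2"
      using sum_squares_bound[of "\<Prod>i\<in>S. norm (\<epsilon> (p i) \<omega>)" "\<Prod>i\<in>S. norm (\<epsilon> (p' i) \<omega>)"] by simp
    finally show ?thesis by (simp add: prod_power_distrib)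
  qed
  have intb: "integrable M (\<lambda>\<omega>. ((\<Prod>i\<in>S. (norm (\<epsilon> (p i) \<omega>))\<^sup>2) + (\<Prod>i\<in>S. (norm (\<epsilon> (p' i) \<omega>))\<^sup>2)) / 2)"
    if "p permutes {1..n}" "p' permutes {1..n}" for p p'
    using prod_norm2_permuted(1)[OF S that(1)] prod_norm2_permuted(1)[OF S that(2)] by auto
  have intK: "integrable M (?K p p')" if pp: "p permutes {1..n}" "p' permutes {1..n}" for p p'
  proof (rule Bochner_Integration.integrable_bound[OF intb[OF pp]])
    show "?K p p' \<in> borel_measurable M"
      using pm[OF pp(1)] pm[OF pp(2)] by (intro borel_measurable_prod borel_measurable_inner measurable_\<epsilon>)
    have "norm (?K p p' \<omega>) \<le> norm (((\<Prod>i\<in>S. (norm (\<epsilon> (p i) \<omega>))\<^sup>2) + (\<Prod>i\<in>S. (norm (\<epsilon> (p' i) \<omega>))\<^sup>2)) / 2)" for \<omega>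
      using b[of p \<omega> p'] by (simp only: real_norm_def)
    then show "AE \<omega> in M. norm (?K p p' \<omega>) \<le>
      norm (((\<Prod>i\<in>S. (norm (\<epsilon> (p i) \<omega>))\<^sup>2) + (\<Prod>i\<in>S. (norm (\<epsilon> (p' i) \<omega>))\<^sup>2)) / 2)" by simp
  qed
  have eK: "expectation (?K p p') \<le> (if p' ` S = p ` S then (?a p + ?a p') / 2 else 0)"
    if pp: "p permutes {1..n}" "p' permutes {1..n}" for p p'
  proof (cases "p' ` S = p ` S")
    case True
    have "expectation (?K p p') \<le> expectation (\<lambda>\<omega>. ((\<Prod>i\<in>S. (norm (\<epsilon> (p i) \<omega>))\<^sup>2) + (\<Prod>i\<in>S. (norm (\<epsilon> (p' i) \<omega>))\<^sup>2)) / 2)"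
      using b by (intro integral_mono intK intb pp) (meson abs_ge_self order_trans)
    also have "\<dots> = (?a p + ?a p') / 2"
      using prod_norm2_permuted[OF S pp(1)] prod_norm2_permuted[OF S pp(2)] by simp
    finally show ?thesis using True by simp
  next
    case False
    have "\<not> p ` S \<subseteq> p' ` S"
    proof
      assume "p ` S \<subseteq> p' ` S"
      then have "p ` S = p' ` S"
        using fS permutes_inj_on[OF pp(1), of S] permutes_inj_on[OF pp(2), of S]
        by (intro card_subset_eq) (auto simp: card_image)
      then show False using False by simp
    qed
    then obtain i0 where i0: "i0 \<in> S" "p i0 \<notin> p' ` S" by blast
    let ?j = "p i0"
    let ?\<Psi> = "\<lambda>x. \<Prod>i\<in>S. (x (p i) :: 'a) \<bullet> x (p' i)"
    have j: "?j \<in> {1..n}" using pm[OF pp(1) i0(1)] .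
    have eq: "?K p p' \<omega> = ?\<Psi> (sample \<omega>)" for \<omega>
      using pm[OF pp(1)] pm[OF pp(2)] by (intro prod.cong refl) (simp add: sample_def)
    have "expectation (\<lambda>\<omega>. ?\<Psi> (sample \<omega>)) = 0"
    proof (rule expectation_eq_0_if_slot[OF _ _ j])
      show "?\<Psi> \<in> borel_measurable (PiM {1..n} (\<lambda>_. borel))"
        using pm[OF pp(1)] pm[OF pp(2)]
        by (intro borel_measurable_prod borel_measurable_inner coordinate_measurable)
      show "integrable M (\<lambda>\<omega>. ?\<Psi> (sample \<omega>))" using intK[OF pp] unfolding eq .
      fix x :: "nat \<Rightarrow> 'a"
      have "?\<Psi> (x(?j := \<epsilon> ?j \<omega>)) = (\<epsilon> ?j \<omega> \<bullet> x (p' i0)) * (\<Prod>i\<in>S - {i0}. x (p i) \<bullet> x (p' i))" for \<omega>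
      proof -
        have "?\<Psi> (x(?j := \<epsilon> ?j \<omega>)) = ((x(?j := \<epsilon> ?j \<omega>)) (p i0) \<bullet> (x(?j := \<epsilon> ?j \<omega>)) (p' i0)) *
           (\<Prod>i\<in>S - {i0}. (x(?j := \<epsilon> ?j \<omega>)) (p i) \<bullet> (x(?j := \<epsilon> ?j \<omega>)) (p' i))"
          by (rule prod.remove[OF fS i0(1)])
        also have "(\<Prod>i\<in>S - {i0}. (x(?j := \<epsilon> ?j \<omega>)) (p i) \<bullet> (x(?j := \<epsilon> ?j \<omega>)) (p' i)) =
           (\<Prod>i\<in>S - {i0}. x (p i) \<bullet> x (p' i))"
        proof (intro prod.cong refl)
          fix i assume "i \<in> S - {i0}"
          then have "p i \<noteq> ?j" "p' i \<noteq> ?j"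
            using permutes_inj[OF pp(1)] i0(2) by (auto dest: injD, metis imageI)
          then show "(x(?j := \<epsilon> ?j \<omega>)) (p i) \<bullet> (x(?j := \<epsilon> ?j \<omega>)) (p' i) = x (p i) \<bullet> x (p' i)" by simp
        qed
        also have "(x(?j := \<epsilon> ?j \<omega>)) (p' i0) = x (p' i0)" using i0 by (metis fun_upd_other imageI)
        finally show ?thesis by simp
      qed
      then show "(\<integral>\<omega>. ?\<Psi> (x(?j := \<epsilon> ?j \<omega>)) \<partial>M) = 0"
        using integrable_\<epsilon>[OF j] mean_\<epsilon>[OF j] by simp
    qed
    then show ?thesis using False unfolding eq by simp
  qed
  have G: "G \<omega> = (\<Sum>p | p permutes {1..n}. \<Sum>p' | p' permutes {1..n}. ?K p p' \<omega>) / (fact n * fact n)" for \<omega>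
    unfolding G_def perm_avg_def by (simp add: sum_divide_distrib[symmetric])
  show "integrable M G"
    unfolding G using intK by (intro integrable_divide Bochner_Integration.integrable_sum) auto
  have "expectation G = (\<Sum>p | p permutes {1..n}. \<Sum>p' | p' permutes {1..n}. expectation (?K p p')) / (fact n * fact n)"
    unfolding G using intK by (intro expectation_double_sum) auto
  also have "\<dots> = perm_avg n (\<lambda>p. perm_avg n (\<lambda>p'. expectation (?K p p')))"
    unfolding perm_avg_def by (simp add: sum_divide_distrib[symmetric])
  also have "\<dots> \<le> fact (card S) / ffact n (card S) * perm_avg n ?a"
    by (rule perm_avg_kernel_le[OF S eK])
  also have "\<dots> \<le> fact (card S) / ffact n (card S) * ((\<Prod>i\<in>S. \<Sum>j=1..n. e2 j) / ffact n (card S))"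
    using ffact_pos[of "card S" n] card_mono[OF _ S] S e2_nonneg
    by (intro mult_left_mono perm_avg_prod_le) auto
  finally show "expectation G \<le> fact (card S) * (\<Sum>j=1..n. e2 j) ^ card S / (ffact n (card S))\<^sup>2"
    by (simp add: power2_eq_square)
qed

lemma sample_mean_second_moment:
  shows "integrable M (\<lambda>\<omega>. (norm (sample_mean n (\<lambda>j. \<epsilon> j \<omega>)))\<^sup>2)"
    and "expectation (\<lambda>\<omega>. (norm (sample_mean n (\<lambda>j. \<epsilon> j \<omega>)))\<^sup>2) = (\<Sum>j=1..n. e2 j) / (real n)\<^sup>2"
proof -
  have int: "integrable M (\<lambda>\<omega>. \<epsilon> i \<omega> \<bullet> \<epsilon> j \<omega>)" if ij: "i \<in> {1..n}" "j \<in> {1..n}" for i j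
  proof (rule Bochner_Integration.integrable_bound)
    show "integrable M (\<lambda>\<omega>. ((norm (\<epsilon> i \<omega>))\<^sup>2 + (norm (\<epsilon> j \<omega>))\<^sup>2) / 2)"
      using integrable_\<epsilon>2 ij by auto
    show "(\<lambda>\<omega>. \<epsilon> i \<omega> \<bullet> \<epsilon> j \<omega>) \<in> borel_measurable M" using measurable_\<epsilon> ij by simp
    have "\<bar>\<epsilon> i \<omega> \<bullet> \<epsilon> j \<omega>\<bar> \<le> ((norm (\<epsilon> i \<omega>))\<^sup>2 + (norm (\<epsilon> j \<omega>))\<^sup>2) / 2" for \<omega>
      using Cauchy_Schwarz_ineq2[of "\<epsilon> i \<omega>" "\<epsilon> j \<omega>"] sum_squares_bound[of "norm (\<epsilon> i \<omega>)" "norm (\<epsilon> j \<omega>)"] by simp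
    then show "AE \<omega> in M. norm (\<epsilon> i \<omega> \<bullet> \<epsilon> j \<omega>) \<le> norm (((norm (\<epsilon> i \<omega>))\<^sup>2 + (norm (\<epsilon> j \<omega>))\<^sup>2) / 2)" by simp
  qed
  have zero: "expectation (\<lambda>\<omega>. \<epsilon> i \<omega> \<bullet> \<epsilon> j \<omega>) = 0" if ij: "i \<in> {1..n}" "j \<in> {1..n}" "i \<noteq> j" for i j
  proof -
    have eq: "\<epsilon> i \<omega> \<bullet> \<epsilon> j \<omega> = sample \<omega> i \<bullet> sample \<omega> j" for \<omega> using ij by (simp add: sample_def)
    show ?thesis
      unfolding eq
    proof (rule expectation_eq_0_if_slot[OF _ _ ij(1), where \<Psi> = "\<lambda>x. x i \<bullet> x j"])
      show "(\<lambda>x. (x i :: 'a) \<bullet> x j) \<in> borel_measurable (PiM {1..n} (\<lambda>_. borel))"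
        by (intro borel_measurable_inner coordinate_measurable ij)
      show "integrable M (\<lambda>\<omega>. sample \<omega> i \<bullet> sample \<omega> j)" using int[OF ij(1,2)] unfolding eq .
      show "(\<integral>\<omega>. (x(i := \<epsilon> i \<omega>)) i \<bullet> (x(i := \<epsilon> i \<omega>)) j \<partial>M) = 0" for x
        using integrable_\<epsilon>[OF ij(1)] mean_\<epsilon>[OF ij(1)] ij(3) by simp
    qed
  qed
  have sq: "(norm (sample_mean n (\<lambda>j. \<epsilon> j \<omega>)))\<^sup>2 = (\<Sum>i=1..n. \<Sum>j=1..n. \<epsilon> i \<omega> \<bullet> \<epsilon> j \<omega>) / (real n)\<^sup>2" for \<omega>
  proof -
    let ?s = "\<Sum>j=1..n. \<epsilon> j \<omega>"
    have "?s \<bullet> ?s = (\<Sum>i=1..n. \<Sum>j=1..n. \<epsilon> i \<omega> \<bullet> \<epsilon> j \<omega>)"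
      by (subst inner_sum_left) (simp only: inner_sum_right)
    moreover have "(norm ((1 / real n) *\<^sub>R ?s))\<^sup>2 = (norm ?s)\<^sup>2 / (real n)\<^sup>2"
      by (simp add: power_divide)
    ultimately show ?thesis unfolding sample_mean_def power2_norm_eq_inner by (simp only:)
  qed
  show "integrable M (\<lambda>\<omega>. (norm (sample_mean n (\<lambda>j. \<epsilon> j \<omega>)))\<^sup>2)"
    unfolding sq using int by (intro integrable_divide Bochner_Integration.integrable_sum) auto
  have "expectation (\<lambda>\<omega>. (norm (sample_mean n (\<lambda>j. \<epsilon> j \<omega>)))\<^sup>2) =
     (\<Sum>i=1..n. \<Sum>j=1..n. expectation (\<lambda>\<omega>. \<epsilon> i \<omega> \<bullet> \<epsilon> j \<omega>)) / (real n)\<^sup>2"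
    unfolding sq using int by (intro expectation_double_sum)
  also have "(\<Sum>i=1..n. \<Sum>j=1..n. expectation (\<lambda>\<omega>. \<epsilon> i \<omega> \<bullet> \<epsilon> j \<omega>)) = (\<Sum>i=1..n. \<Sum>j=1..n. if j = i then e2 i else 0)"
    using zero by (intro sum.cong refl) (auto simp: e2_def power2_norm_eq_inner)
  also have "\<dots> = (\<Sum>i=1..n. e2 i)" by simp
  finally show "expectation (\<lambda>\<omega>. (norm (sample_mean n (\<lambda>j. \<epsilon> j \<omega>)))\<^sup>2) = (\<Sum>j=1..n. e2 j) / (real n)\<^sup>2" .
qed

end

section \<open>The expansion of the estimator\<close>

lemma perm_avg_first:
  assumes "0 < n"
  shows "perm_avg n (\<lambda>p. g (p 1)) = (\<Sum>j=1..n. g j) / real n"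
proof -
  have "perm_avg n (\<lambda>p. g (p 1)) =
    perm_avg n (\<lambda>p. (\<Sum>i\<in>{1..n} - {}. g ((p \<circ> Transposition.transpose 1 i) 1)) / (real n - real (card ({} :: nat set))))"
    by (rule perm_avg_resample[where h = "\<lambda>p. g (p 1)"]) (use assms in auto)
  also have "\<dots> = perm_avg n (\<lambda>p. (\<Sum>j=1..n. g j) / real n)"
  proof (rule perm_avg_cong)
    fix p assume p: "p permutes {1..n}"
    show "(\<Sum>i\<in>{1..n} - {}. g ((p \<circ> Transposition.transpose 1 i) 1)) / (real n - real (card ({} :: nat set))) =
      (\<Sum>j=1..n. g j) / real n"
      using sum_outside_permuted[OF p, of "{}" g] by simp
  qed
  finally show ?thesis by simp
qed

text \<open>Regroups Taylor terms by total degree \<open>q = l + i\<close>.\<close>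

lemma sum_le_triangle:
  fixes g :: "nat \<Rightarrow> nat \<Rightarrow> real"
  shows "(\<Sum>l\<le>m. \<Sum>i\<le>m - l. g l i) = (\<Sum>q\<le>m. \<Sum>l\<le>q. g l (q - l))"
proof -
  have "(\<Sum>l\<le>m. \<Sum>i\<le>m - l. g l i) = (\<Sum>(l, i)\<in>(SIGMA l:{..m}. {..m - l}). g l i)"
    by (subst sum.Sigma) auto
  also have "(SIGMA l:{..m}. {..m - l}) = {(l, i). l + i \<le> m}" by auto
  also have "(\<Sum>(l, i)\<in>{(l, i). l + i \<le> m}. g l i) = (\<Sum>q\<le>m. \<Sum>l\<le>q. g l (q - l))"
    by (rule sum.triangle_reindex_eq)
  finally show ?thesis .
qed

locale smooth_functional = hilbert_noise M H B n \<epsilon>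
  for M :: "'w measure" and H B :: "'a::{real_inner,banach,second_countable_topology} set"
    and n :: nat and \<epsilon> :: "nat \<Rightarrow> 'w \<Rightarrow> 'a" +
  fixes f :: "'a \<Rightarrow> real" and \<theta> :: 'a and s :: real and m :: nat and x :: "nat \<Rightarrow> 'w \<Rightarrow> 'a"
  assumes \<theta>: "\<theta> \<in> H" and diff: "times_differentiable_on m H f"
    and m: "2 \<le> m" "m \<le> n" "real m < s" "s \<le> real m + 1" "smooth_order s = m"
    and sym: "\<And>k. k \<in> {1..m} \<Longrightarrow> symmetric_form H k (fderiv H f k \<theta>)"
    and x: "\<And>j \<omega>. j \<in> {1..n} \<Longrightarrow> \<omega> \<in> space M \<Longrightarrow> x j \<omega> = \<theta> + \<epsilon> j \<omega>"
begin

definition T :: "nat \<Rightarrow> 'a form" where "T k = fderiv H f k \<theta>"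
definition \<delta> :: "'w \<Rightarrow> 'a" where "\<delta> \<omega> = sample_mean n (\<lambda>j. \<epsilon> j \<omega>)"
definition y :: "'w \<Rightarrow> nat \<Rightarrow> 'a" where "y \<omega> j = \<epsilon> j \<omega> - \<delta> \<omega>"
definition U :: "nat \<Rightarrow> 'w \<Rightarrow> real" where
  "U k \<omega> = perm_avg n (\<lambda>p. T k (map (\<lambda>i. \<epsilon> (p i) \<omega>) [1..<Suc k]))"
text \<open>Taylor remainder of the derivative of order \<open>l\<close>. The expansion stops at
  \<open>i = m - l\<close>, so that for every \<open>l\<close> exactly the terms of total degree at
  most \<open>m\<close> are removed.\<close>

definition R :: "'w \<Rightarrow> nat \<Rightarrow> 'a form" where
  "R \<omega> l hs = fderiv H f l (\<theta> + \<delta> \<omega>) hs - (\<Sum>i\<le>m - l. T (l + i) (replicate i (\<delta> \<omega>) @ hs) / fact i)"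
definition Rem :: "'w \<Rightarrow> real" where
  "Rem \<omega> = (\<Sum>l\<le>m. perm_avg n (\<lambda>p. R \<omega> l (map (\<lambda>i. y \<omega> (p i)) [1..<Suc l])) / fact l)"

lemma \<delta>_H: "\<omega> \<in> space M \<Longrightarrow> \<delta> \<omega> \<in> H"
  unfolding \<delta>_def sample_mean_def using \<epsilon>_H by (intro subspace_scale[OF H(1)] subspace_sum[OF H(1)]) auto

lemma y_H: "\<omega> \<in> space M \<Longrightarrow> j \<in> {1..n} \<Longrightarrow> y \<omega> j \<in> H"
  unfolding y_def using \<delta>_H \<epsilon>_H by (intro subspace_diff[OF H(1)]) auto

lemma sum_y: "(\<Sum>j=1..n. y \<omega> j) = 0"
  using n by (simp add: y_def \<delta>_def sample_mean_def sum_subtractf flip: scaleR_sum_left)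

lemma T_multilinear: "k \<le> m \<Longrightarrow> multilinear_form H k (T k)"
  unfolding T_def by (rule multilinear_fderiv[OF H diff \<theta>])

lemma T_symmetric: "k \<le> m \<Longrightarrow> symmetric_form H k (T k)"
  using sym[of k] unfolding T_def by (cases "k = 0") (auto simp: symmetric_form_def)

lemma measurable_\<delta>: "\<delta> \<in> borel_measurable M"
  unfolding \<delta>_def[abs_def] sample_mean_def using measurable_\<epsilon>
  by (intro borel_measurable_scaleR borel_measurable_const borel_measurable_sum) auto

text \<open>The plug-in value of \<open>f\<close> is absorbed as the term \<open>l = 0\<close>,
  since the derivative of order 0 ignores its argument list.\<close>

lemma estimator_eq:
  assumes \<omega>: "\<omega> \<in> space M"
  shows "estimator H f s n (\<lambda>j. x j \<omega>) =
    (\<Sum>l\<le>m. perm_avg n (\<lambda>p. fderiv H f l (\<theta> + \<delta> \<omega>) (map (\<lambda>i. y \<omega> (p i)) [1..<Suc l])) / fact l)"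
proof -
  have mean: "sample_mean n (\<lambda>j. x j \<omega>) = \<theta> + \<delta> \<omega>"
    using n x \<omega> by (simp add: sample_mean_def \<delta>_def sum.distrib scaleR_add_right sum_constant_scaleR)
  have up: "ubar_pairing n (\<lambda>j. x j \<omega>) l F = perm_avg n (\<lambda>p. F (map (\<lambda>i. y \<omega> (p i)) [1..<Suc l]))"
    if l: "l \<le> m" for l and F :: "'a form"
  proof -
    have "ubar_pairing n (\<lambda>j. x j \<omega>) l F =
      (\<Sum>js | length js = l \<and> distinct js \<and> set js \<subseteq> {1..n}. F (map (y \<omega>) js)) / ffact n l"
      unfolding ubar_pairing_def mean ffact_def
    proof (intro arg_cong2[of _ _ _ _ "(/)"] refl sum.cong arg_cong[of _ _ F] map_cong)
      fix js j assume "js \<in> {js. length js = l \<and> distinct js \<and> set js \<subseteq> {1..n}}" "j \<in> set js"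
      then have "j \<in> {1..n}" by blast
      then show "x j \<omega> - (\<theta> + \<delta> \<omega>) = y \<omega> j" using x \<omega> by (simp add: y_def)
    qed
    also have "\<dots> = perm_avg n (\<lambda>p. F (map (y \<omega>) (map p [1..<Suc l])))"
      using l m by (intro sum_distinct_lists_eq_perm_avg) simp
    finally show ?thesis by (simp only: map_map comp_def)
  qed
  have "(\<Sum>l\<le>m. perm_avg n (\<lambda>p. fderiv H f l (\<theta> + \<delta> \<omega>) (map (\<lambda>i. y \<omega> (p i)) [1..<Suc l])) / fact l) =
    (\<Sum>l\<in>insert 0 {1..m}. perm_avg n (\<lambda>p. fderiv H f l (\<theta> + \<delta> \<omega>) (map (\<lambda>i. y \<omega> (p i)) [1..<Suc l])) / fact l)"
    by (intro sum.cong) auto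
  also have "\<dots> = f (\<theta> + \<delta> \<omega>) + (\<Sum>l=1..m. perm_avg n (\<lambda>p. fderiv H f l (\<theta> + \<delta> \<omega>) (map (\<lambda>i. y \<omega> (p i)) [1..<Suc l])) / fact l)"
    by (subst sum.insert) (simp_all del: upt_Suc)
  finally show ?thesis
    unfolding estimator_def mean m(5) using up by simp
qed

lemma estimator_decomposition:
  assumes \<omega>: "\<omega> \<in> space M"
  shows "estimator H f s n (\<lambda>j. x j \<omega>) - f \<theta> =
    (\<Sum>j=1..n. T 1 [\<epsilon> j \<omega>]) / real n + (\<Sum>k=2..m. U k \<omega> / fact k) + Rem \<omega>"
proof -
  let ?w = "\<lambda>p l. map (\<lambda>i. y \<omega> (p i)) [1..<Suc l]"
  define b where "b q l = perm_avg n (\<lambda>p. T q (replicate (q - l) (\<delta> \<omega>) @ ?w p l))" for q l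
  have pol: "perm_avg n (\<lambda>p. fderiv H f l (\<theta> + \<delta> \<omega>) (?w p l)) / fact l =
    (\<Sum>i\<le>m - l. b (l + i) l / (fact i * fact l)) + perm_avg n (\<lambda>p. R \<omega> l (?w p l)) / fact l" for l
  proof -
    have "perm_avg n (\<lambda>p. fderiv H f l (\<theta> + \<delta> \<omega>) (?w p l)) =
      perm_avg n (\<lambda>p. (\<Sum>i\<le>m - l. T (l + i) (replicate i (\<delta> \<omega>) @ ?w p l) / fact i) + R \<omega> l (?w p l))"
      by (intro perm_avg_cong) (simp add: R_def)
    also have "\<dots> = (\<Sum>i\<le>m - l. b (l + i) l / fact i) + perm_avg n (\<lambda>p. R \<omega> l (?w p l))"
      unfolding perm_avg_add perm_avg_sum perm_avg_divide b_def by simp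
    finally show ?thesis by (simp add: add_divide_distrib sum_divide_distrib)
  qed
  \<comment> \<open>The weights \<open>1 / ((q - l)! l!)\<close> are the binomial weights over
    \<open>q!\<close>, so the terms of degree \<open>q\<close> reassemble
    \<open>y + \<delta>\<close>, which is the noise itself.\<close>
  have Uq: "(\<Sum>l\<le>q. b q l / (fact (q - l) * fact l)) = U q \<omega> / fact q" if q: "q \<le> m" for q
  proof -
    have "U q \<omega> = perm_avg n (\<lambda>p. T q (map (\<lambda>i. y \<omega> (p i) + \<delta> \<omega>) [1..<Suc q]))"
      by (simp add: U_def y_def)
    also have "\<dots> = (\<Sum>l\<le>q. real (q choose l) * b q l)"
      unfolding b_def using q m \<delta>_H[OF \<omega>] y_H[OF \<omega>]
      by (intro perm_avg_symmetric_binomial[OF H(1) T_multilinear T_symmetric]) auto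
    also have "\<dots> / fact q = (\<Sum>l\<le>q. b q l / (fact (q - l) * fact l))"
      unfolding sum_divide_distrib
      by (intro sum.cong refl) (simp add: binomial_fact field_simps)
    finally show ?thesis by simp
  qed
  have "estimator H f s n (\<lambda>j. x j \<omega>) = (\<Sum>l\<le>m. \<Sum>i\<le>m - l. b (l + i) l / (fact i * fact l)) + Rem \<omega>"
    unfolding estimator_eq[OF \<omega>] pol Rem_def by (simp add: sum.distrib)
  also have "(\<Sum>l\<le>m. \<Sum>i\<le>m - l. b (l + i) l / (fact i * fact l)) =
    (\<Sum>q\<le>m. \<Sum>l\<le>q. b (l + (q - l)) l / (fact (q - l) * fact l))"
    by (rule sum_le_triangle)
  also have "\<dots> = (\<Sum>q\<le>m. U q \<omega> / fact q)"
    using Uq by (intro sum.cong refl) simp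
  also have "\<dots> = (\<Sum>q\<in>insert 0 (insert 1 {2..m}). U q \<omega> / fact q)"
    using m by (intro sum.cong) auto
  also have "\<dots> = U 0 \<omega> + U 1 \<omega> + (\<Sum>q=2..m. U q \<omega> / fact q)"
    by simp
  also have "U 0 \<omega> = f \<theta>" by (simp add: U_def T_def)
  also have "U 1 \<omega> = (\<Sum>j=1..n. T 1 [\<epsilon> j \<omega>]) / real n"
    using perm_avg_first[OF n, of "\<lambda>j. T 1 [\<epsilon> j \<omega>]"] by (simp add: U_def)
  finally show ?thesis by simp
qed

lemma measurable_estimator: "(\<lambda>\<omega>. estimator H f s n (\<lambda>j. x j \<omega>)) \<in> borel_measurable M"
proof -
  have "(\<lambda>\<omega>. fderiv H f l (\<theta> + \<delta> \<omega>) (map (\<lambda>i. y \<omega> (p i)) [1..<Suc l])) \<in> borel_measurable M"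
    if l: "l \<le> m" and p: "p permutes {1..n}" for l p
  proof -
    have pi: "p i \<in> {1..n}" if "i \<in> set [1..<Suc l]" for i
      using permutes_in_image[OF p, of i] that l m by auto
    have "(\<lambda>\<omega>. fderiv H f l (\<theta> + \<delta> \<omega>) (map (\<lambda>i. (\<lambda>\<omega>. y \<omega> (p i)) \<omega>) [1..<Suc l])) \<in> borel_measurable M"
    proof (rule measurable_fderiv[OF H diff])
      show "(\<lambda>\<omega>. \<theta> + \<delta> \<omega>) \<in> borel_measurable M" using measurable_\<delta> by simp
      show "(\<lambda>\<omega>. y \<omega> (p i)) \<in> borel_measurable M" if "i \<in> set [1..<Suc l]" for i
        unfolding y_def using measurable_\<delta> measurable_\<epsilon>[OF pi[OF that]] by simp
      show "\<theta> + \<delta> \<omega> \<in> H" if "\<omega> \<in> space M" for \<omega>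
        using subspace_add[OF H(1) \<theta> \<delta>_H[OF that]] .
      show "y \<omega> (p i) \<in> H" if "i \<in> set [1..<Suc l]" "\<omega> \<in> space M" for i \<omega>
        using y_H[OF that(2) pi[OF that(1)]] .
    qed (use l m in auto)
    then show ?thesis by simp
  qed
  then have "(\<lambda>\<omega>. \<Sum>l\<le>m. perm_avg n (\<lambda>p. fderiv H f l (\<theta> + \<delta> \<omega>) (map (\<lambda>i. y \<omega> (p i)) [1..<Suc l])) / fact l)
     \<in> borel_measurable M"
    unfolding perm_avg_def
    by (intro borel_measurable_sum borel_measurable_divide borel_measurable_const) auto
  then show ?thesis using estimator_eq by (subst measurable_cong) auto
qed

definition D :: "'a \<Rightarrow> 'a form" where "D h hs = fderiv H f m (\<theta> + h) hs - T m hs"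

lemma D_multilinear: "h \<in> H \<Longrightarrow> multilinear_form H m (D h)"
  unfolding D_def[abs_def] using subspace_add[OF H(1) \<theta>]
  by (intro multilinear_form_diff multilinear_fderiv[OF H diff] T_multilinear) auto

text \<open>The constant depends on \<open>h\<close> without control; it supplies the continuity
  that the Hilbert-Schmidt inequality asks for.\<close>

lemma D_bounded:
  assumes "h \<in> H"
  obtains c where "form_le H m (D h) c"
proof -
  obtain c1 where c1: "form_le H m (fderiv H f m (\<theta> + h)) c1"
    using form_le_fderiv[OF H diff subspace_add[OF H(1) \<theta> assms]] by blast
  obtain c2 where c2: "form_le H m (T m) c2"
    unfolding T_def using form_le_fderiv[OF H diff \<theta>] by blast
  have "form_le H m (D h) (c1 + c2)"
    unfolding form_le_def D_def
  proof (intro allI impI)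
    fix hs :: "'a list" assume "length hs = m \<and> set hs \<subseteq> H"
    then show "\<bar>fderiv H f m (\<theta> + h) hs - T m hs\<bar> \<le> (c1 + c2) * prod_list (map norm hs)"
      using form_leD[OF c1, of hs] form_leD[OF c2, of hs] by (simp add: algebra_simps)
  qed
  then show ?thesis by (rule that)
qed

lemma D_0: "D 0 hs = 0"
  by (simp add: D_def T_def)

text \<open>All permutations share the same \<open>t\<close>, so one form
  \<open>D (t *\<^sub>R \<delta> \<omega>)\<close> is averaged and the centring identity can act
  inside it.\<close>

lemma perm_avg_R:
  assumes \<omega>: "\<omega> \<in> space M" and l: "l \<le> m"
  shows "\<exists>t. 0 < t \<and> t \<le> 1 \<and> perm_avg n (\<lambda>p. R \<omega> l (map (\<lambda>i. y \<omega> (p i)) [1..<Suc l])) =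
    perm_avg n (\<lambda>p. D (t *\<^sub>R \<delta> \<omega>) (replicate (m - l) (\<delta> \<omega>) @ map (\<lambda>i. y \<omega> (p i)) [1..<Suc l])) / fact (m - l)"
proof -
  let ?F = "{p. p permutes {1..n}}" and ?g = "\<lambda>p. map (\<lambda>i. y \<omega> (p i)) [1..<Suc l]"
  have g: "length (?g p) = l \<and> set (?g p) \<subseteq> H" if "p \<in> ?F" for p
  proof -
    have "p i \<in> {1..n}" if "i \<in> set [1..<Suc l]" for i
      using permutes_in_image[of p "{1..n}" i] \<open>p \<in> ?F\<close> that l m by auto
    then have "set (?g p) \<subseteq> H" using y_H[OF \<omega>] by (auto simp del: upt_Suc atLeastAtMost_iff)
    then show ?thesis by (simp del: upt_Suc)
  qed
  have av: "perm_avg n h = (\<Sum>p\<in>?F. (1 / fact n) * h p)" for h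
    by (simp add: perm_avg_def sum_divide_distrib)
  show ?thesis
    unfolding av R_def D_def T_def
    by (rule taylor_combination[where F = ?F and g = ?g and w = "\<lambda>_. 1 / fact n", OF H diff \<theta> \<delta>_H[OF \<omega>] l g])
qed

end

section \<open>The Taylor remainder\<close>

lemma prod_list_map2_eq_prod:
  fixes g :: "'a \<Rightarrow> 'a \<Rightarrow> real"
  assumes "length xs = k" "length ys = k"
  shows "(\<Prod>i<k. g (xs ! i) (ys ! i)) = prod_list (map2 g xs ys)"
  using assms by (simp add: prod.list_conv_set_nth atLeast0LessThan)

lemma prod_if_inner:
  fixes d :: "'a::real_inner"
  assumes "S \<subseteq> {1..l}"
  shows "(\<Prod>i=1..l. (if i \<in> S then u i else d) \<bullet> (if i \<in> S then v i else d)) =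
    (d \<bullet> d) ^ (l - card S) * (\<Prod>i\<in>S. u i \<bullet> v i)"
proof -
  have fS: "finite S" using assms finite_subset by auto
  have "(\<Prod>i=1..l. (if i \<in> S then u i else d) \<bullet> (if i \<in> S then v i else d)) =
     (\<Prod>i\<in>{1..l} - S. (if i \<in> S then u i else d) \<bullet> (if i \<in> S then v i else d)) *
     (\<Prod>i\<in>S. (if i \<in> S then u i else d) \<bullet> (if i \<in> S then v i else d))"
    using assms by (intro prod.subset_diff) auto
  also have "(\<Prod>i\<in>{1..l} - S. (if i \<in> S then u i else d) \<bullet> (if i \<in> S then v i else d)) = (\<Prod>i\<in>{1..l} - S. d \<bullet> d)"
    by (intro prod.cong) auto
  also have "\<dots> = (d \<bullet> d) ^ (l - card S)" using assms fS by (simp add: card_Diff_subset)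
  finally show ?thesis by simp
qed

lemma abs_divide_fact_le: "\<bar>(a::real) / fact k\<bar> \<le> \<bar>a\<bar>"
  using mult_left_mono[OF fact_ge_1, of "\<bar>a\<bar>" k] by (simp add: abs_divide divide_le_eq)

lemma divide_fact_le: "(a::real) \<le> fact k * b \<Longrightarrow> a / fact k \<le> b"
  by (simp add: divide_le_eq mult.commute)

context smooth_functional
begin

lemmas m_bounds = m(1-4)

text \<open>Centring at the mean minimises the sum of squared distances.\<close>

lemma sum_norm_y_le: "(\<Sum>j=1..n. (norm (y \<omega> j))\<^sup>2) \<le> (\<Sum>j=1..n. (norm (\<epsilon> j \<omega>))\<^sup>2)"
proof -
  have s: "(\<Sum>j=1..n. \<epsilon> j \<omega>) = real n *\<^sub>R \<delta> \<omega>" using n by (simp add: \<delta>_def sample_mean_def)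
  have "(\<Sum>j=1..n. (norm (y \<omega> j))\<^sup>2) =
    (\<Sum>j=1..n. (norm (\<epsilon> j \<omega>))\<^sup>2) - 2 * ((\<Sum>j=1..n. \<epsilon> j \<omega>) \<bullet> \<delta> \<omega>) + real n * (norm (\<delta> \<omega>))\<^sup>2"
    unfolding y_def inner_sum_left
    by (simp add: power2_norm_eq_inner inner_diff_left inner_diff_right inner_commute sum.distrib
        sum_subtractf sum_distrib_left)
  also have "\<dots> = (\<Sum>j=1..n. (norm (\<epsilon> j \<omega>))\<^sup>2) - real n * (norm (\<delta> \<omega>))\<^sup>2"
    unfolding s by (simp add: power2_norm_eq_inner)
  finally show ?thesis by simp
qed

lemma Rem_abs_le:
  "\<bar>Rem \<omega>\<bar> \<le> (\<Sum>l\<le>m. \<bar>perm_avg n (\<lambda>p. R \<omega> l (map (\<lambda>i. y \<omega> (p i)) [1..<Suc l]))\<bar> / fact l)"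
  unfolding Rem_def by (rule order_trans[OF sum_abs]) (simp add: abs_divide)

text \<open>Homogeneity fixes the exponent: the increment contributes \<open>s - m\<close>, the
  copies of \<open>\<delta>\<close> contribute \<open>m - l\<close> and the centred vectors
  \<open>l\<close>, in total \<open>s\<close>. The factorial from the elimination of lonely indices
  cancels against \<open>1 / l!\<close>, and \<open>\<kappa>\<close> compares \<open>n ^ l\<close>
  with the falling factorial.\<close>

lemma Rem_bound_spec:
  assumes \<omega>: "\<omega> \<in> space M" and C: "0 \<le> C" and a: "0 < a" and \<delta>a: "norm (\<delta> \<omega>) \<le> a"
    and holder: "\<And>h. h \<in> H \<Longrightarrow> form_le H m (D h) (C * norm h powr (s - real m))"
    and \<kappa>: "\<And>l. l \<le> m \<Longrightarrow> real n ^ l \<le> \<kappa> * ffact n l"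
    and Q: "(\<Sum>j=1..n. (norm (\<epsilon> j \<omega>))\<^sup>2) \<le> (real n * a)\<^sup>2"
  shows "\<bar>Rem \<omega>\<bar> \<le> (real m + 1) * \<kappa> * C * a powr s"
proof -
  let ?q = "sqrt (\<Sum>j=1..n. (norm (y \<omega> j))\<^sup>2)"
  have q: "?q \<le> real n * a"
    using sum_norm_y_le[of \<omega>] Q a by (intro real_le_lsqrt) (auto simp: sum_nonneg)
  have q0: "0 \<le> ?q" by (simp add: sum_nonneg)
  have each: "\<bar>perm_avg n (\<lambda>p. R \<omega> l (map (\<lambda>i. y \<omega> (p i)) [1..<Suc l]))\<bar> / fact l \<le> \<kappa> * C * a powr s"
    if l: "l \<le> m" for l
  proof -
    let ?w = "\<lambda>p. map (\<lambda>i. y \<omega> (p i)) [1..<Suc l]"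
    obtain t where t: "0 < t" "t \<le> 1" and eq: "perm_avg n (\<lambda>p. R \<omega> l (?w p)) =
      perm_avg n (\<lambda>p. D (t *\<^sub>R \<delta> \<omega>) (replicate (m - l) (\<delta> \<omega>) @ ?w p)) / fact (m - l)"
      using perm_avg_R[OF \<omega> l] by blast
    let ?h = "t *\<^sub>R \<delta> \<omega>" and ?r = "replicate (m - l) (\<delta> \<omega>)"
    have h: "?h \<in> H" using subspace_scale[OF H(1) \<delta>_H[OF \<omega>]] .
    have hn: "norm ?h \<le> a"
      using t \<delta>a mult_mono[of t 1 "norm (\<delta> \<omega>)" a] by simp
    have r: "set ?r \<subseteq> H" "length ?r + l = m" using \<delta>_H[OF \<omega>] l by auto
    have pr: "prod_list (map norm ?r) = norm (\<delta> \<omega>) ^ (m - l)" by simp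
    let ?N = "C * norm ?h powr (s - real m) * prod_list (map norm ?r)"
    let ?N' = "C * a powr (s - real m) * a ^ (m - l)"
    have N0: "0 \<le> ?N" using C by (intro mult_nonneg_nonneg) auto
    have NN: "?N \<le> ?N'"
      unfolding pr using C hn \<delta>a a m_bounds
      by (intro mult_mono mult_left_mono powr_mono2 power_mono) auto
    have ff: "0 < ffact n l" using l m_bounds by (intro ffact_pos) simp
    have "set [1..<Suc l] = {1..l}" by auto
    then have cw: "card (set [1..<Suc l]) = l" "set [1..<Suc l] \<subseteq> {1..n}"
      using l m_bounds by (simp_all del: upt_Suc)
    have "\<bar>perm_avg n (\<lambda>p. D ?h (?r @ ?w p))\<bar> \<le> fact (card (set [1..<Suc l])) * ?N * ?q ^ l / ffact n (card (set [1..<Suc l]))"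
    proof (rule perm_avg_centred_bound[OF H(1) _ _ N0 _ sum_y])
      show "multilinear_form H l (\<lambda>hs. D ?h (?r @ hs))"
        by (rule multilinear_form_append[OF D_multilinear[OF h] r])
      show "form_le H l (\<lambda>hs. D ?h (?r @ hs)) ?N"
        by (rule form_le_append[OF holder[OF h] r])
      show "\<And>j. j \<in> {1..n} \<Longrightarrow> y \<omega> j \<in> H" using y_H[OF \<omega>] .
    qed (use cw in auto)
    also have "\<dots> = fact l * ?N * ?q ^ l / ffact n l" unfolding cw(1) ..
    also have "\<dots> \<le> fact l * ?N' * (real n * a) ^ l / ffact n l"
    proof -
      have "?N * ?q ^ l \<le> ?N' * (real n * a) ^ l"
        by (rule mult_mono[OF NN power_mono[OF q q0] order_trans[OF N0 NN] zero_le_power[OF q0]])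
      then have "fact l * (?N * ?q ^ l) / ffact n l \<le> fact l * (?N' * (real n * a) ^ l) / ffact n l"
        using ff by (meson divide_right_mono mult_left_mono fact_ge_zero less_imp_le)
      then show ?thesis by (simp only: mult.assoc)
    qed
    also have "\<dots> = fact l * ?N' * a ^ l * (real n ^ l / ffact n l)" by (simp add: power_mult_distrib)
    also have "\<dots> \<le> fact l * ?N' * a ^ l * \<kappa>"
      using \<kappa>[OF l] ff C a by (intro mult_left_mono mult_nonneg_nonneg) (auto simp: field_simps)
    also have "\<dots> = fact l * (\<kappa> * C * a powr s)"
    proof -
      have "a powr (s - real m) * a ^ (m - l) * a ^ l = a powr (s - real m) * a ^ m"
        using l by (simp add: mult.assoc power_add[symmetric])
      also have "\<dots> = a powr s"
        using a by (simp add: powr_realpow[symmetric] powr_add[symmetric])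
      finally show ?thesis by (simp add: mult_ac)
    qed
    finally have b: "\<bar>perm_avg n (\<lambda>p. D ?h (?r @ ?w p))\<bar> \<le> fact l * (\<kappa> * C * a powr s)" .
    have "\<bar>perm_avg n (\<lambda>p. R \<omega> l (?w p))\<bar> \<le> \<bar>perm_avg n (\<lambda>p. D ?h (?r @ ?w p))\<bar>"
      unfolding eq by (rule abs_divide_fact_le)
    then have "\<bar>perm_avg n (\<lambda>p. R \<omega> l (?w p))\<bar> \<le> fact l * (\<kappa> * C * a powr s)" using b by linarith
    then show ?thesis by (rule divide_fact_le)
  qed
  have "\<bar>Rem \<omega>\<bar> \<le> (\<Sum>l\<le>m. \<kappa> * C * a powr s)"
    using each by (intro order_trans[OF Rem_abs_le sum_mono]) auto
  then show ?thesis by (simp add: algebra_simps)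
qed

text \<open>Squared Hilbert-Schmidt norm of the permutation average of the tensors formed from the
  \<open>\<epsilon> (p i)\<close> with \<open>i\<close> in \<open>S\<close>.\<close>

definition G :: "nat set \<Rightarrow> 'w \<Rightarrow> real" where
  "G S \<omega> = perm_avg n (\<lambda>p. perm_avg n (\<lambda>p'. \<Prod>i\<in>S. \<epsilon> (p i) \<omega> \<bullet> \<epsilon> (p' i) \<omega>))"

text \<open>Cauchy-Schwarz with weights \<open>1 / fact n\<close> produces a double permutation
  average; the slots filled with a constant vector contribute powers and factor out of it.\<close>

lemma perm_avg_HS:
  assumes \<omega>: "\<omega> \<in> space M" and F: "multilinear_form H (r + l) F" "form_le H (r + l) F c"
    and N: "hs_norm B (r + l) F \<le> ereal N" and l: "l \<le> n" and S: "S \<subseteq> {1..l}" and d: "d \<in> H" "d' \<in> H"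
  shows "(perm_avg n (\<lambda>p. F (replicate r d' @ map (\<lambda>i. if i \<in> S then \<epsilon> (p i) \<omega> else d) [1..<Suc l])))\<^sup>2 \<le>
    N\<^sup>2 * ((d' \<bullet> d') ^ r * ((d \<bullet> d) ^ (l - card S) * G S \<omega>))"
proof -
  let ?h = "\<lambda>p. replicate r d' @ map (\<lambda>i. if i \<in> S then \<epsilon> (p i) \<omega> else d) [1..<Suc l]"
  let ?P = "{p. p permutes {1..n}}"
  have h: "length (?h p) = r + l \<and> set (?h p) \<subseteq> H" if "p \<in> ?P" for p
  proof -
    have "p i \<in> {1..n}" if "i \<in> S" for i
      using permutes_in_image[of p "{1..n}" i] \<open>p \<in> ?P\<close> that S l by auto
    then have "\<epsilon> (p i) \<omega> \<in> H" if "i \<in> S" for i using that \<epsilon>_H[OF _ \<omega>] by blast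
    then show ?thesis using d by (auto simp del: upt_Suc)
  qed
  have "(perm_avg n (\<lambda>p. F (?h p)))\<^sup>2 = (\<Sum>p\<in>?P. (1 / fact n) * F (?h p))\<^sup>2"
    by (simp add: perm_avg_def sum_divide_distrib)
  also have "\<dots> \<le> N\<^sup>2 * (\<Sum>p\<in>?P. \<Sum>p'\<in>?P. (1 / fact n) * (1 / fact n) * (\<Prod>i<r + l. (?h p ! i) \<bullet> (?h p' ! i)))"
    by (rule hs_norm_Cauchy_Schwarz[OF H(1) B F N h])
  also have "(\<lambda>p p'. \<Prod>i<r + l. (?h p ! i) \<bullet> (?h p' ! i)) =
     (\<lambda>p p'. (d' \<bullet> d') ^ r * ((d \<bullet> d) ^ (l - card S) * (\<Prod>i\<in>S. \<epsilon> (p i) \<omega> \<bullet> \<epsilon> (p' i) \<omega>)))"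
  proof (intro ext)
    fix p p' :: "nat \<Rightarrow> nat"
    let ?v = "\<lambda>p i. if i \<in> S then \<epsilon> (p i) \<omega> else d"
    have "(\<Prod>i<r + l. (?h p ! i) \<bullet> (?h p' ! i)) = prod_list (map2 (\<bullet>) (?h p) (?h p'))"
      by (rule prod_list_map2_eq_prod) simp_all
    also have "map2 (\<bullet>) (?h p) (?h p') = replicate r (d' \<bullet> d') @ map (\<lambda>i. ?v p i \<bullet> ?v p' i) [1..<Suc l]"
      by (simp add: zip_map_map map_zip_map2 zip_same_conv_map comp_def del: upt_Suc)
    also have "prod_list \<dots> = (d' \<bullet> d') ^ r * (\<Prod>i\<in>set [1..<Suc l]. ?v p i \<bullet> ?v p' i)"
      using prod.distinct_set_conv_list[of "[1..<Suc l]" "\<lambda>i. ?v p i \<bullet> ?v p' i"]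
      by (simp only: prod_list.append prod_list_replicate distinct_upt)
    also have "set [1..<Suc l] = {1..l}" by auto
    also have "(\<Prod>i=1..l. ?v p i \<bullet> ?v p' i) = (d \<bullet> d) ^ (l - card S) * (\<Prod>i\<in>S. \<epsilon> (p i) \<omega> \<bullet> \<epsilon> (p' i) \<omega>)"
      by (rule prod_if_inner[OF S])
    finally show "(\<Prod>i<r + l. (?h p ! i) \<bullet> (?h p' ! i)) =
       (d' \<bullet> d') ^ r * ((d \<bullet> d) ^ (l - card S) * (\<Prod>i\<in>S. \<epsilon> (p i) \<omega> \<bullet> \<epsilon> (p' i) \<omega>))" .
  qed
  also have "(\<Sum>p\<in>?P. \<Sum>p'\<in>?P. (1 / fact n) * (1 / fact n) *
      ((d' \<bullet> d') ^ r * ((d \<bullet> d) ^ (l - card S) * (\<Prod>i\<in>S. \<epsilon> (p i) \<omega> \<bullet> \<epsilon> (p' i) \<omega>)))) =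
     (d' \<bullet> d') ^ r * ((d \<bullet> d) ^ (l - card S) * G S \<omega>)"
    unfolding G_def perm_avg_def
    by (simp add: sum_distrib_left sum_divide_distrib mult_ac)
  finally show ?thesis .
qed

lemma G_nonneg:
  assumes \<omega>: "\<omega> \<in> space M" and S: "S \<subseteq> {1..n}"
  shows "0 \<le> G S \<omega>"
proof -
  have z: "0 \<in> H" using subspace_0[OF H(1)] .
  obtain \<pi> where \<pi>: "\<pi> permutes {1..n}" "\<pi> ` {1..card S} = S" using ex_permutes_image_eq[OF S] by blast
  have cS: "card S \<le> n" using card_mono[OF _ S] by simp
  have "G S \<omega> = G {1..card S} \<omega>"
  proof -
    have re: "(\<Prod>i\<in>S. g i) = (\<Prod>i\<in>{1..card S}. g (\<pi> i))" for g :: "nat \<Rightarrow> real"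
      using prod.reindex[OF permutes_inj_on[OF \<pi>(1), of "{1..card S}"], of g] unfolding \<pi>(2) by (simp add: comp_def)
    have "G S \<omega> = perm_avg n (\<lambda>p. perm_avg n (\<lambda>p'. \<Prod>i\<in>{1..card S}. \<epsilon> ((p \<circ> \<pi>) i) \<omega> \<bullet> \<epsilon> ((p' \<circ> \<pi>) i) \<omega>))"
      unfolding G_def re comp_def ..
    also have "\<dots> = perm_avg n (\<lambda>p. perm_avg n (\<lambda>p'. \<Prod>i\<in>{1..card S}. \<epsilon> ((p \<circ> \<pi>) i) \<omega> \<bullet> \<epsilon> (p' i) \<omega>))"
      by (rule perm_avg_cong) (rule perm_avg_compose[OF \<pi>(1)])
    also have "\<dots> = G {1..card S} \<omega>"
      unfolding G_def
      by (rule perm_avg_compose[OF \<pi>(1), of "\<lambda>p. perm_avg n (\<lambda>p'. \<Prod>i\<in>{1..card S}. \<epsilon> (p i) \<omega> \<bullet> \<epsilon> (p' i) \<omega>)"])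
    finally show ?thesis .
  qed
  also have "0 \<le> \<dots>"
  proof -
    have "hs_norm B (0 + card S) (\<lambda>_. 0) \<le> ereal 1"
      unfolding hs_norm_def by (intro SUP_least) (simp add: L2_set_def)
    then have "(perm_avg n (\<lambda>p. 0))\<^sup>2 \<le> 1\<^sup>2 * (((0::'a) \<bullet> 0) ^ 0 * (((0::'a) \<bullet> 0) ^ (card S - card {1..card S}) * G {1..card S} \<omega>))"
      using z cS by (intro perm_avg_HS[OF \<omega>, where c = 0 and d = "0 :: 'a" and d' = "0 :: 'a" and F = "\<lambda>_. 0"])
        (auto simp: multilinear_form_def form_le_def)
    then show ?thesis by simp
  qed
  finally show ?thesis .
qed

text \<open>The set \<open>S\<close> marks the slots that keep the noise after \<open>y j\<close> is
  expanded. The other \<open>m - card S\<close> slots hold \<open>\<delta>\<close> up to sign and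
  scale like powers of \<open>a\<close>, whence the exponent \<open>s - card S\<close>;
  \<open>sqrt (G S \<omega>)\<close> is left for the expectation.\<close>

lemma Rem_bound_HS:
  assumes \<omega>: "\<omega> \<in> space M" and C: "0 \<le> C" and a: "0 < a" and \<delta>a: "norm (\<delta> \<omega>) \<le> a"
    and holder: "\<And>h. h \<in> H \<Longrightarrow> hs_norm B m (D h) \<le> ereal (C * norm h powr (s - real m))"
  shows "\<bar>Rem \<omega>\<bar> \<le> (\<Sum>l\<le>m. \<Sum>S\<in>Pow {1..l}. C * a powr (s - real (card S)) * sqrt (G S \<omega>) / (fact l * fact (m - l)))"
proof -
  have each: "\<bar>perm_avg n (\<lambda>p. R \<omega> l (map (\<lambda>i. y \<omega> (p i)) [1..<Suc l]))\<bar> / fact l \<le>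
      (\<Sum>S\<in>Pow {1..l}. C * a powr (s - real (card S)) * sqrt (G S \<omega>) / (fact l * fact (m - l)))"
    if l: "l \<le> m" for l
  proof -
    let ?w = "\<lambda>p. map (\<lambda>i. y \<omega> (p i)) [1..<Suc l]"
    obtain t where t: "0 < t" "t \<le> 1" and eq: "perm_avg n (\<lambda>p. R \<omega> l (?w p)) =
      perm_avg n (\<lambda>p. D (t *\<^sub>R \<delta> \<omega>) (replicate (m - l) (\<delta> \<omega>) @ ?w p)) / fact (m - l)"
      using perm_avg_R[OF \<omega> l] by blast
    let ?h = "t *\<^sub>R \<delta> \<omega>" and ?r = "replicate (m - l) (\<delta> \<omega>)"
    have h: "?h \<in> H" using subspace_scale[OF H(1) \<delta>_H[OF \<omega>]] .
    have hn: "norm ?h \<le> a"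
      using t \<delta>a mult_mono[of t 1 "norm (\<delta> \<omega>)" a] by simp
    have nd: "- \<delta> \<omega> \<in> H" using subspace_neg[OF H(1) \<delta>_H[OF \<omega>]] .
    obtain c where c: "form_le H m (D ?h) c" using D_bounded[OF h] by blast
    have ml: "m - l + l = m" using l by simp
    let ?A = "\<lambda>S. perm_avg n (\<lambda>p. D ?h (?r @ map (\<lambda>i. if i \<in> S then \<epsilon> (p i) \<omega> else - \<delta> \<omega>) [1..<Suc l]))"
    have A: "\<bar>?A S\<bar> \<le> C * a powr (s - real (card S)) * sqrt (G S \<omega>)" if S: "S \<subseteq> {1..l}" for S
    proof -
      let ?N = "C * norm ?h powr (s - real m)"
      have cS: "card S \<le> l" using card_mono[OF _ S] by simp
      have G0: "0 \<le> G S \<omega>" using S l m_bounds by (intro G_nonneg[OF \<omega>]) auto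
      have "(?A S)\<^sup>2 \<le> ?N\<^sup>2 * ((\<delta> \<omega> \<bullet> \<delta> \<omega>) ^ (m - l) * ((- \<delta> \<omega> \<bullet> - \<delta> \<omega>) ^ (l - card S) * G S \<omega>))"
      proof (rule perm_avg_HS[OF \<omega> _ _ _ _ S nd \<delta>_H[OF \<omega>]])
        show "multilinear_form H (m - l + l) (D ?h)" unfolding ml by (rule D_multilinear[OF h])
        show "form_le H (m - l + l) (D ?h) c" unfolding ml by (rule c)
        show "hs_norm B (m - l + l) (D ?h) \<le> ereal ?N" unfolding ml by (rule holder[OF h])
        show "l \<le> n" using l m_bounds by simp
      qed
      also have "\<dots> = (?N * norm (\<delta> \<omega>) ^ (m - card S))\<^sup>2 * G S \<omega>"
      proof -
        have "(\<delta> \<omega> \<bullet> \<delta> \<omega>) ^ (m - l) * (\<delta> \<omega> \<bullet> \<delta> \<omega>) ^ (l - card S) = (norm (\<delta> \<omega>) ^ (m - card S))\<^sup>2"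
        proof -
          have "(m - l) + (l - card S) = m - card S" using l cS by simp
          then have "(\<delta> \<omega> \<bullet> \<delta> \<omega>) ^ (m - l) * (\<delta> \<omega> \<bullet> \<delta> \<omega>) ^ (l - card S) = (\<delta> \<omega> \<bullet> \<delta> \<omega>) ^ (m - card S)"
            by (simp only: power_add[symmetric])
          also have "\<dots> = (norm (\<delta> \<omega>) ^ (m - card S))\<^sup>2"
            by (simp add: power2_norm_eq_inner[symmetric] power_mult[symmetric] mult.commute)
          finally show ?thesis .
        qed
        then show ?thesis by (simp add: power_mult_distrib mult.assoc)
      qed
      also have "\<dots> \<le> (C * a powr (s - real m) * a ^ (m - card S))\<^sup>2 * G S \<omega>"
        using C hn \<delta>a a m_bounds G0
        by (intro mult_right_mono power_mono mult_mono mult_left_mono powr_mono2) auto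
      also have "C * a powr (s - real m) * a ^ (m - card S) = C * a powr (s - real (card S))"
        using a l cS by (simp add: powr_realpow[symmetric] powr_add[symmetric] of_nat_diff mult.assoc)
      finally have "sqrt ((?A S)\<^sup>2) \<le> sqrt ((C * a powr (s - real (card S)))\<^sup>2 * G S \<omega>)"
        by (rule real_sqrt_le_mono)
      then show ?thesis using C by (simp add: real_sqrt_mult)
    qed
    have "perm_avg n (\<lambda>p. D ?h (?r @ ?w p)) = perm_avg n (\<lambda>p. \<Sum>S\<in>Pow {1..l}.
        D ?h (?r @ map (\<lambda>i. if i \<in> S then \<epsilon> (p i) \<omega> else - \<delta> \<omega>) [1..<Suc l]))"
    proof (rule perm_avg_cong)
      fix p assume p: "p permutes {1..n}"
      have ep: "\<epsilon> (p i) \<omega> \<in> H" if "i \<in> set [1..<Suc l]" for i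
        using permutes_in_image[OF p, of i] that l m_bounds by (intro \<epsilon>_H \<omega>) auto
      have "D ?h (?r @ map (\<lambda>i. \<epsilon> (p i) \<omega> + - \<delta> \<omega>) [1..<Suc l]) =
        (\<Sum>S\<in>Pow (set [1..<Suc l]). D ?h (?r @ map (\<lambda>i. if i \<in> S then \<epsilon> (p i) \<omega> else - \<delta> \<omega>) [1..<Suc l]))"
        using l \<delta>_H[OF \<omega>] ep nd by (intro multilinear_expand_add[OF H(1) D_multilinear[OF h]]) auto
      moreover have "set [1..<Suc l] = {1..l}" by auto
      ultimately show "D ?h (?r @ ?w p) = (\<Sum>S\<in>Pow {1..l}.
        D ?h (?r @ map (\<lambda>i. if i \<in> S then \<epsilon> (p i) \<omega> else - \<delta> \<omega>) [1..<Suc l]))"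
        by (simp add: y_def del: upt_Suc)
    qed
    also have "\<dots> = (\<Sum>S\<in>Pow {1..l}. ?A S)" by (rule perm_avg_sum)
    finally have "\<bar>perm_avg n (\<lambda>p. D ?h (?r @ ?w p))\<bar> \<le>
       (\<Sum>S\<in>Pow {1..l}. C * a powr (s - real (card S)) * sqrt (G S \<omega>))"
      using A by (auto intro!: order_trans[OF sum_abs] sum_mono)
    then have "\<bar>perm_avg n (\<lambda>p. D ?h (?r @ ?w p))\<bar> / (fact l * fact (m - l)) \<le>
       (\<Sum>S\<in>Pow {1..l}. C * a powr (s - real (card S)) * sqrt (G S \<omega>)) / (fact l * fact (m - l))"
      by (intro divide_right_mono) auto
    then show ?thesis
      unfolding eq by (simp add: abs_divide sum_divide_distrib mult.commute)
  qed
  show ?thesis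
    using each by (intro order_trans[OF Rem_abs_le sum_mono]) auto
qed

end

section \<open>Tail bounds\<close>

text \<open>Majorises the contributions of all orders at once, uniformly in \<open>m\<close>; this
  is what permits \<open>s\<close> to grow with \<open>n\<close>.\<close>

definition sqrt_fact_series :: "real \<Rightarrow> real" where
  "sqrt_fact_series a = (\<Sum>k. a ^ k / sqrt (fact k))"

lemma summable_sqrt_fact_series:
  assumes "0 \<le> a"
  shows "summable (\<lambda>k. a ^ k / sqrt (fact k))"
proof (rule summable_comparison_test)
  show "\<exists>N. \<forall>k\<ge>N. norm (a ^ k / sqrt (fact k)) \<le> ((4 * a\<^sup>2) ^ k / fact k + (1/4) ^ k) / 2"
  proof (intro exI allI impI)
    fix k :: nat
    \<comment> \<open>The inequality between a product and squares, with a factor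
      \<open>2 ^ k\<close> inserted and removed, splits the term into an exponential and a geometric
      series.\<close>
    have "2 * ((2 * a) ^ k / sqrt (fact k)) * (1/2) ^ k \<le> ((2 * a) ^ k / sqrt (fact k))\<^sup>2 + ((1/2) ^ k)\<^sup>2"
      by (rule sum_squares_bound)
    moreover have "((2 * a) ^ k / sqrt (fact k))\<^sup>2 = (4 * a\<^sup>2) ^ k / fact k"
    proof -
      have "((2 * a) ^ k)\<^sup>2 = ((2 * a)\<^sup>2) ^ k" by (simp only: power_mult[symmetric] mult.commute)
      also have "(2 * a)\<^sup>2 = 4 * a\<^sup>2" by (simp add: power_mult_distrib)
      finally show ?thesis by (simp add: power_divide)
    qed
    moreover have "((1/2) ^ k)\<^sup>2 = (1/4 :: real) ^ k"
      by (simp add: power_divide power2_eq_square flip: power_mult_distrib)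
    moreover have "2 * ((2 * a) ^ k / sqrt (fact k)) * (1/2) ^ k = 2 * (a ^ k / sqrt (fact k))"
      by (simp add: power_mult_distrib power_divide)
    ultimately have "2 * (a ^ k / sqrt (fact k)) \<le> (4 * a\<^sup>2) ^ k / fact k + (1/4) ^ k"
      by (simp only:)
    moreover have n: "norm (a ^ k / sqrt (fact k)) = a ^ k / sqrt (fact k)" using assms by simp
    moreover have "2 * u \<le> v \<Longrightarrow> u \<le> v / 2" for u v :: real by simp
    ultimately show "norm (a ^ k / sqrt (fact k)) \<le> ((4 * a\<^sup>2) ^ k / fact k + (1/4) ^ k) / 2"
      unfolding n by blast
  qed
  have "summable (\<lambda>k. (4 * a\<^sup>2) ^ k / fact k)"
    using summable_exp[of "4 * a\<^sup>2"] by (simp add: divide_inverse mult.commute)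
  then show "summable (\<lambda>k. ((4 * a\<^sup>2) ^ k / fact k + (1/4) ^ k) / 2)"
    by (intro summable_divide summable_add summable_geometric) auto
qed

lemma sqrt_fact_series_ge:
  assumes "0 \<le> a" "finite I"
  shows "(\<Sum>k\<in>I. a ^ k / sqrt (fact k)) \<le> sqrt_fact_series a"
  unfolding sqrt_fact_series_def
  using assms by (intro sum_le_suminf summable_sqrt_fact_series) auto

text \<open>The factor \<open>2 ^ l\<close> counts the subsets of \<open>{1..l}\<close>. Since
  \<open>1 / (l! (m - l)!)\<close> is a binomial coefficient over \<open>m!\<close> and
  \<open>sqrt (l!) \<le> sqrt (m!)\<close>, the binomial theorem for \<open>2 + 1\<close>
  applies.\<close>

lemma sum_sqrt_fact_le:
  "(\<Sum>l\<le>m. 2 ^ l * sqrt (fact l) / (fact l * fact (m - l))) \<le> 3 ^ m / sqrt (fact m)"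
proof -
  have "(\<Sum>l\<le>m. 2 ^ l * sqrt (fact l) / (fact l * fact (m - l))) \<le>
    (\<Sum>l\<le>m. real (m choose l) * 2 ^ l * 1 ^ (m - l) / sqrt (fact m))"
  proof (rule sum_mono)
    fix l assume l: "l \<in> {..m}"
    have "sqrt (fact l) / (fact l * fact (m - l)) = real (m choose l) * sqrt (fact l) / fact m"
      using l by (simp add: binomial_fact)
    also have "\<dots> \<le> real (m choose l) * sqrt (fact m) / fact m"
      using l by (intro divide_right_mono mult_left_mono real_sqrt_le_mono fact_mono) auto
    also have "\<dots> = real (m choose l) / sqrt (fact m)"
      by (simp add: field_simps flip: real_sqrt_mult)
    finally have "2 ^ l * (sqrt (fact l) / (fact l * fact (m - l))) \<le> 2 ^ l * (real (m choose l) / sqrt (fact m))"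
      by (intro mult_left_mono) auto
    then show "2 ^ l * sqrt (fact l) / (fact l * fact (m - l)) \<le> real (m choose l) * 2 ^ l * 1 ^ (m - l) / sqrt (fact m)"
      by (simp add: mult_ac)
  qed
  also have "\<dots> = (2 + 1) ^ m / sqrt (fact m)"
    unfolding binomial_ring by (simp add: sum_divide_distrib)
  finally show ?thesis by simp
qed

lemma (in prob_space) expectation_abs_le_sqrt:
  fixes X :: "'a \<Rightarrow> real"
  assumes X: "X \<in> borel_measurable M" "integrable M (\<lambda>\<omega>. (X \<omega>)\<^sup>2)"
  shows "integrable M (\<lambda>\<omega>. \<bar>X \<omega>\<bar>)" "expectation (\<lambda>\<omega>. \<bar>X \<omega>\<bar>) \<le> sqrt (expectation (\<lambda>\<omega>. (X \<omega>)\<^sup>2))"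
proof -
  have "integrable M X" using square_integrable_imp_integrable[OF X] .
  then show i: "integrable M (\<lambda>\<omega>. \<bar>X \<omega>\<bar>)" by simp
  have "0 \<le> variance (\<lambda>\<omega>. \<bar>X \<omega>\<bar>)" by simp
  also have "\<dots> = expectation (\<lambda>\<omega>. (X \<omega>)\<^sup>2) - (expectation (\<lambda>\<omega>. \<bar>X \<omega>\<bar>))\<^sup>2"
    using variance_eq[OF i] X(2) by simp
  finally show "expectation (\<lambda>\<omega>. \<bar>X \<omega>\<bar>) \<le> sqrt (expectation (\<lambda>\<omega>. (X \<omega>)\<^sup>2))"
    by (intro real_le_rsqrt) simp
qed

text \<open>Here \<open>v\<close> stands for the squared noise level and \<open>t\<close> for that
  level times the effective rank, so that \<open>t / v\<close> is the effective rank.\<close>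

definition rate :: "nat \<Rightarrow> real \<Rightarrow> real \<Rightarrow> real \<Rightarrow> real" where
  "rate n s v t = max (v * sqrt (t / v) / real n) ((t / real n) powr (s / 2))"

context smooth_functional
begin

lemma T_bounded:
  assumes "k \<le> m"
  obtains c where "form_le H k (T k) c" "0 \<le> c"
  using form_le_fderiv[OF H diff \<theta> assms] unfolding T_def by metis

lemma U_measurable: "k \<le> m \<Longrightarrow> U k \<in> borel_measurable M"
proof -
  assume k: "k \<le> m"
  obtain c where c: "form_le H k (T k) c" "0 \<le> c" using T_bounded[OF k] .
  have s: "set [1..<Suc k] \<subseteq> {1..n}" using k m_bounds by auto
  have "(\<lambda>\<omega>. T k (map (\<lambda>i. \<epsilon> (p i) \<omega>) [1..<Suc k])) \<in> borel_measurable M" if "p permutes {1..n}" for p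
    by (rule form_permuted_measurable[OF T_multilinear[OF k] c distinct_upt _ s that]) simp
  then show ?thesis unfolding U_def[abs_def] perm_avg_def by (intro borel_measurable_divide borel_measurable_sum) auto
qed

lemma T1_measurable: "j \<in> {1..n} \<Longrightarrow> (\<lambda>\<omega>. T 1 [\<epsilon> j \<omega>]) \<in> borel_measurable M"
proof -
  assume j: "j \<in> {1..n}"
  have k: "1 \<le> m" using m_bounds by simp
  obtain c where c: "form_le H 1 (T 1) c" "0 \<le> c" using T_bounded[OF k] .
  have "(\<lambda>\<omega>. T 1 (map (\<lambda>i. \<epsilon> j \<omega>) [0::nat])) \<in> borel_measurable M"
    using measurable_\<epsilon>[OF j] \<epsilon>_H[OF j]
    by (intro measurable_form[OF H(1) B T_multilinear[OF k] c(1)]) auto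
  then show ?thesis by simp
qed

definition Z :: "'w \<Rightarrow> real" where
  "Z \<omega> = estimator H f s n (\<lambda>j. x j \<omega>) - f \<theta> - (\<Sum>j=1..n. T 1 [\<epsilon> j \<omega>]) / real n"

lemma Z_measurable: "Z \<in> borel_measurable M"
  unfolding Z_def[abs_def]
  using measurable_estimator T1_measurable by (intro borel_measurable_diff borel_measurable_divide borel_measurable_sum) auto

lemma Z_eq: "\<omega> \<in> space M \<Longrightarrow> Z \<omega> = (\<Sum>k=2..m. U k \<omega> / fact k) + Rem \<omega>"
  unfolding Z_def using estimator_decomposition by simp

text \<open>One sample size with explicit constants: \<open>tr\<close> majorises the averaged second
  moment of the noise norms, \<open>\<kappa>\<close> compares powers with falling factorials, and
  \<open>K\<close> is the Markov level. The weight \<open>d\<close> is 1 under the spectral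
  hypothesis and the square root of the theorem's constant under the other.\<close>

context
  fixes \<sigma>2 tr \<kappa> K C\<^sub>0 d :: real
  assumes s2: "\<And>a. a \<in> H \<Longrightarrow> (\<Sum>j=1..n. expectation (\<lambda>\<omega>. (a \<bullet> \<epsilon> j \<omega>)\<^sup>2)) \<le> real n * \<sigma>2 * (norm a)\<^sup>2"
    and \<sigma>2: "0 < \<sigma>2" "\<sigma>2 \<le> tr" and tr: "(\<Sum>j=1..n. e2 j) \<le> real n * tr"
    and \<kappa>: "\<And>l. l \<le> m \<Longrightarrow> real n ^ l \<le> \<kappa> * ffact n l"
    and K: "1 \<le> K" and C\<^sub>0: "0 \<le> C\<^sub>0" and d: "0 < d"
    and T_le: "\<And>k. 2 \<le> k \<Longrightarrow> k \<le> m \<Longrightarrow> form_le H k (T k) (C\<^sub>0 * d ^ k)"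
begin

abbreviation mx :: real where "mx \<equiv> rate n s \<sigma>2 tr"

lemma \<tau>_pos: "0 < tr / real n"
  using n \<sigma>2 by simp

lemma K\<tau>_pos: "0 < K * (tr / real n)"
  by (rule mult_pos_pos[OF _ \<tau>_pos]) (use K in simp)

lemma \<kappa>_ge_1: "1 \<le> \<kappa>"
  using \<kappa>[of 0] by simp

lemma mx_nonneg: "0 \<le> mx"
  using powr_ge_zero[of "tr / real n" "s / 2"] unfolding rate_def by linarith

text \<open>If \<open>tr / n \<le> 1\<close>, degree 2 dominates, and its value is the square of the
  first entry of the maximum. Otherwise \<open>\<sigma>2 \<le> tr\<close> turns the term into at
  most \<open>(tr / n) ^ k\<close>, and \<open>k \<le> m < s\<close> gives the square of the second
  entry.\<close>

lemma variance_term_le: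
  assumes k: "2 \<le> k" "k \<le> m"
  shows "\<sigma>2 * tr ^ (k - 1) / real n ^ k \<le> mx\<^sup>2"
proof -
  let ?\<tau> = "tr / real n"
  have tr0: "0 < tr" and n0: "0 < real n" using \<sigma>2 n by auto
  show ?thesis
  proof (cases "?\<tau> \<le> 1")
    case True
    have "tr ^ (k - 1) = tr * tr ^ (k - 2)" "real n ^ k = (real n)\<^sup>2 * real n ^ (k - 2)"
      using k by (auto simp flip: power_Suc power_add intro!: arg_cong2[of _ _ _ _ "(^)"])
    then have "\<sigma>2 * tr ^ (k - 1) / real n ^ k = (\<sigma>2 * tr / (real n)\<^sup>2) * ?\<tau> ^ (k - 2)"
      by (simp add: power_divide)
    also have "\<dots> \<le> (\<sigma>2 * tr / (real n)\<^sup>2) * 1"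
      using True tr0 \<sigma>2 n0 by (intro mult_left_mono power_le_one) auto
    also have "\<dots> = (\<sigma>2 * sqrt (tr / \<sigma>2) / real n)\<^sup>2"
    proof -
      have "(sqrt (tr / \<sigma>2))\<^sup>2 = tr / \<sigma>2" using \<sigma>2 tr0 by simp
      then have e: "(\<sigma>2 * sqrt (tr / \<sigma>2) / real n)\<^sup>2 = \<sigma>2\<^sup>2 * (tr / \<sigma>2) / (real n)\<^sup>2"
        by (simp only: power_divide power_mult_distrib)
      show ?thesis unfolding mult_1_right e using \<sigma>2 by (simp add: power2_eq_square)
    qed
    also have "\<dots> \<le> mx\<^sup>2"
      using \<sigma>2 tr0 n0 unfolding rate_def by (intro power_mono) auto
    finally show ?thesis .
  next
    case False
    have "tr ^ k = tr * tr ^ (k - 1)" using k by (simp flip: power_Suc)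
    then have "\<sigma>2 * tr ^ (k - 1) / real n ^ k = (\<sigma>2 / tr) * ?\<tau> ^ k"
      using tr0 by (simp add: power_divide)
    also have "\<dots> \<le> 1 * ?\<tau> ^ k"
      using \<sigma>2 tr0 \<tau>_pos by (intro mult_right_mono) auto
    also have "\<dots> = ?\<tau> powr real k" using \<tau>_pos by (simp add: powr_realpow)
    also have "\<dots> \<le> ?\<tau> powr s" using False k m_bounds by (intro powr_mono) auto
    also have "\<dots> = (?\<tau> powr (s / 2))\<^sup>2"
      using \<tau>_pos by (simp add: power2_eq_square flip: powr_add)
    also have "\<dots> \<le> mx\<^sup>2" unfolding rate_def by (intro power_mono) auto
    finally show ?thesis .
  qed
qed

text \<open>The second moment carries \<open>fact k\<close>; after the square root and the division
  by the \<open>fact k\<close> of the expansion, \<open>1 / sqrt (fact k)\<close> survives.\<close>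

lemma U_abs:
  assumes k: "2 \<le> k" "k \<le> m"
  shows "integrable M (\<lambda>\<omega>. \<bar>U k \<omega>\<bar>)"
    and "expectation (\<lambda>\<omega>. \<bar>U k \<omega>\<bar>) / fact k \<le> \<kappa> * C\<^sub>0 * mx * (d ^ k / sqrt (fact k))"
proof -
  let ?N = "C\<^sub>0 * d ^ k" and ?xs = "[1..<Suc k]"
  obtain k' where k': "k = Suc k'" using k by (cases k) auto
  have kn: "k \<le> n" using k m_bounds by simp
  have s: "set ?xs \<subseteq> {1..n}" using kn by auto
  have N0: "0 \<le> ?N" using C\<^sub>0 d by simp
  have TT: "multilinear_form H k (T k)" "form_le H k (T k) ?N" using T_multilinear T_le k by auto
  have ff: "0 < ffact n k" using kn by (rule ffact_pos)
  have n0: "0 < real n" and tr0: "0 < tr" using n \<sigma>2 by auto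
  note sm = perm_avg_form_second_moment[OF TT N0 distinct_upt _ s]
  have int: "integrable M (\<lambda>\<omega>. (U k \<omega>)\<^sup>2)" using sm(1) by (simp add: U_def)
  note ab = expectation_abs_le_sqrt[OF U_measurable[OF k(2)] int]
  show "integrable M (\<lambda>\<omega>. \<bar>U k \<omega>\<bar>)" by (rule ab(1))
  have "expectation (\<lambda>\<omega>. (U k \<omega>)\<^sup>2) \<le>
      fact k / ffact n k * perm_avg n (\<lambda>p. expectation (\<lambda>\<omega>. (T k (map (\<lambda>i. \<epsilon> (p i) \<omega>) ?xs))\<^sup>2))"
    using sm(2) by (simp add: U_def)
  also have "\<dots> \<le> fact k / ffact n k * (real n * \<sigma>2 * ?N\<^sup>2 * (\<Sum>j=1..n. e2 j) ^ (k - 1) / ffact n k)"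
  proof (rule mult_left_mono)
    have "perm_avg n (\<lambda>p. expectation (\<lambda>\<omega>. (T k (map (\<lambda>i. \<epsilon> (p i) \<omega>) [1..<Suc (Suc k')]))\<^sup>2)) \<le>
       real n * \<sigma>2 * ?N\<^sup>2 * (\<Sum>j=1..n. e2 j) ^ k' / ffact n (Suc k')"
      using TT N0 kn s2 \<sigma>2 unfolding k' by (intro perm_avg_expectation_form_sq) auto
    then show "perm_avg n (\<lambda>p. expectation (\<lambda>\<omega>. (T k (map (\<lambda>i. \<epsilon> (p i) \<omega>) ?xs))\<^sup>2)) \<le>
       real n * \<sigma>2 * ?N\<^sup>2 * (\<Sum>j=1..n. e2 j) ^ (k - 1) / ffact n k"
      unfolding k' by simp
  qed (use ff in auto)
  also have "\<dots> \<le> fact k / ffact n k * (real n * \<sigma>2 * ?N\<^sup>2 * (real n * tr) ^ (k - 1) / ffact n k)"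
    using ff \<sigma>2 tr e2_nonneg
    by (intro mult_left_mono divide_right_mono power_mono sum_nonneg) auto
  also have "\<dots> = fact k * ?N\<^sup>2 * (real n ^ k / ffact n k)\<^sup>2 * (\<sigma>2 * tr ^ (k - 1) / real n ^ k)"
    using n0 ff unfolding k' by (simp add: field_simps power2_eq_square power_mult_distrib)
  also have "\<dots> \<le> fact k * ?N\<^sup>2 * \<kappa>\<^sup>2 * mx\<^sup>2"
  proof (intro mult_mono mult_left_mono power_mono variance_term_le k)
    show "real n ^ k / ffact n k \<le> \<kappa>" using \<kappa>[OF k(2)] ff by (simp add: field_simps)
  qed (use ff \<sigma>2 tr0 C\<^sub>0 d in auto)
  finally have "sqrt (expectation (\<lambda>\<omega>. (U k \<omega>)\<^sup>2)) \<le> sqrt (fact k * (?N * \<kappa> * mx)\<^sup>2)"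
    by (intro real_sqrt_le_mono) (simp add: power_mult_distrib mult_ac)
  also have "\<dots> = sqrt (fact k) * (?N * \<kappa> * mx)"
    using N0 \<kappa>_ge_1 mx_nonneg by (simp add: real_sqrt_mult)
  finally have "expectation (\<lambda>\<omega>. \<bar>U k \<omega>\<bar>) \<le> sqrt (fact k) * (?N * \<kappa> * mx)" using ab(2) by linarith
  then have "expectation (\<lambda>\<omega>. \<bar>U k \<omega>\<bar>) / fact k \<le> sqrt (fact k) * (?N * \<kappa> * mx) / fact k"
    by (intro divide_right_mono) auto
  also have "\<dots> = \<kappa> * C\<^sub>0 * mx * (d ^ k / sqrt (fact k))"
    by (simp add: field_simps flip: real_sqrt_mult)
  finally show "expectation (\<lambda>\<omega>. \<bar>U k \<omega>\<bar>) / fact k \<le> \<kappa> * C\<^sub>0 * mx * (d ^ k / sqrt (fact k))" .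
qed

definition W1 :: "'w \<Rightarrow> real" where "W1 \<omega> = (\<Sum>k=2..m. \<bar>U k \<omega>\<bar> / fact k)"

lemma W1_integrable: "integrable M W1"
  unfolding W1_def[abs_def] using U_abs(1) by (intro Bochner_Integration.integrable_sum) auto

lemma W1_expectation: "expectation W1 \<le> \<kappa> * sqrt_fact_series d * (C\<^sub>0 * mx)"
proof -
  have "expectation W1 = (\<Sum>k=2..m. expectation (\<lambda>\<omega>. \<bar>U k \<omega>\<bar>) / fact k)"
    unfolding W1_def[abs_def] using U_abs(1) by (subst Bochner_Integration.integral_sum) auto
  also have "\<dots> \<le> (\<Sum>k=2..m. \<kappa> * C\<^sub>0 * mx * (d ^ k / sqrt (fact k)))"
    using U_abs(2) by (intro sum_mono) auto
  also have "\<dots> = \<kappa> * C\<^sub>0 * mx * (\<Sum>k=2..m. d ^ k / sqrt (fact k))" by (simp add: sum_distrib_left)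
  also have "\<dots> \<le> \<kappa> * C\<^sub>0 * mx * sqrt_fact_series d"
    using \<kappa>_ge_1 C\<^sub>0 mx_nonneg d by (intro mult_left_mono sqrt_fact_series_ge mult_nonneg_nonneg) auto
  finally show ?thesis by (simp add: mult_ac)
qed

lemma Z_le: "\<omega> \<in> space M \<Longrightarrow> \<bar>Z \<omega>\<bar> \<le> W1 \<omega> + \<bar>Rem \<omega>\<bar>"
proof -
  assume "\<omega> \<in> space M"
  have "\<bar>\<Sum>k=2..m. U k \<omega> / fact k\<bar> \<le> W1 \<omega>"
    unfolding W1_def by (rule order_trans[OF sum_abs]) (simp add: abs_divide)
  then show ?thesis using Z_eq[OF \<open>\<omega> \<in> space M\<close>] by linarith
qed

lemma prob_\<delta>_large: "prob {\<omega>\<in>space M. (norm (\<delta> \<omega>))\<^sup>2 \<ge> K * (tr / real n)} \<le> 1 / K"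
proof -
  have n0: "0 < real n" using n by simp
  note c = K\<tau>_pos
  have "prob {\<omega>\<in>space M. (norm (\<delta> \<omega>))\<^sup>2 \<ge> K * (tr / real n)} \<le>
      expectation (\<lambda>\<omega>. (norm (\<delta> \<omega>))\<^sup>2) / (K * (tr / real n))"
    using sample_mean_second_moment(1) c
    by (intro integral_Markov_inequality_measure[where A = "space M"]) (auto simp: \<delta>_def)
  also have "expectation (\<lambda>\<omega>. (norm (\<delta> \<omega>))\<^sup>2) = (\<Sum>j=1..n. e2 j) / (real n)\<^sup>2"
    using sample_mean_second_moment(2) by (simp add: \<delta>_def)
  also have "(\<Sum>j=1..n. e2 j) / (real n)\<^sup>2 / (K * (tr / real n)) \<le> (real n * tr) / (real n)\<^sup>2 / (K * (tr / real n))"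
    using tr c by (intro divide_right_mono) auto
  also have "\<dots> = 1 / K" using n0 K \<sigma>2 by (simp add: power2_eq_square)
  finally show ?thesis .
qed

text \<open>The threshold is \<open>K\<close> times \<open>n * tr\<close>, written as the square of
  \<open>n\<close> times the radius to which \<open>\<delta>\<close> is confined.\<close>

lemma prob_Q_large:
  "prob {\<omega>\<in>space M. (\<Sum>j=1..n. (norm (\<epsilon> j \<omega>))\<^sup>2) \<ge> (real n)\<^sup>2 * (K * (tr / real n))} \<le> 1 / K"
proof -
  have n0: "0 < real n" using n by simp
  have c: "0 < (real n)\<^sup>2 * (K * (tr / real n))" by (rule mult_pos_pos[OF _ K\<tau>_pos]) (use n0 in simp)
  have int: "integrable M (\<lambda>\<omega>. \<Sum>j=1..n. (norm (\<epsilon> j \<omega>))\<^sup>2)"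
    using integrable_\<epsilon>2 by (intro Bochner_Integration.integrable_sum) auto
  have "prob {\<omega>\<in>space M. (\<Sum>j=1..n. (norm (\<epsilon> j \<omega>))\<^sup>2) \<ge> (real n)\<^sup>2 * (K * (tr / real n))} \<le>
      expectation (\<lambda>\<omega>. \<Sum>j=1..n. (norm (\<epsilon> j \<omega>))\<^sup>2) / ((real n)\<^sup>2 * (K * (tr / real n)))"
    using int c by (intro integral_Markov_inequality_measure[where A = "space M"]) (auto intro!: sum_nonneg)
  also have "expectation (\<lambda>\<omega>. \<Sum>j=1..n. (norm (\<epsilon> j \<omega>))\<^sup>2) = (\<Sum>j=1..n. e2 j)"
    unfolding e2_def using integrable_\<epsilon>2 by (intro Bochner_Integration.integral_sum) auto
  also have "(\<Sum>j=1..n. e2 j) / ((real n)\<^sup>2 * (K * (tr / real n))) \<le> (real n * tr) / ((real n)\<^sup>2 * (K * (tr / real n)))"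
    using tr c by (intro divide_right_mono) auto
  also have "\<dots> = 1 / K" using n0 K \<sigma>2 by (simp add: power2_eq_square)
  finally show ?thesis .
qed

lemma radius:
  defines "a \<equiv> sqrt (K * (tr / real n))"
  shows "0 < a" "a\<^sup>2 = K * (tr / real n)" "a powr s = K powr (s / 2) * (tr / real n) powr (s / 2)"
proof -
  show a0: "0 < a" unfolding a_def using K\<tau>_pos by (simp only: real_sqrt_gt_0_iff)
  show "a\<^sup>2 = K * (tr / real n)" unfolding a_def by (rule real_sqrt_pow2[OF less_imp_le[OF K\<tau>_pos]])
  have "a powr s = (K * (tr / real n)) powr (s / 2)"
    unfolding a_def powr_half_sqrt[OF less_imp_le[OF K\<tau>_pos], symmetric] powr_powr by simp
  also have "\<dots> = K powr (s / 2) * (tr / real n) powr (s / 2)"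
    by (rule powr_mult)
  finally show "a powr s = K powr (s / 2) * (tr / real n) powr (s / 2)" .
qed

text \<open>Where \<open>\<delta>\<close> or the sum of squares is large, the remainder is given up;
  elsewhere it is below a constant, which together with \<open>W1\<close> forms an integrable
  majorant. The format of majorant plus exceptional event lets both hypotheses share one limit
  argument.\<close>

lemma tail_spec:
  assumes holder: "\<And>h. h \<in> H \<Longrightarrow> form_le H m (D h) (C\<^sub>0 * norm h powr (s - real m))"
  shows "\<exists>W. integrable M W \<and> (\<forall>\<omega>\<in>space M. 0 \<le> W \<omega>) \<and>
    expectation W \<le> (\<kappa> * sqrt_fact_series d + (real m + 1) * \<kappa> * K powr (s / 2)) * (C\<^sub>0 * mx) \<and>
    prob {\<omega>\<in>space M. \<bar>Z \<omega>\<bar> > W \<omega>} \<le> 2 / K"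
proof -
  let ?a = "sqrt (K * (tr / real n))"
  let ?c = "(real m + 1) * \<kappa> * C\<^sub>0 * ?a powr s"
  let ?A = "{\<omega>\<in>space M. (norm (\<delta> \<omega>))\<^sup>2 \<ge> K * (tr / real n)}"
  let ?B = "{\<omega>\<in>space M. (\<Sum>j=1..n. (norm (\<epsilon> j \<omega>))\<^sup>2) \<ge> (real n)\<^sup>2 * (K * (tr / real n))}"
  have c0: "0 \<le> ?c" using \<kappa>_ge_1 C\<^sub>0 by (intro mult_nonneg_nonneg) auto
  have cle: "?c \<le> (real m + 1) * \<kappa> * K powr (s / 2) * (C\<^sub>0 * mx)"
  proof -
    have "?c = (real m + 1) * \<kappa> * K powr (s / 2) * (C\<^sub>0 * (tr / real n) powr (s / 2))"
      unfolding radius(3) by (simp add: mult_ac)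
    also have "\<dots> \<le> (real m + 1) * \<kappa> * K powr (s / 2) * (C\<^sub>0 * mx)"
      using \<kappa>_ge_1 C\<^sub>0 unfolding rate_def by (intro mult_left_mono mult_nonneg_nonneg) auto
    finally show ?thesis .
  qed
  have mA: "?A \<in> sets M" using measurable_\<delta> by measurable
  have mB: "?B \<in> sets M"
  proof -
    have "(\<lambda>\<omega>. \<Sum>j=1..n. (norm (\<epsilon> j \<omega>))\<^sup>2) \<in> borel_measurable M"
      using measurable_\<epsilon> by (intro borel_measurable_sum) auto
    then show ?thesis by measurable
  qed
  have sub: "{\<omega>\<in>space M. \<bar>Z \<omega>\<bar> > W1 \<omega> + ?c} \<subseteq> ?A \<union> ?B"
  proof
    fix \<omega> assume w: "\<omega> \<in> {\<omega>\<in>space M. \<bar>Z \<omega>\<bar> > W1 \<omega> + ?c}"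
    show "\<omega> \<in> ?A \<union> ?B"
    proof (rule ccontr)
      assume "\<omega> \<notin> ?A \<union> ?B"
      then have "(norm (\<delta> \<omega>))\<^sup>2 < K * (tr / real n)"
        "(\<Sum>j=1..n. (norm (\<epsilon> j \<omega>))\<^sup>2) < (real n)\<^sup>2 * (K * (tr / real n))" using w by auto
      then have d1: "norm (\<delta> \<omega>) \<le> ?a" and d2: "(\<Sum>j=1..n. (norm (\<epsilon> j \<omega>))\<^sup>2) \<le> (real n * ?a)\<^sup>2"
        unfolding power_mult_distrib radius(2) by (blast intro: real_le_rsqrt less_imp_le)+
      have "\<bar>Rem \<omega>\<bar> \<le> ?c"
        using w by (intro Rem_bound_spec[OF _ C\<^sub>0 radius(1) d1 holder \<kappa> d2]) auto
      then show False using w Z_le[of \<omega>] by auto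
    qed
  qed
  have "prob {\<omega>\<in>space M. \<bar>Z \<omega>\<bar> > W1 \<omega> + ?c} \<le> prob (?A \<union> ?B)"
    using sub mA mB by (intro finite_measure_mono) auto
  also have "\<dots> \<le> prob ?A + prob ?B" using mA mB by (rule measure_Un_le)
  also have "\<dots> \<le> 2 / K" using prob_\<delta>_large prob_Q_large by simp
  finally have P: "prob {\<omega>\<in>space M. \<bar>Z \<omega>\<bar> > W1 \<omega> + ?c} \<le> 2 / K" .
  have E: "expectation (\<lambda>\<omega>. W1 \<omega> + ?c) = expectation W1 + ?c"
    using W1_integrable by (simp add: prob_space)
  have W0: "0 \<le> W1 \<omega> + ?c" for \<omega>
    using c0 unfolding W1_def by (intro add_nonneg_nonneg sum_nonneg) auto
  have EW: "expectation (\<lambda>\<omega>. W1 \<omega> + ?c) \<le>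
      (\<kappa> * sqrt_fact_series d + (real m + 1) * \<kappa> * K powr (s / 2)) * (C\<^sub>0 * mx)"
    by (rule order_trans[OF eq_refl[OF E] order_trans[OF add_mono[OF W1_expectation cle]
          eq_refl[OF distrib_right[symmetric]]]])
  have "integrable M (\<lambda>\<omega>. W1 \<omega> + ?c)" using W1_integrable by simp
  then show ?thesis using P W0 EW by blast
qed

text \<open>Jensen's inequality passes from the mean of \<open>G S\<close> to that of its square
  root, which leaves the factor \<open>sqrt (fact (card S))\<close>.\<close>

lemma sqrt_G:
  assumes S: "S \<subseteq> {1..m}"
  shows "integrable M (\<lambda>\<omega>. sqrt (G S \<omega>))"
    and "expectation (\<lambda>\<omega>. sqrt (G S \<omega>)) \<le> sqrt (fact (card S)) * \<kappa> * sqrt (tr / real n) ^ card S"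
proof -
  let ?k = "card S"
  have Sn: "S \<subseteq> {1..n}" using S m_bounds by auto
  have km: "?k \<le> m" using card_mono[OF _ S] by simp
  have ff: "0 < ffact n ?k" using km m_bounds by (intro ffact_pos) simp
  have n0: "0 < real n" and tr0: "0 < tr" using n \<sigma>2 by auto
  have gi: "integrable M (G S)" and ge: "expectation (G S) \<le> fact ?k * (\<Sum>j=1..n. e2 j) ^ ?k / (ffact n ?k)\<^sup>2"
    using gram_expectation[OF Sn] unfolding G_def[abs_def] by auto
  have m': "(\<lambda>\<omega>. sqrt (G S \<omega>)) \<in> borel_measurable M" using gi by simp
  have sq: "(sqrt (G S \<omega>))\<^sup>2 = G S \<omega>" if "\<omega> \<in> space M" for \<omega>
    using G_nonneg[OF that Sn] by simp
  have i2: "integrable M (\<lambda>\<omega>. (sqrt (G S \<omega>))\<^sup>2)"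
    using gi sq by (subst Bochner_Integration.integrable_cong[where g = "G S"]) auto
  have ab: "\<bar>sqrt (G S \<omega>)\<bar> = sqrt (G S \<omega>)" if "\<omega> \<in> space M" for \<omega>
    using G_nonneg[OF that Sn] by simp
  note ex = expectation_abs_le_sqrt[OF m' i2]
  show "integrable M (\<lambda>\<omega>. sqrt (G S \<omega>))" using square_integrable_imp_integrable[OF m' i2] .
  have "expectation (\<lambda>\<omega>. sqrt (G S \<omega>)) = expectation (\<lambda>\<omega>. \<bar>sqrt (G S \<omega>)\<bar>)"
    using ab by (intro Bochner_Integration.integral_cong) auto
  also have "\<dots> \<le> sqrt (expectation (\<lambda>\<omega>. (sqrt (G S \<omega>))\<^sup>2))" by (rule ex(2))
  also have "expectation (\<lambda>\<omega>. (sqrt (G S \<omega>))\<^sup>2) = expectation (G S)"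
    using sq by (intro Bochner_Integration.integral_cong) auto
  also have "sqrt (expectation (G S)) \<le> sqrt (fact ?k * (\<kappa> * sqrt (tr / real n) ^ ?k)\<^sup>2)"
  proof (rule real_sqrt_le_mono)
    have "expectation (G S) \<le> fact ?k * (real n * tr) ^ ?k / (ffact n ?k)\<^sup>2"
      using tr e2_nonneg
      by (intro order_trans[OF ge] divide_right_mono mult_left_mono power_mono sum_nonneg) auto
    also have "\<dots> = fact ?k * ((real n ^ ?k / ffact n ?k)\<^sup>2 * (tr / real n) ^ ?k)"
      using n0 ff by (simp add: field_simps power2_eq_square power_mult_distrib)
    also have "\<dots> \<le> fact ?k * (\<kappa>\<^sup>2 * (tr / real n) ^ ?k)"
    proof (intro mult_left_mono mult_right_mono power_mono)
      show "real n ^ ?k / ffact n ?k \<le> \<kappa>" using \<kappa>[OF km] ff by (simp add: field_simps)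
    qed (use ff n0 tr0 in auto)
    also have "(tr / real n) ^ ?k = (sqrt (tr / real n) ^ ?k)\<^sup>2"
    proof -
      have "(sqrt (tr / real n) ^ ?k)\<^sup>2 = ((sqrt (tr / real n))\<^sup>2) ^ ?k"
        by (simp only: power_mult[symmetric] mult.commute)
      then show ?thesis using \<tau>_pos by simp
    qed
    finally show "expectation (G S) \<le> fact ?k * (\<kappa> * sqrt (tr / real n) ^ ?k)\<^sup>2"
      by (simp add: power_mult_distrib)
  qed
  also have "\<dots> = sqrt (fact ?k) * \<kappa> * sqrt (tr / real n) ^ ?k"
    using \<kappa>_ge_1 \<tau>_pos n0 tr0 by (simp add: real_sqrt_mult)
  finally show "expectation (\<lambda>\<omega>. sqrt (G S \<omega>)) \<le> sqrt (fact (card S)) * \<kappa> * sqrt (tr / real n) ^ card S" .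
qed

text \<open>Only \<open>\<delta>\<close> has to be confined here: the noise averages enter through
  their expectations and belong to the majorant \<open>W2\<close>.\<close>

lemma tail_HS:
  assumes holder: "\<And>h. h \<in> H \<Longrightarrow> hs_norm B m (D h) \<le> ereal (C\<^sub>0 * d ^ m * norm h powr (s - real m))"
  shows "\<exists>W. integrable M W \<and> (\<forall>\<omega>\<in>space M. 0 \<le> W \<omega>) \<and>
    expectation W \<le> (\<kappa> * sqrt_fact_series d + \<kappa> * sqrt K * sqrt_fact_series (3 * d * sqrt K)) * (C\<^sub>0 * mx) \<and>
    prob {\<omega>\<in>space M. \<bar>Z \<omega>\<bar> > W \<omega>} \<le> 2 / K"
proof -
  let ?a = "sqrt (K * (tr / real n))" and ?\<tau> = "tr / real n"
  let ?C = "C\<^sub>0 * d ^ m"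
  let ?A = "{\<omega>\<in>space M. (norm (\<delta> \<omega>))\<^sup>2 \<ge> K * (tr / real n)}"
  let ?t = "\<lambda>l S \<omega>. ?C * ?a powr (s - real (card S)) * sqrt (G S \<omega>) / (fact l * fact (m - l))"
  define W2 where "W2 \<omega> = (\<Sum>l\<le>m. \<Sum>S\<in>Pow {1..l}. ?t l S \<omega>)" for \<omega>
  have C0: "0 \<le> ?C" using C\<^sub>0 d by simp
  have SS: "S \<subseteq> {1..m}" if "l \<le> m" "S \<in> Pow {1..l}" for l S using that by force
  have int: "integrable M (?t l S)" if "l \<le> m" "S \<in> Pow {1..l}" for l S
    using sqrt_G(1)[OF SS[OF that]] by auto
  have W2i: "integrable M W2"
    unfolding W2_def[abs_def] using int by (intro Bochner_Integration.integrable_sum) auto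
  have E1: "expectation (?t l S) \<le> ?C * \<kappa> * sqrt K ^ (m + 1) * ?\<tau> powr (s / 2) * (sqrt (fact l) / (fact l * fact (m - l)))"
    if l: "l \<le> m" and S: "S \<in> Pow {1..l}" for l S
  proof -
    let ?k = "card S"
    have kl: "?k \<le> l" using card_mono[of "{1..l}" S] S by simp
    \<comment> \<open>\<open>s \<le> m + 1\<close> lets the power of \<open>sqrt K\<close> be
      majorised by one that does not depend on \<open>S\<close>.\<close>
    have sk: "0 \<le> s - real ?k" "s - real ?k \<le> real (m + 1)" using kl l m_bounds by auto
    have "?a powr (s - real ?k) * sqrt ?\<tau> ^ ?k = sqrt K powr (s - real ?k) * ?\<tau> powr (s / 2)"
    proof -
      have "?a = sqrt K * sqrt ?\<tau>" by (rule real_sqrt_mult)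
      then have "?a powr (s - real ?k) = sqrt K powr (s - real ?k) * sqrt ?\<tau> powr (s - real ?k)"
        using K \<tau>_pos by (simp add: powr_mult)
      moreover have "sqrt ?\<tau> powr (s - real ?k) * sqrt ?\<tau> ^ ?k = sqrt ?\<tau> powr s"
      proof -
        have "0 < sqrt ?\<tau>" using \<tau>_pos by simp
        then show ?thesis by (simp only: powr_realpow[symmetric] powr_add[symmetric]) simp
      qed
      moreover have "sqrt ?\<tau> powr s = ?\<tau> powr (s / 2)"
        using \<tau>_pos by (simp add: powr_half_sqrt[symmetric] powr_powr)
      ultimately show ?thesis by (simp only: mult.assoc)
    qed
    moreover have "sqrt K powr (s - real ?k) \<le> sqrt K ^ (m + 1)"
    proof -
      have "sqrt K powr (s - real ?k) \<le> sqrt K powr real (m + 1)" using K sk by (intro powr_mono) auto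
      also have "\<dots> = sqrt K ^ (m + 1)" using K by (intro powr_realpow) auto
      finally show ?thesis .
    qed
    ultimately have ak: "?a powr (s - real ?k) * sqrt ?\<tau> ^ ?k \<le> sqrt K ^ (m + 1) * ?\<tau> powr (s / 2)"
      by (simp add: mult_right_mono)
    have "expectation (?t l S) = ?C * ?a powr (s - real ?k) * expectation (\<lambda>\<omega>. sqrt (G S \<omega>)) / (fact l * fact (m - l))"
      by simp
    also have "\<dots> \<le> ?C * ?a powr (s - real ?k) * (sqrt (fact ?k) * \<kappa> * sqrt ?\<tau> ^ ?k) / (fact l * fact (m - l))"
      using C\<^sub>0 d by (intro divide_right_mono mult_left_mono sqrt_G(2)[OF SS[OF l S]] mult_nonneg_nonneg) auto
    also have "\<dots> = ?C * \<kappa> * (?a powr (s - real ?k) * sqrt ?\<tau> ^ ?k) * (sqrt (fact ?k) / (fact l * fact (m - l)))"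
      by (simp add: mult_ac)
    also have "\<dots> \<le> ?C * \<kappa> * (sqrt K ^ (m + 1) * ?\<tau> powr (s / 2)) * (sqrt (fact l) / (fact l * fact (m - l)))"
    proof (rule mult_mono)
      show "?C * \<kappa> * (?a powr (s - real ?k) * sqrt ?\<tau> ^ ?k) \<le> ?C * \<kappa> * (sqrt K ^ (m + 1) * ?\<tau> powr (s / 2))"
        by (rule mult_left_mono[OF ak]) (use C0 \<kappa>_ge_1 in auto)
      show "sqrt (fact ?k) / (fact l * fact (m - l)) \<le> sqrt (fact l) / (fact l * fact (m - l))"
        using kl by (intro divide_right_mono real_sqrt_le_mono fact_mono) auto
      show "0 \<le> ?C * \<kappa> * (sqrt K ^ (m + 1) * ?\<tau> powr (s / 2))"
        using C\<^sub>0 d \<kappa>_ge_1 K by (intro mult_nonneg_nonneg) auto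
    qed auto
    finally show ?thesis by (simp add: mult_ac)
  qed
  let ?P = "?C * \<kappa> * sqrt K ^ (m + 1) * ?\<tau> powr (s / 2)"
  have P0: "0 \<le> ?P" using C\<^sub>0 d \<kappa>_ge_1 K by (intro mult_nonneg_nonneg) auto
  have W2e: "expectation W2 \<le> \<kappa> * sqrt K * sqrt_fact_series (3 * d * sqrt K) * (C\<^sub>0 * mx)"
  proof -
    have "expectation W2 = (\<Sum>l\<le>m. \<Sum>S\<in>Pow {1..l}. expectation (?t l S))"
    proof -
      have "expectation W2 = (\<Sum>l\<le>m. expectation (\<lambda>\<omega>. \<Sum>S\<in>Pow {1..l}. ?t l S \<omega>))"
        unfolding W2_def[abs_def]
        by (rule Bochner_Integration.integral_sum) (rule Bochner_Integration.integrable_sum, rule int, auto)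
      also have "\<dots> = (\<Sum>l\<le>m. \<Sum>S\<in>Pow {1..l}. expectation (?t l S))"
        by (intro sum.cong refl Bochner_Integration.integral_sum int) auto
      finally show ?thesis .
    qed
    also have "\<dots> \<le> (\<Sum>l\<le>m. \<Sum>S\<in>Pow {1..l}. ?P * (sqrt (fact l) / (fact l * fact (m - l))))"
      using E1 by (intro sum_mono) auto
    also have "\<dots> = ?P * (\<Sum>l\<le>m. 2 ^ l * sqrt (fact l) / (fact l * fact (m - l)))"
      by (simp add: card_Pow sum_distrib_left mult_ac)
    also have "\<dots> \<le> ?P * (3 ^ m / sqrt (fact m))"
      by (intro mult_left_mono sum_sqrt_fact_le P0)
    \<comment> \<open>The powers \<open>3 ^ m\<close>, \<open>d ^ m\<close> and
      \<open>sqrt K ^ m\<close> over \<open>sqrt (fact m)\<close> form a single term of the series,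
      hence are bounded uniformly in \<open>m\<close>.\<close>
    also have "\<dots> = C\<^sub>0 * \<kappa> * sqrt K * ?\<tau> powr (s / 2) * ((3 * d * sqrt K) ^ m / sqrt (fact m))"
      by (simp add: power_mult_distrib mult_ac)
    also have "\<dots> \<le> C\<^sub>0 * \<kappa> * sqrt K * mx * sqrt_fact_series (3 * d * sqrt K)"
    proof (rule mult_mono)
      show "C\<^sub>0 * \<kappa> * sqrt K * ?\<tau> powr (s / 2) \<le> C\<^sub>0 * \<kappa> * sqrt K * mx"
        using C\<^sub>0 \<kappa>_ge_1 K unfolding rate_def by (intro mult_left_mono mult_nonneg_nonneg) auto
      show "(3 * d * sqrt K) ^ m / sqrt (fact m) \<le> sqrt_fact_series (3 * d * sqrt K)"
        using sqrt_fact_series_ge[of "3 * d * sqrt K" "{m}"] d K by simp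
      show "0 \<le> C\<^sub>0 * \<kappa> * sqrt K * mx" using C\<^sub>0 \<kappa>_ge_1 K mx_nonneg by (intro mult_nonneg_nonneg) auto
    qed (use d K in auto)
    finally show ?thesis by (simp add: mult_ac)
  qed
  have mA: "?A \<in> sets M" using measurable_\<delta> by measurable
  have sub: "{\<omega>\<in>space M. \<bar>Z \<omega>\<bar> > W1 \<omega> + W2 \<omega>} \<subseteq> ?A"
  proof
    fix \<omega> assume w: "\<omega> \<in> {\<omega>\<in>space M. \<bar>Z \<omega>\<bar> > W1 \<omega> + W2 \<omega>}"
    show "\<omega> \<in> ?A"
    proof (rule ccontr)
      assume "\<omega> \<notin> ?A"
      then have "(norm (\<delta> \<omega>))\<^sup>2 < K * (tr / real n)" using w by auto
      then have d1: "norm (\<delta> \<omega>) \<le> ?a" by (simp add: real_le_rsqrt)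
      have "\<bar>Rem \<omega>\<bar> \<le> W2 \<omega>"
        unfolding W2_def using w by (intro Rem_bound_HS[OF _ C0 radius(1) d1 holder]) auto
      then show False using w Z_le[of \<omega>] by auto
    qed
  qed
  have "prob {\<omega>\<in>space M. \<bar>Z \<omega>\<bar> > W1 \<omega> + W2 \<omega>} \<le> prob ?A"
    using sub mA by (intro finite_measure_mono) auto
  also have "\<dots> \<le> 1 / K" by (rule prob_\<delta>_large)
  also have "\<dots> \<le> 2 / K" using K by (intro divide_right_mono) auto
  finally have P: "prob {\<omega>\<in>space M. \<bar>Z \<omega>\<bar> > W1 \<omega> + W2 \<omega>} \<le> 2 / K" .
  have E: "expectation (\<lambda>\<omega>. W1 \<omega> + W2 \<omega>) = expectation W1 + expectation W2"
    using W1_integrable W2i by simp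
  have W0: "0 \<le> W1 \<omega> + W2 \<omega>" if w: "\<omega> \<in> space M" for \<omega>
  proof (rule add_nonneg_nonneg)
    show "0 \<le> W1 \<omega>" unfolding W1_def by (intro sum_nonneg) auto
    have "0 \<le> G S \<omega>" if "l \<le> m" "S \<in> Pow {1..l}" for l S
      using SS[OF that] m_bounds by (intro G_nonneg[OF w]) auto
    then show "0 \<le> W2 \<omega>" unfolding W2_def
      using C\<^sub>0 d by (intro sum_nonneg divide_nonneg_nonneg mult_nonneg_nonneg) auto
  qed
  have EW: "expectation (\<lambda>\<omega>. W1 \<omega> + W2 \<omega>) \<le>
      (\<kappa> * sqrt_fact_series d + \<kappa> * sqrt K * sqrt_fact_series (3 * d * sqrt K)) * (C\<^sub>0 * mx)"
    by (rule order_trans[OF eq_refl[OF E] order_trans[OF add_mono[OF W1_expectation W2e]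
          eq_refl[OF distrib_right[symmetric]]]])
  have "integrable M (\<lambda>\<omega>. W1 \<omega> + W2 \<omega>)" using W1_integrable W2i by simp
  then show ?thesis using P W0 EW by blast
qed

end

end

section \<open>Covariance and effective rank\<close>

lemma Bessel_inequality:
  fixes F :: "'a::real_inner set"
  assumes F: "finite F" and on: "\<And>u v. u \<in> F \<Longrightarrow> v \<in> F \<Longrightarrow> u \<bullet> v = (if u = v then 1 else 0)"
  shows "(\<Sum>e\<in>F. (z \<bullet> e)\<^sup>2) \<le> (norm z)\<^sup>2"
proof -
  let ?P = "\<Sum>e\<in>F. (z \<bullet> e) *\<^sub>R e"
  have zP: "z \<bullet> ?P = (\<Sum>e\<in>F. (z \<bullet> e)\<^sup>2)" by (simp add: inner_sum_right power2_eq_square)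
  have "?P \<bullet> ?P = (\<Sum>u\<in>F. \<Sum>v\<in>F. (z \<bullet> u) * ((z \<bullet> v) * (u \<bullet> v)))"
    by (simp add: inner_sum_left inner_sum_right sum_distrib_left inner_commute mult_ac)
  also have "\<dots> = (\<Sum>u\<in>F. \<Sum>v\<in>F. if v = u then (z \<bullet> u)\<^sup>2 else 0)"
    using on by (intro sum.cong refl) (auto simp: power2_eq_square)
  also have "\<dots> = (\<Sum>e\<in>F. (z \<bullet> e)\<^sup>2)" using F by simp
  finally have "(norm (z - ?P))\<^sup>2 = (norm z)\<^sup>2 - (\<Sum>e\<in>F. (z \<bullet> e)\<^sup>2)"
    using zP by (simp add: power2_norm_eq_inner inner_diff_left inner_diff_right inner_commute)
  then show ?thesis using zero_le_power2[of "norm (z - ?P)"] by linarith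
qed

context hilbert_noise
begin

lemma integrable_inner_product:
  assumes j: "j \<in> {1..n}"
  shows "integrable M (\<lambda>\<omega>. (\<epsilon> j \<omega> \<bullet> a) * (\<epsilon> j \<omega> \<bullet> b))"
    and "\<bar>expectation (\<lambda>\<omega>. (\<epsilon> j \<omega> \<bullet> a) * (\<epsilon> j \<omega> \<bullet> b))\<bar> \<le> e2 j * norm a * norm b"
proof -
  have b: "\<bar>(\<epsilon> j \<omega> \<bullet> a) * (\<epsilon> j \<omega> \<bullet> b)\<bar> \<le> (norm (\<epsilon> j \<omega>))\<^sup>2 * (norm a * norm b)" for \<omega>
    using mult_mono[OF Cauchy_Schwarz_ineq2[of "\<epsilon> j \<omega>" a] Cauchy_Schwarz_ineq2[of "\<epsilon> j \<omega>" b]]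
    by (simp add: abs_mult power2_eq_square mult_ac)
  have ib: "integrable M (\<lambda>\<omega>. (norm (\<epsilon> j \<omega>))\<^sup>2 * (norm a * norm b))" using integrable_\<epsilon>2[OF j] by simp
  show i: "integrable M (\<lambda>\<omega>. (\<epsilon> j \<omega> \<bullet> a) * (\<epsilon> j \<omega> \<bullet> b))"
  proof (rule Bochner_Integration.integrable_bound[OF ib])
    show "(\<lambda>\<omega>. (\<epsilon> j \<omega> \<bullet> a) * (\<epsilon> j \<omega> \<bullet> b)) \<in> borel_measurable M" using measurable_\<epsilon>[OF j] by simp
    have "norm ((\<epsilon> j \<omega> \<bullet> a) * (\<epsilon> j \<omega> \<bullet> b)) \<le> norm ((norm (\<epsilon> j \<omega>))\<^sup>2 * (norm a * norm b))" for \<omega>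
      using b[of \<omega>] by simp
    then show "AE \<omega> in M. norm ((\<epsilon> j \<omega> \<bullet> a) * (\<epsilon> j \<omega> \<bullet> b)) \<le> norm ((norm (\<epsilon> j \<omega>))\<^sup>2 * (norm a * norm b))" by simp
  qed
  have "\<bar>expectation (\<lambda>\<omega>. (\<epsilon> j \<omega> \<bullet> a) * (\<epsilon> j \<omega> \<bullet> b))\<bar> \<le> expectation (\<lambda>\<omega>. \<bar>(\<epsilon> j \<omega> \<bullet> a) * (\<epsilon> j \<omega> \<bullet> b)\<bar>)"
    by (rule integral_abs_bound)
  also have "\<dots> \<le> expectation (\<lambda>\<omega>. (norm (\<epsilon> j \<omega>))\<^sup>2 * (norm a * norm b))"
    using b i ib by (intro integral_mono) auto
  finally show "\<bar>expectation (\<lambda>\<omega>. (\<epsilon> j \<omega> \<bullet> a) * (\<epsilon> j \<omega> \<bullet> b))\<bar> \<le> e2 j * norm a * norm b"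
    by (simp add: e2_def mult.assoc)
qed

lemma cov_form_eq:
  "cov_form M n \<epsilon> [a, b] = (\<Sum>j=1..n. expectation (\<lambda>\<omega>. (\<epsilon> j \<omega> \<bullet> a) * (\<epsilon> j \<omega> \<bullet> b))) / real n"
proof -
  have "cov_form M n \<epsilon> [a, b] = expectation (\<lambda>\<omega>. (1 / real n) * (\<Sum>j=1..n. (\<epsilon> j \<omega> \<bullet> a) * (\<epsilon> j \<omega> \<bullet> b)))"
    by (simp add: cov_form_def tensor_form_def)
  also have "\<dots> = (1 / real n) * expectation (\<lambda>\<omega>. \<Sum>j=1..n. (\<epsilon> j \<omega> \<bullet> a) * (\<epsilon> j \<omega> \<bullet> b))"
    by (rule integral_mult_right_zero)
  also have "expectation (\<lambda>\<omega>. \<Sum>j=1..n. (\<epsilon> j \<omega> \<bullet> a) * (\<epsilon> j \<omega> \<bullet> b)) =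
      (\<Sum>j=1..n. expectation (\<lambda>\<omega>. (\<epsilon> j \<omega> \<bullet> a) * (\<epsilon> j \<omega> \<bullet> b)))"
    by (intro Bochner_Integration.integral_sum integrable_inner_product(1))
  finally show ?thesis by simp
qed

lemma cov_form_abs_le: "\<bar>cov_form M n \<epsilon> [a, b]\<bar> \<le> (\<Sum>j=1..n. e2 j) / real n * (norm a * norm b)"
proof -
  have "\<bar>cov_form M n \<epsilon> [a, b]\<bar> \<le> (\<Sum>j=1..n. \<bar>expectation (\<lambda>\<omega>. (\<epsilon> j \<omega> \<bullet> a) * (\<epsilon> j \<omega> \<bullet> b))\<bar>) / real n"
    unfolding cov_form_eq by (simp add: abs_divide divide_right_mono)
  also have "\<dots> \<le> (\<Sum>j=1..n. e2 j * norm a * norm b) / real n"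
    by (intro divide_right_mono sum_mono integrable_inner_product(2)) auto
  also have "\<dots> = (\<Sum>j=1..n. e2 j) / real n * (norm a * norm b)"
    by (simp add: sum_distrib_right mult.assoc)
  finally show ?thesis .
qed

text \<open>Positivity excludes infinite spectral norms, which \<open>real_of_ereal\<close> sends to
  0, and with them a space without unit vectors. Rescaling to a unit vector then bounds the
  quadratic form of the covariance.\<close>

lemma noise_level_facts:
  assumes pos: "0 < noise_level H M n \<epsilon>"
  shows "spec_norm H 2 (cov_form M n \<epsilon>) = ereal ((noise_level H M n \<epsilon>)\<^sup>2)"
    and "\<exists>h\<in>H. norm h = 1"
    and "(noise_level H M n \<epsilon>)\<^sup>2 \<le> (\<Sum>j=1..n. e2 j) / real n"
    and "\<And>a. a \<in> H \<Longrightarrow> (\<Sum>j=1..n. expectation (\<lambda>\<omega>. (a \<bullet> \<epsilon> j \<omega>)\<^sup>2)) \<le> real n * (noise_level H M n \<epsilon>)\<^sup>2 * (norm a)\<^sup>2"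
proof -
  let ?S = "spec_norm H 2 (cov_form M n \<epsilon>)" and ?\<sigma> = "noise_level H M n \<epsilon>"
  have "?S \<le> ereal ((\<Sum>j=1..n. e2 j) / real n)"
    unfolding spec_norm_def
  proof (rule SUP_least)
    fix hs :: "'a list" assume hs: "hs \<in> {hs. length hs = 2 \<and> (\<forall>h\<in>set hs. h \<in> H \<and> norm h = 1)}"
    then obtain a b where "hs = [a, b]" by (auto simp: length_Suc_conv numeral_2_eq_2)
    then show "ereal \<bar>cov_form M n \<epsilon> hs\<bar> \<le> ereal ((\<Sum>j=1..n. e2 j) / real n)"
      using cov_form_abs_le[of a b] hs by simp
  qed
  moreover have "0 < real_of_ereal ?S" using pos by (simp add: noise_level_def)
  ultimately show S: "?S = ereal (?\<sigma>\<^sup>2)"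
    unfolding noise_level_def by (cases ?S) auto
  then show "?\<sigma>\<^sup>2 \<le> (\<Sum>j=1..n. e2 j) / real n"
    using \<open>?S \<le> ereal ((\<Sum>j=1..n. e2 j) / real n)\<close> by simp
  show "\<exists>h\<in>H. norm h = 1"
  proof (rule ccontr)
    assume "\<not> (\<exists>h\<in>H. norm h = 1)"
    then have "{hs. length hs = 2 \<and> (\<forall>h\<in>set hs. h \<in> H \<and> norm h = 1)} = {}"
      by (auto simp: length_Suc_conv numeral_2_eq_2)
    then have "?S = - \<infinity>" unfolding spec_norm_def by (simp only: image_empty Sup_empty bot_ereal_def)
    then show False using S by simp
  qed
  fix a assume a: "a \<in> H"
  show "(\<Sum>j=1..n. expectation (\<lambda>\<omega>. (a \<bullet> \<epsilon> j \<omega>)\<^sup>2)) \<le> real n * ?\<sigma>\<^sup>2 * (norm a)\<^sup>2"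
  proof (cases "a = 0")
    case False
    let ?u = "(1 / norm a) *\<^sub>R a"
    have u: "?u \<in> H" "norm ?u = 1" using a False subspace_scale[OF H(1)] by auto
    have "ereal \<bar>cov_form M n \<epsilon> [?u, ?u]\<bar> \<le> ?S"
      unfolding spec_norm_def using u by (intro SUP_upper) auto
    then have c: "cov_form M n \<epsilon> [?u, ?u] \<le> ?\<sigma>\<^sup>2" unfolding S by simp
    have "(\<Sum>j=1..n. expectation (\<lambda>\<omega>. (a \<bullet> \<epsilon> j \<omega>)\<^sup>2)) = real n * (norm a)\<^sup>2 * cov_form M n \<epsilon> [?u, ?u]"
      unfolding cov_form_eq using n False
      by (simp add: power2_eq_square inner_commute sum_divide_distrib[symmetric])
    also have "\<dots> \<le> real n * (norm a)\<^sup>2 * ?\<sigma>\<^sup>2" using c by (intro mult_left_mono) auto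
    finally show ?thesis by (simp add: mult_ac)
  qed simp
qed

text \<open>Parseval's identity for the noise vectors, taken through the expectation by dominated
  convergence along finite sections of \<open>B\<close>. Bessel's inequality supplies summability,
  without which the infinite sum in \<open>form_trace\<close> would be 0 by convention.\<close>

lemma trace_ge:
  "(\<Sum>j=1..n. e2 j) / real n \<le> form_trace B (cov_form M n \<epsilon>)"
proof -
  let ?g = "\<lambda>e. cov_form M n \<epsilon> [e, e]"
  have g: "?g e = (\<Sum>j=1..n. expectation (\<lambda>\<omega>. (\<epsilon> j \<omega> \<bullet> e)\<^sup>2)) / real n" for e
    unfolding cov_form_eq by (simp add: power2_eq_square)
  have g0: "0 \<le> ?g e" for e unfolding g by (intro divide_nonneg_nonneg sum_nonneg integral_nonneg_AE) auto
  have on: "u \<bullet> v = (if u = v then 1 else 0)" if "u \<in> B" "v \<in> B" for u v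
    using B that by (auto simp: orthonormal_basis_def pairwise_def orthogonal_def norm_eq_1)
  have int: "integrable M (\<lambda>\<omega>. (\<epsilon> j \<omega> \<bullet> e)\<^sup>2)" if "j \<in> {1..n}" for j e
    using integrable_inner_product(1)[OF that, of e e] by (simp add: power2_eq_square)
  have fs: "(\<Sum>e\<in>F. ?g e) = (\<Sum>j=1..n. expectation (\<lambda>\<omega>. \<Sum>e\<in>F. (\<epsilon> j \<omega> \<bullet> e)\<^sup>2)) / real n" for F
  proof -
    have "(\<Sum>j=1..n. expectation (\<lambda>\<omega>. \<Sum>e\<in>F. (\<epsilon> j \<omega> \<bullet> e)\<^sup>2)) = (\<Sum>j=1..n. \<Sum>e\<in>F. expectation (\<lambda>\<omega>. (\<epsilon> j \<omega> \<bullet> e)\<^sup>2))"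
      using int by (intro sum.cong refl Bochner_Integration.integral_sum) auto
    also have "\<dots> = (\<Sum>e\<in>F. \<Sum>j=1..n. expectation (\<lambda>\<omega>. (\<epsilon> j \<omega> \<bullet> e)\<^sup>2))" by (rule sum.swap)
    finally show ?thesis unfolding g by (simp add: sum_divide_distrib)
  qed
  have bs: "(\<Sum>e\<in>F. (\<epsilon> j \<omega> \<bullet> e)\<^sup>2) \<le> (norm (\<epsilon> j \<omega>))\<^sup>2" if "finite F" "F \<subseteq> B" for F j \<omega>
  proof (rule Bessel_inequality[OF that(1)])
    show "u \<bullet> v = (if u = v then 1 else 0)" if "u \<in> F" "v \<in> F" for u v
      using that \<open>F \<subseteq> B\<close> by (intro on) auto
  qed
  have bound: "(\<Sum>e\<in>F. ?g e) \<le> (\<Sum>j=1..n. e2 j) / real n" if F: "finite F" "F \<subseteq> B" for F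
    unfolding fs e2_def
    using bs[OF F] int integrable_\<epsilon>2
    by (intro divide_right_mono sum_mono integral_mono Bochner_Integration.integrable_sum) auto
  have sm: "?g summable_on B"
    using g0 bound by (intro nonneg_bdd_above_summable_on) (auto intro!: bdd_aboveI2)
  obtain F where F: "\<And>N. finite (F N)" "\<And>N. F N \<subseteq> B"
    and lim: "\<And>z. z \<in> H \<Longrightarrow> (\<lambda>N. \<Sum>e\<in>F N. (z \<bullet> e) *\<^sub>R e) \<longlonglongrightarrow> z"
    using orthonormal_basis_projections[OF B] by metis
  have "(\<lambda>N. \<Sum>e\<in>F N. ?g e) \<longlonglongrightarrow> (\<Sum>j=1..n. e2 j) / real n"
    unfolding fs e2_def
  proof (intro tendsto_divide tendsto_sum tendsto_const)
    fix j assume j: "j \<in> {1..n}"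
    show "(\<lambda>N. expectation (\<lambda>\<omega>. \<Sum>e\<in>F N. (\<epsilon> j \<omega> \<bullet> e)\<^sup>2)) \<longlonglongrightarrow> expectation (\<lambda>\<omega>. (norm (\<epsilon> j \<omega>))\<^sup>2)"
    proof (rule integral_dominated_convergence[where w = "\<lambda>\<omega>. (norm (\<epsilon> j \<omega>))\<^sup>2"])
      show "AE \<omega> in M. (\<lambda>N. \<Sum>e\<in>F N. (\<epsilon> j \<omega> \<bullet> e)\<^sup>2) \<longlonglongrightarrow> (norm (\<epsilon> j \<omega>))\<^sup>2"
      proof (rule AE_I2)
        fix \<omega> assume w: "\<omega> \<in> space M"
        have "(\<lambda>N. \<epsilon> j \<omega> \<bullet> (\<Sum>e\<in>F N. (\<epsilon> j \<omega> \<bullet> e) *\<^sub>R e)) \<longlonglongrightarrow> \<epsilon> j \<omega> \<bullet> \<epsilon> j \<omega>"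
          by (intro tendsto_intros lim \<epsilon>_H j w)
        then show "(\<lambda>N. \<Sum>e\<in>F N. (\<epsilon> j \<omega> \<bullet> e)\<^sup>2) \<longlonglongrightarrow> (norm (\<epsilon> j \<omega>))\<^sup>2"
          by (simp add: inner_sum_right power2_eq_square power2_norm_eq_inner[symmetric, unfolded power2_eq_square])
      qed
      show "AE \<omega> in M. norm (\<Sum>e\<in>F N. (\<epsilon> j \<omega> \<bullet> e)\<^sup>2) \<le> (norm (\<epsilon> j \<omega>))\<^sup>2" for N
        using bs[OF F] by (intro AE_I2) (simp add: abs_of_nonneg sum_nonneg)
    qed (use measurable_\<epsilon>[OF j] integrable_\<epsilon>2[OF j] in auto)
  qed (use n in auto)
  moreover have "(\<Sum>e\<in>F N. ?g e) \<le> form_trace B (cov_form M n \<epsilon>)" for N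
    unfolding form_trace_def using F g0 sm by (intro finite_sum_le_infsum) auto
  ultimately show ?thesis by (intro LIMSEQ_le_const2) auto
qed

lemma effective_rank_facts:
  assumes pos: "0 < noise_level H M n \<epsilon>"
  shows "(\<Sum>j=1..n. e2 j) \<le> real n * ((noise_level H M n \<epsilon>)\<^sup>2 * effective_rank H B M n \<epsilon>)"
    and "(noise_level H M n \<epsilon>)\<^sup>2 \<le> (noise_level H M n \<epsilon>)\<^sup>2 * effective_rank H B M n \<epsilon>"
proof -
  have e: "(noise_level H M n \<epsilon>)\<^sup>2 * effective_rank H B M n \<epsilon> = form_trace B (cov_form M n \<epsilon>)"
    using pos by (simp add: effective_rank_def)
  show "(\<Sum>j=1..n. e2 j) \<le> real n * ((noise_level H M n \<epsilon>)\<^sup>2 * effective_rank H B M n \<epsilon>)"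
    unfolding e using trace_ge n by (simp add: field_simps)
  show "(noise_level H M n \<epsilon>)\<^sup>2 \<le> (noise_level H M n \<epsilon>)\<^sup>2 * effective_rank H B M n \<epsilon>"
    unfolding e using noise_level_facts(3)[OF pos] trace_ge by linarith
qed

end

text \<open>Every factor satisfies \<open>n \<le> l * (n - i)\<close>: at the worst index
  \<open>i = l - 1\<close> the gap is \<open>(l - 1) * (n - l)\<close>.\<close>

lemma power_le_ffact:
  assumes "l \<le> n"
  shows "real n ^ l \<le> real l ^ l * ffact n l"
proof -
  have "real n ^ l = (\<Prod>i<l. real n)" by simp
  also have "\<dots> \<le> (\<Prod>i<l. real l * (real n - real i))"
  proof (intro prod_mono conjI)
    fix i assume "i \<in> {..<l}"
    then have i: "real i \<le> real l - 1" by auto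
    have "real l * (real n - real i) - real n \<ge> real l * (real n - (real l - 1)) - real n"
      using i by (simp add: mult_left_mono)
    also have "real l * (real n - (real l - 1)) - real n = (real l - 1) * (real n - real l)"
      by (simp add: algebra_simps)
    also have "\<dots> \<ge> 0"
      using \<open>i \<in> {..<l}\<close> assms by (intro mult_nonneg_nonneg) auto
    finally show "real n \<le> real l * (real n - real i)" by simp
  qed auto
  also have "\<dots> = real l ^ l * ffact n l" by (simp add: prod.distrib ffact_def)
  finally show ?thesis .
qed

lemma power_le_ffact_bounded:
  assumes "l \<le> n" "l \<le> L" "1 \<le> L"
  shows "real n ^ l \<le> real L ^ L * ffact n l"
proof -
  have "real l ^ l \<le> real L ^ l" using assms by (intro power_mono) auto
  also have "\<dots> \<le> real L ^ L" using assms by (intro power_increasing) auto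
  finally have "real l ^ l * ffact n l \<le> real L ^ L * ffact n l"
    using ffact_pos[OF assms(1)] by (intro mult_right_mono) auto
  then show ?thesis using power_le_ffact[OF assms(1)] by linarith
qed

text \<open>Divided by \<open>n ^ l\<close>, this says that a product of factors
  \<open>1 - i / n\<close> is at least 1 minus the sum of the \<open>i / n\<close>, where the sum of
  the \<open>i < l\<close> is bounded by \<open>l\<^sup>2 / 2\<close>.\<close>

lemma ffact_ge:
  assumes "0 < n"
  shows "l \<le> n \<Longrightarrow> real n ^ l * (1 - (real l)\<^sup>2 / (2 * real n)) \<le> ffact n l"
proof (induction l)
  case 0
  then show ?case by simp
next
  case (Suc l)
  let ?n = "real n" and ?l = "real l"
  have n0: "0 < ?n" using assms by simp
  have "?n ^ Suc l * (1 - (real (Suc l))\<^sup>2 / (2 * ?n)) \<le> ?n ^ Suc l * ((1 - ?l\<^sup>2 / (2 * ?n)) * (1 - ?l / ?n))"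
  proof (rule mult_left_mono)
    have "(1 - ?l\<^sup>2 / (2 * ?n)) * (1 - ?l / ?n) - (1 - (real (Suc l))\<^sup>2 / (2 * ?n)) =
       1 / (2 * ?n) + ?l\<^sup>2 / (2 * ?n) * (?l / ?n)"
      using n0 by (simp add: power2_eq_square field_simps)
    also have "\<dots> \<ge> 0" using n0 by simp
    finally show "1 - (real (Suc l))\<^sup>2 / (2 * ?n) \<le> (1 - ?l\<^sup>2 / (2 * ?n)) * (1 - ?l / ?n)" by simp
  qed simp
  also have "\<dots> = (?n ^ l * (1 - ?l\<^sup>2 / (2 * ?n))) * (?n - ?l)"
    using n0 by (simp add: field_simps)
  also have "\<dots> \<le> ffact n l * (?n - ?l)"
    using Suc by (intro mult_right_mono) auto
  finally show ?case by (simp add: ffact_Suc)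
qed

text \<open>Here the condition on \<open>s\<^sup>2\<close> takes effect: the loss in
  \<open>ffact_ge\<close> is at most 1/2.\<close>

lemma power_le_2_ffact:
  assumes "0 < n" "l \<le> m" "(real m)\<^sup>2 \<le> real n" "m \<le> n"
  shows "real n ^ l \<le> 2 * ffact n l"
proof -
  have "(real l)\<^sup>2 \<le> (real m)\<^sup>2" using assms by (intro power_mono) auto
  then have "(real l)\<^sup>2 / (2 * real n) \<le> real n / (2 * real n)"
    using assms(3) by (intro divide_right_mono) linarith+
  also have "\<dots> = 1 / 2" using assms(1) by simp
  finally have "(real l)\<^sup>2 / (2 * real n) \<le> 1 / 2" .
  then have "real n ^ l * (1 / 2) \<le> real n ^ l * (1 - (real l)\<^sup>2 / (2 * real n))"
    by (intro mult_left_mono) auto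
  also have "\<dots> \<le> ffact n l" using assms by (intro ffact_ge) auto
  finally show ?thesis by simp
qed

text \<open>The model equations hold on \<open>space M\<close> only; independence sees the variables
  only there.\<close>

lemma (in prob_space) indep_vars_cong_space:
  assumes "indep_vars M' X I" and eq: "\<And>i \<omega>. i \<in> I \<Longrightarrow> \<omega> \<in> space M \<Longrightarrow> X i \<omega> = Y i \<omega>"
  shows "indep_vars M' Y I"
proof -
  have "X i \<in> measurable M (M' i) \<longleftrightarrow> Y i \<in> measurable M (M' i)" if "i \<in> I" for i
    using eq[OF that] by (intro measurable_cong) auto
  moreover have "{X i -` A \<inter> space M |A. A \<in> sets (M' i)} = {Y i -` A \<inter> space M |A. A \<in> sets (M' i)}" if "i \<in> I" for i
  proof -
    have "X i -` A \<inter> space M = Y i -` A \<inter> space M" for A using eq[OF that] by auto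
    then show ?thesis by simp
  qed
  ultimately show ?thesis
    using assms(1) unfolding indep_vars_def2 by (auto cong: indep_sets_cong)
qed

text \<open>\<open>K\<close> is chosen from the target accuracy before \<open>n\<close> grows, so
  \<open>c\<close> may depend on it; Markov's inequality for \<open>W\<close> then leaves a multiple
  of \<open>b n / q n\<close>.\<close>

lemma tail_imp_tendsto_0:
  fixes M :: "nat \<Rightarrow> 'w measure" and Z :: "nat \<Rightarrow> 'w \<Rightarrow> real" and b q :: "nat \<Rightarrow> real"
  assumes lim: "(\<lambda>n. b n / q n) \<longlonglongrightarrow> 0"
    and ev: "\<forall>\<^sub>F n in sequentially. prob_space (M n) \<and> Z n \<in> borel_measurable (M n) \<and> 0 < q n"
    and tail: "\<And>K::real. 1 \<le> K \<Longrightarrow> \<exists>c. \<forall>\<^sub>F n in sequentially. \<exists>W. integrable (M n) W \<and>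
      (\<forall>\<omega>\<in>space (M n). 0 \<le> W \<omega>) \<and> (\<integral>\<omega>. W \<omega> \<partial>M n) \<le> c * b n \<and>
      measure (M n) {\<omega>\<in>space (M n). \<bar>Z n \<omega>\<bar> > W \<omega>} \<le> 2 / K"
    and \<eta>: "0 < \<eta>"
  shows "(\<lambda>n. measure (M n) {\<omega>\<in>space (M n). \<bar>Z n \<omega> / q n\<bar> > \<eta>}) \<longlonglongrightarrow> 0"
proof (rule tendstoI)
  fix e :: real assume e: "0 < e"
  \<comment> \<open>\<open>4 / e\<close> leaves half of \<open>e\<close> to the exceptional event
    and half to Markov's inequality.\<close>
  define K where "K = max 1 (4 / e)"
  have K: "1 \<le> K" "2 / K \<le> e / 2" using e by (auto simp: K_def max_def field_simps)
  obtain c where c: "\<forall>\<^sub>F n in sequentially. \<exists>W. integrable (M n) W \<and>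
      (\<forall>\<omega>\<in>space (M n). 0 \<le> W \<omega>) \<and> (\<integral>\<omega>. W \<omega> \<partial>M n) \<le> c * b n \<and>
      measure (M n) {\<omega>\<in>space (M n). \<bar>Z n \<omega>\<bar> > W \<omega>} \<le> 2 / K"
    using tail[OF K(1)] by blast
  have "(\<lambda>n. c * (b n / q n) / \<eta>) \<longlonglongrightarrow> c * 0 / \<eta>"
    using \<eta> by (intro tendsto_intros lim) auto
  then have "\<forall>\<^sub>F n in sequentially. c * (b n / q n) / \<eta> < e / 2"
    using e by (intro order_tendstoD(2)) auto
  then show "\<forall>\<^sub>F n in sequentially. dist (measure (M n) {\<omega>\<in>space (M n). \<bar>Z n \<omega> / q n\<bar> > \<eta>}) 0 < e"
    using c ev
  proof eventually_elim
    case (elim n)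
    then interpret prob_space "M n" by simp
    obtain W where W: "integrable (M n) W" "\<And>\<omega>. \<omega> \<in> space (M n) \<Longrightarrow> 0 \<le> W \<omega>"
      "expectation W \<le> c * b n" "prob {\<omega>\<in>space (M n). \<bar>Z n \<omega>\<bar> > W \<omega>} \<le> 2 / K"
      using elim by blast
    have [measurable]: "W \<in> borel_measurable (M n)" "Z n \<in> borel_measurable (M n)" using W(1) elim by auto
    have q: "0 < q n" using elim by simp
    let ?A = "{\<omega>\<in>space (M n). \<bar>Z n \<omega>\<bar> > W \<omega>}" and ?B = "{\<omega>\<in>space (M n). W \<omega> \<ge> \<eta> * q n}"
    have sets: "?A \<in> events" "?B \<in> events" by measurable
    have "prob {\<omega>\<in>space (M n). \<bar>Z n \<omega> / q n\<bar> > \<eta>} \<le> prob (?A \<union> ?B)"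
    proof (rule finite_measure_mono)
      show "{\<omega>\<in>space (M n). \<bar>Z n \<omega> / q n\<bar> > \<eta>} \<subseteq> ?A \<union> ?B"
        using q by (auto simp: abs_divide field_simps)
    qed (use sets in auto)
    also have "\<dots> \<le> prob ?A + prob ?B" by (rule measure_Un_le[OF sets])
    also have "prob ?B \<le> expectation W / (\<eta> * q n)"
      using W(1,2) q \<eta> by (intro integral_Markov_inequality_measure[where A = "space (M n)"]) auto
    also have "\<dots> \<le> c * b n / (\<eta> * q n)" using W(3) q \<eta> by (intro divide_right_mono) auto
    also have "\<dots> = c * (b n / q n) / \<eta>" by simp
    finally have "prob {\<omega>\<in>space (M n). \<bar>Z n \<omega> / q n\<bar> > \<eta>} < e"
      using W(4) K(2) elim(1) by linarith
    then show ?case by simp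
  qed
qed

lemma weak_conv_m_cong_eventually:
  assumes "\<forall>\<^sub>F n in sequentially. N n = N' n" "weak_conv_m N' \<mu>"
  shows "weak_conv_m N \<mu>"
  unfolding weak_conv_m_def weak_conv_def
proof safe
  fix x assume "isCont (cdf \<mu>) x"
  then have "(\<lambda>n. cdf (N' n) x) \<longlonglongrightarrow> cdf \<mu> x"
    using assms(2) by (auto simp: weak_conv_m_def weak_conv_def)
  moreover have "\<forall>\<^sub>F n in sequentially. cdf (N' n) x = cdf (N n) x"
    using assms(1) by eventually_elim simp
  ultimately show "(\<lambda>n. cdf (N n) x) \<longlonglongrightarrow> cdf \<mu> x" by (rule Lim_transform_eventually)
qed

section \<open>The linear term and the Hoelder seminorms\<close>

context smooth_functional
begin

lemma T1_moments:
  assumes j: "j \<in> {1..n}"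
  shows "integrable M (\<lambda>\<omega>. T 1 [\<epsilon> j \<omega>])" "expectation (\<lambda>\<omega>. T 1 [\<epsilon> j \<omega>]) = 0"
    "integrable M (\<lambda>\<omega>. (T 1 [\<epsilon> j \<omega>])\<^sup>2)"
proof -
  have k: "1 \<le> m" using m_bounds by simp
  obtain c where c: "form_le H 1 (T 1) c" "0 \<le> c" using T_bounded[OF k] .
  obtain a where a: "a \<in> H" "norm a \<le> c * (prod_list (map norm []) * prod_list (map norm []))"
    "\<And>z. z \<in> H \<Longrightarrow> T 1 ([] @ z # []) = a \<bullet> z"
    by (rule slot_Riesz[OF T_multilinear[OF k] c, of "[]" "[]"]) auto
  have eq: "T 1 [\<epsilon> j \<omega>] = \<epsilon> j \<omega> \<bullet> a" if "\<omega> \<in> space M" for \<omega>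
    using a(3)[OF \<epsilon>_H[OF j that]] by (simp add: inner_commute)
  show "integrable M (\<lambda>\<omega>. T 1 [\<epsilon> j \<omega>])"
    using eq integrable_\<epsilon>[OF j] by (subst Bochner_Integration.integrable_cong[where g = "\<lambda>\<omega>. \<epsilon> j \<omega> \<bullet> a"]) auto
  show "expectation (\<lambda>\<omega>. T 1 [\<epsilon> j \<omega>]) = 0"
    using expectation_slot[OF T_multilinear[OF k] c, of "[]" "[]"] j by simp
  show "integrable M (\<lambda>\<omega>. (T 1 [\<epsilon> j \<omega>])\<^sup>2)"
    using eq integrable_inner_product(1)[OF j, of a a]
    by (subst Bochner_Integration.integrable_cong[where g = "\<lambda>\<omega>. (\<epsilon> j \<omega> \<bullet> a) * (\<epsilon> j \<omega> \<bullet> a)"])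
      (auto simp: power2_eq_square)
qed

text \<open>To be composed with independent variables, the form must be a measurable function on the
  whole ambient type, hence \<open>clip\<close>.\<close>

lemma T1_indep: "indep_vars (\<lambda>_. borel) (\<lambda>j \<omega>. T 1 [\<epsilon> j \<omega>] / c) {1..n}"
proof (rule indep_vars_cong_space)
  have k: "1 \<le> m" using m_bounds by simp
  obtain b where b: "form_le H 1 (T 1) b" "0 \<le> b" using T_bounded[OF k] .
  have "(\<lambda>z. T 1 (map (\<lambda>i. clip z) [0::nat])) \<in> borel_measurable borel"
    by (intro measurable_form[OF H(1) B T_multilinear[OF k] b(1)]) auto
  then have "(\<lambda>z. T 1 [clip z] / c) \<in> borel_measurable borel" by simp
  then show "indep_vars (\<lambda>_. borel) (\<lambda>j \<omega>. T 1 [clip (\<epsilon> j \<omega>)] / c) {1..n}"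
    by (intro indep_vars_compose2[OF indep, where Y = "\<lambda>_ z. T 1 [clip z] / c"])
  show "\<And>i \<omega>. i \<in> {1..n} \<Longrightarrow> \<omega> \<in> space M \<Longrightarrow> T 1 [clip (\<epsilon> i \<omega>)] / c = T 1 [\<epsilon> i \<omega>] / c" by simp
qed

text \<open>The supremum leaves out \<open>h = 0\<close>, where the increment vanishes.\<close>

lemma holder_form_le:
  assumes le: "holder_seminorm H f s \<theta> \<le> ereal C" and C: "0 \<le> C" and h: "h \<in> H"
  shows "form_le H m (D h) (C * norm h powr (s - real m))"
proof (cases "h = 0")
  case True
  then show ?thesis using D_0 by (simp add: form_le_def)
next
  case False
  have "spec_norm H m (D h) / ereal (norm h powr (s - real m)) \<le> holder_seminorm H f s \<theta>"
    unfolding holder_seminorm_def m(5) Let_def D_def[abs_def] T_def using h False by (intro SUP_upper2[where i = h]) auto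
  then have "spec_norm H m (D h) / ereal (norm h powr (s - real m)) \<le> ereal C" using le by (rule order_trans)
  then have "spec_norm H m (D h) \<le> ereal (C * norm h powr (s - real m))"
    by (rule ereal_divide_leD) (use False in simp)
  then show ?thesis
    by (rule spec_norm_form_le[OF H(1) D_multilinear[OF h]]) (use C in simp)
qed

lemma holder_hs_norm_le:
  assumes le: "holder_seminorm_HS H B f s \<theta> \<le> ereal C" and h: "h \<in> H"
  shows "hs_norm B m (D h) \<le> ereal (C * norm h powr (s - real m))"
proof (cases "h = 0")
  case True
  then have "D h = (\<lambda>_. 0)" using D_0 by auto
  then show ?thesis using True unfolding hs_norm_def by (intro SUP_least) (simp add: L2_set_def)
next
  case False
  have "hs_norm B m (D h) / ereal (norm h powr (s - real m)) \<le> holder_seminorm_HS H B f s \<theta>"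
    unfolding holder_seminorm_HS_def m(5) Let_def D_def[abs_def] T_def using h False by (intro SUP_upper2[where i = h]) auto
  then have "hs_norm B m (D h) / ereal (norm h powr (s - real m)) \<le> ereal C" using le by (rule order_trans)
  then show ?thesis by (rule ereal_divide_leD) (use False in simp)
qed

end

section \<open>Asymptotic normality\<close>

theorem theorem4p1:
  fixes H B :: "nat \<Rightarrow> 'a::{real_inner,banach,second_countable_topology} set"
    and f :: "nat \<Rightarrow> 'a \<Rightarrow> real"
    and s C\<^sub>0 :: "nat \<Rightarrow> real"
    and \<theta> :: "nat \<Rightarrow> 'a"
    and M :: "nat \<Rightarrow> 'w measure"
    and x \<epsilon> :: "nat \<Rightarrow> nat \<Rightarrow> 'w \<Rightarrow> 'a"
    and \<sigma> r V :: "nat \<Rightarrow> real"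
  assumes space: "\<forall>\<^sub>F n in sequentially.
        subspace (H n) \<and> closed (H n) \<and> orthonormal_basis (H n) (B n)"
    and order: "\<forall>\<^sub>F n in sequentially.
        0 < s n \<and> 2 \<le> smooth_order (s n) \<and> smooth_order (s n) \<le> n"
    and smooth: "\<forall>\<^sub>F n in sequentially.
        \<theta> n \<in> H n \<and> times_differentiable_on (smooth_order (s n)) (H n) (f n) \<and>
        (\<forall>k\<in>{1..smooth_order (s n)}.
           multilinear_form (H n) k (fderiv (H n) (f n) k (\<theta> n)) \<and>
           symmetric_form (H n) k (fderiv (H n) (f n) k (\<theta> n)) \<and>
           spec_norm (H n) k (fderiv (H n) (f n) k (\<theta> n)) < \<infinity>)"
    and model: "\<forall>\<^sub>F n in sequentially.
        prob_space (M n) \<and>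
        (\<forall>j\<in>{1..n}. \<forall>\<omega>\<in>space (M n). x n j \<omega> = \<theta> n + \<epsilon> n j \<omega> \<and> \<epsilon> n j \<omega> \<in> H n) \<and>
        prob_space.indep_vars (M n) (\<lambda>_. borel) (x n) {1..n}"
    and noise: "\<forall>\<^sub>F n in sequentially.
        \<forall>j\<in>{1..n}. integrable (M n) (\<epsilon> n j) \<and> (\<integral>\<omega>. \<epsilon> n j \<omega> \<partial>M n) = 0 \<and>
                   integrable (M n) (\<lambda>\<omega>. (norm (\<epsilon> n j \<omega>))\<^sup>2)"
    and \<sigma>: "\<And>n. \<sigma> n = noise_level (H n) (M n) n (\<epsilon> n)"
    and r: "\<And>n. r n = effective_rank (H n) (B n) (M n) n (\<epsilon> n)"
    and V: "\<And>n. V n = V1 (H n) (f n) (\<theta> n) (M n) n (\<epsilon> n)"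
    and positive: "\<forall>\<^sub>F n in sequentially. 0 < \<sigma> n \<and> 0 < V n"
    and ii: "(\<lambda>n. C\<^sub>0 n * max ((\<sigma> n)\<^sup>2 * sqrt (r n) / real n)
                              (((\<sigma> n)\<^sup>2 * r n / real n) powr (s n / 2))
                  / sqrt (V n / real n)) \<longlonglongrightarrow> 0"
    and iii: "lindeberg_condition M V (\<lambda>n. lin_noise (H n) (f n) (\<theta> n) (\<epsilon> n))"
  shows "(s \<in> O(\<lambda>_. 1) \<and>
      (\<forall>\<^sub>F n in sequentially.
         (\<forall>k. 2 \<le> k \<and> real k < s n \<longrightarrow>
            spec_norm (H n) k (fderiv (H n) (f n) k (\<theta> n)) \<le> ereal (C\<^sub>0 n)) \<and>
         holder_seminorm (H n) (f n) (s n) (\<theta> n) \<le> ereal (C\<^sub>0 n))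
      \<longrightarrow> weak_conv_m
            (\<lambda>n. distr (M n) borel (\<lambda>\<omega>. sqrt (real n) *
               (estimator (H n) (f n) (s n) n (\<lambda>j. x n j \<omega>) - f n (\<theta> n)) / sqrt (V n)))
            std_normal_distribution) \<and>
     (\<forall>d::real. 0 < d \<and>
      (\<forall>\<^sub>F n in sequentially. (s n)\<^sup>2 \<le> real n) \<and>
      (\<forall>\<^sub>F n in sequentially.
         (\<forall>k. 2 \<le> k \<and> real k < s n \<longrightarrow>
            spec_norm (H n) k (fderiv (H n) (f n) k (\<theta> n)) / ereal (d powr (real k / 2))
              \<le> ereal (C\<^sub>0 n)) \<and>
         holder_seminorm_HS (H n) (B n) (f n) (s n) (\<theta> n)
           \<le> ereal (C\<^sub>0 n * d powr (real (smooth_order (s n)) / 2)))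
      \<longrightarrow> weak_conv_m
            (\<lambda>n. distr (M n) borel (\<lambda>\<omega>. sqrt (real n) *
               (estimator (H n) (f n) (s n) n (\<lambda>j. x n j \<omega>) - f n (\<theta> n)) / sqrt (V n)))
            std_normal_distribution)"
proof -
  let ?normal = "weak_conv_m
            (\<lambda>n. distr (M n) borel (\<lambda>\<omega>. sqrt (real n) *
               (estimator (H n) (f n) (s n) n (\<lambda>j. x n j \<omega>) - f n (\<theta> n)) / sqrt (V n)))
            std_normal_distribution"
  define m where "m n = smooth_order (s n)" for n
  \<comment> \<open>Division by \<open>sqrt (n * V n)\<close> makes the variances add up to 1.
    Correspondingly \<open>q n\<close> is the standard deviation of the linear term, on whose scale
    \<open>Z n\<close> has to vanish.\<close>
  define X where "X n j \<omega> = lin_noise (H n) (f n) (\<theta> n) (\<epsilon> n) j \<omega> / sqrt (real n * V n)" for n j \<omega>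
  define Z where "Z n \<omega> = estimator (H n) (f n) (s n) n (\<lambda>j. x n j \<omega>) - f n (\<theta> n) -
      (\<Sum>j=1..n. lin_noise (H n) (f n) (\<theta> n) (\<epsilon> n) j \<omega>) / real n" for n \<omega>
  define q where "q n = sqrt (V n / real n)" for n
  define b where "b n = C\<^sub>0 n * max ((\<sigma> n)\<^sup>2 * sqrt (r n) / real n)
      (((\<sigma> n)\<^sup>2 * r n / real n) powr (s n / 2))" for n
  let ?tail = "\<lambda>n K c. \<exists>W. integrable (M n) W \<and>
      (\<forall>\<omega>\<in>space (M n). 0 \<le> W \<omega>) \<and> (\<integral>\<omega>. W \<omega> \<partial>M n) \<le> c * b n \<and>
      measure (M n) {\<omega>\<in>space (M n). \<bar>Z n \<omega>\<bar> > W \<omega>} \<le> 2 / K"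
  \<comment> \<open>The hypotheses hold for large \<open>n\<close> only, so the locale is
    interpreted inside eventual statements. Independence is given for the observations and passes to
    the noise by subtracting \<open>\<theta> n\<close>.\<close>
  have loc: "\<forall>\<^sub>F n in sequentially.
      smooth_functional (M n) (H n) (B n) n (\<epsilon> n) (f n) (\<theta> n) (s n) (m n) (x n)"
    using space order smooth model noise eventually_gt_at_top[of 0]
  proof eventually_elim
    case (elim n)
    then interpret prob_space "M n" by simp
    have "indep_vars (\<lambda>_. borel) (\<lambda>j \<omega>. x n j \<omega> - \<theta> n) {1..n}"
      by (rule indep_vars_compose2[where Y = "\<lambda>_ z. z - \<theta> n"]) (use elim in auto)
    then have ind: "indep_vars (\<lambda>_. borel) (\<epsilon> n) {1..n}"
      by (rule indep_vars_cong_space) (use elim in auto)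
    have "real (m n) < s n" "s n \<le> real (m n) + 1"
      using elim ceiling_correct[of "s n"] unfolding m_def smooth_order_def by linarith+
    with elim ind show ?case
      by (intro smooth_functional.intro hilbert_noise.intro hilbert_noise_axioms.intro
          smooth_functional_axioms.intro prob_space_axioms) (auto simp: m_def)
  qed
  \<comment> \<open>The two sets of smoothness hypotheses enter only through a tail bound on
    \<open>Z n\<close>, whose constant may depend on \<open>K\<close>.\<close>
  have conv: ?normal
    if tail: "\<And>K::real. 1 \<le> K \<Longrightarrow> \<exists>c. \<forall>\<^sub>F n in sequentially. ?tail n K c"
  proof -
    have Zm: "\<forall>\<^sub>F n in sequentially. prob_space (M n) \<and> Z n \<in> borel_measurable (M n) \<and> 0 < q n"
      using loc positive
    proof eventually_elim
      case (elim n)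
      then interpret L: smooth_functional "M n" "H n" "B n" n "\<epsilon> n" "f n" "\<theta> n" "s n" "m n" "x n" by simp
      have "Z n = L.Z" by (simp add: fun_eq_iff Z_def L.Z_def L.T_def lin_noise_def)
      then show ?case using L.Z_measurable L.prob_space_axioms L.n elim by (simp add: q_def)
    qed
    have "weak_conv_m (\<lambda>n. distr (M n) borel (\<lambda>\<omega>. (\<Sum>j=1..n. X n j \<omega>) + Z n \<omega> / q n)) std_normal_distribution"
    proof (rule lindeberg_central_limit_theorem)
      show "\<forall>\<^sub>F n in sequentially. prob_space (M n) \<and>
          prob_space.indep_vars (M n) (\<lambda>_. borel) (X n) {1..n} \<and>
          (\<forall>j\<in>{1..n}. integrable (M n) (X n j) \<and> (\<integral>\<omega>. X n j \<omega> \<partial>M n) = 0 \<and>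
            integrable (M n) (\<lambda>\<omega>. (X n j \<omega>)\<^sup>2)) \<and>
          (\<Sum>j=1..n. \<integral>\<omega>. (X n j \<omega>)\<^sup>2 \<partial>M n) = 1"
        using loc positive
      proof eventually_elim
        case (elim n)
        then interpret L: smooth_functional "M n" "H n" "B n" n "\<epsilon> n" "f n" "\<theta> n" "s n" "m n" "x n" by simp
        have X: "X n = (\<lambda>j \<omega>. L.T 1 [\<epsilon> n j \<omega>] / sqrt (real n * V n))"
          by (simp add: fun_eq_iff X_def L.T_def lin_noise_def)
        have nV: "0 < real n * V n" using L.n elim by simp
        have sq: "(X n j \<omega>)\<^sup>2 = (L.T 1 [\<epsilon> n j \<omega>])\<^sup>2 / (real n * V n)" for j \<omega>
          using nV by (simp add: X power_divide)
        have "real n * V n = (\<Sum>j=1..n. \<integral>\<omega>. (L.T 1 [\<epsilon> n j \<omega>])\<^sup>2 \<partial>M n)"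
          using L.n unfolding V V1_def lin_noise_def L.T_def by simp
        then have "(\<Sum>j=1..n. \<integral>\<omega>. (X n j \<omega>)\<^sup>2 \<partial>M n) = 1"
          unfolding sq using nV by (simp add: sum_divide_distrib[symmetric])
        moreover have "integrable (M n) (X n j) \<and> (\<integral>\<omega>. X n j \<omega> \<partial>M n) = 0 \<and>
            integrable (M n) (\<lambda>\<omega>. (X n j \<omega>)\<^sup>2)" if "j \<in> {1..n}" for j
          unfolding sq using L.T1_moments[OF that] by (simp add: X)
        ultimately show ?case using L.T1_indep L.prob_space_axioms unfolding X by blast
      qed
      show "(\<lambda>n. \<Sum>j=1..n. \<integral>\<omega>. (X n j \<omega>)\<^sup>2 * indicator {\<omega>. \<bar>X n j \<omega>\<bar> > \<eta>} \<omega> \<partial>M n) \<longlonglongrightarrow> 0"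
        if \<eta>: "0 < \<eta>" for \<eta> :: real
      proof -
        let ?g = "\<lambda>n. lin_noise (H n) (f n) (\<theta> n) (\<epsilon> n)"
        have lim: "(\<lambda>n. (1 / (real n * V n)) * (\<Sum>j=1..n. \<integral>\<omega>. (?g n j \<omega>)\<^sup>2 *
            indicator {\<omega>. \<bar>?g n j \<omega>\<bar> > \<eta> * sqrt (real n * V n)} \<omega> \<partial>M n)) \<longlonglongrightarrow> 0"
          using iii \<eta> unfolding lindeberg_condition_def by blast
        show ?thesis
        proof (rule Lim_transform_eventually[OF lim])
          show "\<forall>\<^sub>F n in sequentially. (1 / (real n * V n)) * (\<Sum>j=1..n. \<integral>\<omega>. (?g n j \<omega>)\<^sup>2 *
            indicator {\<omega>. \<bar>?g n j \<omega>\<bar> > \<eta> * sqrt (real n * V n)} \<omega> \<partial>M n) =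
            (\<Sum>j=1..n. \<integral>\<omega>. (X n j \<omega>)\<^sup>2 * indicator {\<omega>. \<bar>X n j \<omega>\<bar> > \<eta>} \<omega> \<partial>M n)"
            using positive eventually_gt_at_top[of 0]
          proof eventually_elim
            case (elim n)
            then have nV: "0 < real n * V n" by simp
            then have "(X n j \<omega>)\<^sup>2 * indicator {\<omega>. \<bar>X n j \<omega>\<bar> > \<eta>} \<omega> = (1 / (real n * V n)) * ((?g n j \<omega>)\<^sup>2 *
              indicator {\<omega>. \<bar>?g n j \<omega>\<bar> > \<eta> * sqrt (real n * V n)} \<omega>)" for j \<omega>
              by (simp add: X_def power_divide abs_divide indicator_def less_divide_eq)
            then show ?case by (simp add: sum_distrib_left)
          qed
        qed
      qed
      show "\<forall>\<^sub>F n in sequentially. (\<lambda>\<omega>. Z n \<omega> / q n) \<in> borel_measurable (M n)"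
        using Zm by eventually_elim (intro borel_measurable_divide borel_measurable_const, simp)
      show "(\<lambda>n. measure (M n) {\<omega>\<in>space (M n). \<bar>Z n \<omega> / q n\<bar> > \<eta>}) \<longlonglongrightarrow> 0" if "0 < \<eta>" for \<eta> :: real
        using ii tail that by (intro tail_imp_tendsto_0[OF _ Zm]) (simp_all add: b_def q_def)
    qed
    moreover have "\<forall>\<^sub>F n in sequentially. distr (M n) borel (\<lambda>\<omega>. sqrt (real n) *
        (estimator (H n) (f n) (s n) n (\<lambda>j. x n j \<omega>) - f n (\<theta> n)) / sqrt (V n)) =
        distr (M n) borel (\<lambda>\<omega>. (\<Sum>j=1..n. X n j \<omega>) + Z n \<omega> / q n)"
      using positive eventually_gt_at_top[of 0]
    proof eventually_elim
      case (elim n)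
      \<comment> \<open>Read with \<open>a = sqrt n\<close> and \<open>v = sqrt V\<close>: the
        normalised linear term plus the remainder over \<open>q n\<close> is the standardised
        error.\<close>
      have alg: "u / (a * v) + (w - u / a\<^sup>2) / (v / a) = a * w / v" if "0 < a" "0 < v" for a v u w :: real
        using that by (simp add: field_simps power2_eq_square)
      have "(\<Sum>j=1..n. X n j \<omega>) + Z n \<omega> / q n = sqrt (real n) *
        (estimator (H n) (f n) (s n) n (\<lambda>j. x n j \<omega>) - f n (\<theta> n)) / sqrt (V n)" for \<omega>
        using alg[of "sqrt (real n)" "sqrt (V n)" "\<Sum>j=1..n. lin_noise (H n) (f n) (\<theta> n) (\<epsilon> n) j \<omega>"
            "estimator (H n) (f n) (s n) n (\<lambda>j. x n j \<omega>) - f n (\<theta> n)"] elim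
        by (simp add: X_def Z_def q_def sum_divide_distrib[symmetric] real_sqrt_mult real_sqrt_divide)
      then show ?case by simp
    qed
    ultimately show ?thesis by (rule weak_conv_m_cong_eventually[rotated])
  qed
  have quant: "\<forall>\<^sub>F n in sequentially. 0 < (\<sigma> n)\<^sup>2 \<and> (\<sigma> n)\<^sup>2 \<le> (\<sigma> n)\<^sup>2 * r n \<and>
      (\<forall>a\<in>H n. (\<Sum>j=1..n. \<integral>\<omega>. (a \<bullet> \<epsilon> n j \<omega>)\<^sup>2 \<partial>M n) \<le> real n * (\<sigma> n)\<^sup>2 * (norm a)\<^sup>2) \<and>
      (\<Sum>j=1..n. hilbert_noise.e2 (M n) (\<epsilon> n) j) \<le> real n * ((\<sigma> n)\<^sup>2 * r n) \<and>
      (\<exists>h\<in>H n. norm h = 1)"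
    using loc positive
  proof eventually_elim
    case (elim n)
    then interpret L: smooth_functional "M n" "H n" "B n" n "\<epsilon> n" "f n" "\<theta> n" "s n" "m n" "x n" by simp
    have pos: "0 < noise_level (H n) (M n) n (\<epsilon> n)" using elim \<sigma> by simp
    show ?case
      using pos L.noise_level_facts[OF pos] L.effective_rank_facts[OF pos] unfolding \<sigma> r by simp
  qed
  have b_nonneg: "0 \<le> b n" if "0 \<le> C\<^sub>0 n" for n
    using that unfolding b_def by (intro mult_nonneg_nonneg max.coboundedI2) auto
  have spec: ?normal
    if O: "s \<in> O(\<lambda>_. 1)"
      and i: "\<forall>\<^sub>F n in sequentially.
         (\<forall>k. 2 \<le> k \<and> real k < s n \<longrightarrow>
            spec_norm (H n) k (fderiv (H n) (f n) k (\<theta> n)) \<le> ereal (C\<^sub>0 n)) \<and>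
         holder_seminorm (H n) (f n) (s n) (\<theta> n) \<le> ereal (C\<^sub>0 n)"
  proof (rule conv)
    fix K :: real assume K: "1 \<le> K"
    obtain c where c: "\<forall>\<^sub>F n in sequentially. norm (s n) \<le> c * norm (1::real)"
      using O by (rule landau_o.bigE)
    \<comment> \<open>One integer bound for \<open>s n\<close>, hence for \<open>m n\<close>, makes
      \<open>L ^ L\<close> and \<open>K powr (L / 2)\<close> constants.\<close>
    define L where "L = max 1 (nat \<lceil>c\<rceil>)"
    have L1: "1 \<le> L" by (simp add: L_def)
    have cL: "c \<le> real L" unfolding L_def by linarith
    let ?\<kappa> = "real L ^ L"
    have F0: "0 \<le> sqrt_fact_series 1" using sqrt_fact_series_ge[of 1 "{}"] by simp
    let ?c = "?\<kappa> * sqrt_fact_series 1 + (real L + 1) * ?\<kappa> * K powr (real L / 2)"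
    show "\<exists>c. \<forall>\<^sub>F n in sequentially. ?tail n K c"
    proof (intro exI[of _ ?c])
      show "\<forall>\<^sub>F n in sequentially. ?tail n K ?c"
        using loc i quant c
      proof eventually_elim
        case (elim n)
        then interpret L: smooth_functional "M n" "H n" "B n" n "\<epsilon> n" "f n" "\<theta> n" "s n" "m n" "x n" by simp
        have sL: "s n \<le> real L" using elim(4) cL by simp
        have mL: "m n \<le> L" using sL L.m(3) by linarith
        obtain h where h: "h \<in> H n" "norm h = 1" using elim by blast
        have sp: "spec_norm (H n) k (L.T k) \<le> ereal (C\<^sub>0 n)" if "2 \<le> k" "k \<le> m n" for k
          using elim(2) that L.m(3) by (auto simp: L.T_def)
        \<comment> \<open>The sign comes from the bound at \<open>k = 2\<close>, an admissible order
          since \<open>m \<ge> 2\<close>: a space with a unit vector has nonnegative spectral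
          norms.\<close>
        have C0: "0 \<le> C\<^sub>0 n"
          using order_trans[OF spec_norm_nonneg[OF h] sp[of 2]] L.m_bounds by simp
        have T_le: "form_le (H n) k (L.T k) (C\<^sub>0 n * 1 ^ k)" if "2 \<le> k" "k \<le> m n" for k
          using spec_norm_form_le[OF L.H(1) L.T_multilinear[OF that(2)] sp[OF that] C0] by simp
        have \<kappa>: "real n ^ l \<le> ?\<kappa> * ffact n l" if "l \<le> m n" for l
          using that mL L.m_bounds L1 by (intro power_le_ffact_bounded) auto
        have s2: "(\<Sum>j=1..n. \<integral>\<omega>. (a \<bullet> \<epsilon> n j \<omega>)\<^sup>2 \<partial>M n) \<le> real n * (\<sigma> n)\<^sup>2 * (norm a)\<^sup>2"
          if "a \<in> H n" for a using elim(3) that by blast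
        have tr: "(\<Sum>j=1..n. L.e2 j) \<le> real n * ((\<sigma> n)\<^sup>2 * r n)" using elim(3) by blast
        have \<sigma>2: "0 < (\<sigma> n)\<^sup>2" "(\<sigma> n)\<^sup>2 \<le> (\<sigma> n)\<^sup>2 * r n" using elim(3) by blast+
        note facts = s2 \<sigma>2 tr \<kappa> K C0 zero_less_one T_le
        have b: "C\<^sub>0 n * rate n (s n) ((\<sigma> n)\<^sup>2) ((\<sigma> n)\<^sup>2 * r n) = b n"
          using \<sigma>2(1) by (simp add: b_def rate_def)
        have Z: "Z n = L.Z" by (simp add: fun_eq_iff Z_def L.Z_def L.T_def lin_noise_def)
        obtain W where W: "integrable (M n) W" "\<forall>\<omega>\<in>space (M n). 0 \<le> W \<omega>"
          "L.expectation W \<le> (?\<kappa> * sqrt_fact_series 1 + (real (m n) + 1) * ?\<kappa> * K powr (s n / 2)) * b n"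
          "L.prob {\<omega>\<in>space (M n). \<bar>Z n \<omega>\<bar> > W \<omega>} \<le> 2 / K"
          using L.tail_spec[OF facts L.holder_form_le] elim(2) C0 unfolding b Z by blast
        have "(?\<kappa> * sqrt_fact_series 1 + (real (m n) + 1) * ?\<kappa> * K powr (s n / 2)) * b n \<le> ?c * b n"
          using mL sL K
          by (intro mult_right_mono b_nonneg[OF C0] add_left_mono mult_mono mult_nonneg_nonneg powr_mono) auto
        then show ?case using W by (intro exI[of _ W]) auto
      qed
    qed
  qed
  have HS: ?normal
    if d: "0 < d" and sn: "\<forall>\<^sub>F n in sequentially. (s n)\<^sup>2 \<le> real n"
      and i: "\<forall>\<^sub>F n in sequentially.
         (\<forall>k. 2 \<le> k \<and> real k < s n \<longrightarrow>
            spec_norm (H n) k (fderiv (H n) (f n) k (\<theta> n)) / ereal (d powr (real k / 2))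
              \<le> ereal (C\<^sub>0 n)) \<and>
         holder_seminorm_HS (H n) (B n) (f n) (s n) (\<theta> n)
           \<le> ereal (C\<^sub>0 n * d powr (real (smooth_order (s n)) / 2))" for d :: real
  proof (rule conv)
    fix K :: real assume K: "1 \<le> K"
    \<comment> \<open>The bounds above weigh order \<open>k\<close> by a plain power, so they are
      used with \<open>sqrt d\<close>.\<close>
    have d': "0 < sqrt d" using d by simp
    have dk: "d powr (real k / 2) = sqrt d ^ k" for k
      using powr_realpow[OF d', of k] d by (simp add: powr_half_sqrt[symmetric] powr_powr)
    let ?c = "2 * sqrt_fact_series (sqrt d) + 2 * sqrt K * sqrt_fact_series (3 * sqrt d * sqrt K)"
    show "\<exists>c. \<forall>\<^sub>F n in sequentially. ?tail n K c"
    proof (intro exI[of _ ?c])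
      show "\<forall>\<^sub>F n in sequentially. ?tail n K ?c"
        using loc i quant sn
      proof eventually_elim
        case (elim n)
        then interpret L: smooth_functional "M n" "H n" "B n" n "\<epsilon> n" "f n" "\<theta> n" "s n" "m n" "x n" by simp
        obtain h where h: "h \<in> H n" "norm h = 1" using elim by blast
        have sp: "spec_norm (H n) k (L.T k) \<le> ereal (C\<^sub>0 n * sqrt d ^ k)" if k: "2 \<le> k" "k \<le> m n" for k
        proof (rule ereal_divide_leD)
          show "spec_norm (H n) k (L.T k) / ereal (sqrt d ^ k) \<le> ereal (C\<^sub>0 n)"
            using elim(2) k L.m(3) by (auto simp: L.T_def simp flip: dk)
        qed (use d' in simp)
        have "0 \<le> C\<^sub>0 n * (sqrt d)\<^sup>2"
          using order_trans[OF spec_norm_nonneg[OF h] sp[of 2]] L.m_bounds by simp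
        then have C0: "0 \<le> C\<^sub>0 n" using d by (simp add: zero_le_mult_iff)
        have T_le: "form_le (H n) k (L.T k) (C\<^sub>0 n * sqrt d ^ k)" if "2 \<le> k" "k \<le> m n" for k
          using C0 d' by (intro spec_norm_form_le[OF L.H(1) L.T_multilinear sp] that) simp
        have "(real (m n))\<^sup>2 \<le> (s n)\<^sup>2" using L.m(3) by (intro power_mono) auto
        then have mn: "(real (m n))\<^sup>2 \<le> real n" using elim(4) by linarith
        have \<kappa>: "real n ^ l \<le> 2 * ffact n l" if "l \<le> m n" for l
          using L.n L.m_bounds by (intro power_le_2_ffact[OF _ that mn]) auto
        have s2: "(\<Sum>j=1..n. \<integral>\<omega>. (a \<bullet> \<epsilon> n j \<omega>)\<^sup>2 \<partial>M n) \<le> real n * (\<sigma> n)\<^sup>2 * (norm a)\<^sup>2"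
          if "a \<in> H n" for a using elim(3) that by blast
        have tr: "(\<Sum>j=1..n. L.e2 j) \<le> real n * ((\<sigma> n)\<^sup>2 * r n)" using elim(3) by blast
        have \<sigma>2: "0 < (\<sigma> n)\<^sup>2" "(\<sigma> n)\<^sup>2 \<le> (\<sigma> n)\<^sup>2 * r n" using elim(3) by blast+
        note facts = s2 \<sigma>2 tr \<kappa> K C0 d' T_le
        have b: "C\<^sub>0 n * rate n (s n) ((\<sigma> n)\<^sup>2) ((\<sigma> n)\<^sup>2 * r n) = b n"
          using \<sigma>2(1) by (simp add: b_def rate_def)
        have Z: "Z n = L.Z" by (simp add: fun_eq_iff Z_def L.Z_def L.T_def lin_noise_def)
        have "holder_seminorm_HS (H n) (B n) (f n) (s n) (\<theta> n) \<le> ereal (C\<^sub>0 n * sqrt d ^ m n)"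
          using elim(2) unfolding L.m(5) dk by blast
        then show ?case
          using L.tail_HS[OF facts L.holder_hs_norm_le] unfolding b Z by blast
      qed
    qed
  qed
  show ?thesis using spec HS by blast
qed

end
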